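(* The functor $Q_{\Delta}^K: Set^0_{\Delta}\to dgCoalg^0_k$ sends Kan weak equivalences of simplicial sets to $\Omega$-quasi-isomorphisms of dg coalgebras.
   Context: $k$ is a fixed commutative unital ring. $Set_\Delta^0$ is the full subcategory of simplicial sets $S$ with $S_0$ a singleton ($0$-reduced). $dgCoalg_k^0$ is the category of connected (degree $0$ part $\cong k$), counital dg coalgebras over $k$. For a pointed space $(X,b)$, $\mathrm{Sing}(X,b)$ is the sub-simplicial set of $\mathrm{Sing}(X)$ of singular simplices $|\Delta^n|\to X$ sending all vertices of $|\Delta^n|$ to $b$. For $S\in Set^0_\Delta$ with $S_0=\{x\}$, $Q^K_\Delta(S):=Q_\Delta(\mathrm{Sing}(|S|,x))$. $Q_\Delta(S)$ is the dg coalgebra of normalized simplicial chains with the Alexander-Whitney coproduct $\Delta(\sigma)=\sum_{p+q=n}f^p(\sigma)\otimes l^q(\sigma)$, $\sigma\in S_n$, where $f^p$ is the front $p$-face ($[p]\to[p+q]$, $i\mapsto i$) and $l^q$ the last $q$-face ($[q]\to[p+q]$, $i\mapsto i+p$). Cobar construction of a connected dg coalgebra $(C,\partial,\Delta)$, free over $k$ in each degree: let $\overline C_i=C_i$ for $i>0$, $\overline C_0=0$, $(s\overline C)_i=\overline C_{i+1}$, and $\Delta(c)=c\otimes1+1\otimes c+\sum c'\otimes c''$ for $c\in\overline C$. Then $\Omega C$ is the tensor algebra $k\oplus s\overline C\oplus(s\overline C)^{\otimes2}\oplus\cdots$ with differential the derivation extending $D(sc)=-s\partial c+\sum(-1)^{\deg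 c'}sc'\otimes sc''$. A map of simplicial sets is a Kan weak equivalence if its geometric realization is a weak homotopy equivalence. A map $f:C\to C'$ of connected dg coalgebras is an $\Omega$-quasi-isomorphism if $\Omega f:\Omega C\to\Omega C'$ is a quasi-isomorphism of dga's. *)

theory Defs
  imports "HOL-Homology.Simplices" "HOL-Analysis.Sum_Topology" "HOL-Analysis.Homotopy"
begin

section \<open>Simplicial sets\<close>

text \<open>Morphisms [m] to [n] of the simplex category are extensional functions on {0..m}, so that
  equality of morphisms is equality in HOL and composition is \<^const>\<open>compose\<close>.\<close>

definition Delta :: "nat \<Rightarrow> nat \<Rightarrow> (nat \<Rightarrow> nat) set" where
  "Delta m n = {\<theta> \<in> {..m} \<rightarrow>\<^sub>E {..n}. mono_on {..m} \<theta>}"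

definition coface :: "nat \<Rightarrow> nat \<Rightarrow> nat \<Rightarrow> nat" where
  "coface n i = (\<lambda>j\<in>{..n - 1}. if j < i then j else Suc j)"

definition codegen :: "nat \<Rightarrow> nat \<Rightarrow> nat \<Rightarrow> nat" where
  "codegen n i = (\<lambda>j\<in>{..Suc n}. if j \<le> i then j else j - 1)"

definition front_inc :: "nat \<Rightarrow> nat \<Rightarrow> nat" where
  "front_inc p = (\<lambda>i\<in>{..p}. i)"

definition last_inc :: "nat \<Rightarrow> nat \<Rightarrow> nat \<Rightarrow> nat" where
  "last_inc p q = (\<lambda>i\<in>{..q}. i + p)"

text \<open>\<open>act X n m \<theta>\<close> is the operator from n-simplices to m-simplices induced by
  \<open>\<theta> \<in> Delta m n\<close>.\<close>

record 'a sset =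
  simplices :: "nat \<Rightarrow> 'a set"
  act :: "nat \<Rightarrow> nat \<Rightarrow> (nat \<Rightarrow> nat) \<Rightarrow> 'a \<Rightarrow> 'a"

definition simplicial_set :: "'a sset \<Rightarrow> bool" where
  "simplicial_set X \<longleftrightarrow>
     (\<forall>n m. \<forall>\<theta>\<in>Delta m n. \<forall>x\<in>simplices X n. act X n m \<theta> x \<in> simplices X m) \<and>
     (\<forall>n. \<forall>x\<in>simplices X n. act X n n (\<lambda>i\<in>{..n}. i) x = x) \<and>
     (\<forall>n m l. \<forall>\<theta>\<in>Delta m n. \<forall>\<eta>\<in>Delta l m. \<forall>x\<in>simplices X n.
        act X m l \<eta> (act X n m \<theta> x) = act X n l (compose {..l} \<theta> \<eta>) x)"

definition reduced_sset :: "'a sset \<Rightarrow> bool" where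
  "reduced_sset X \<longleftrightarrow> simplicial_set X \<and> (\<exists>x. simplices X 0 = {x})"

definition sset_map :: "'a sset \<Rightarrow> 'b sset \<Rightarrow> (nat \<Rightarrow> 'a \<Rightarrow> 'b) \<Rightarrow> bool" where
  "sset_map X Y f \<longleftrightarrow>
     (\<forall>n. \<forall>x\<in>simplices X n. f n x \<in> simplices Y n) \<and>
     (\<forall>n m. \<forall>\<theta>\<in>Delta m n. \<forall>x\<in>simplices X n. f m (act X n m \<theta> x) = act Y n m \<theta> (f n x))"

definition degenerate :: "'a sset \<Rightarrow> nat \<Rightarrow> 'a \<Rightarrow> bool" where
  "degenerate X n x \<longleftrightarrow>
     (\<exists>m i. n = Suc m \<and> i \<le> m \<and> (\<exists>y\<in>simplices X m. x = act X m n (codegen m i) y))"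

section \<open>Geometric realization and singular simplices\<close>

definition quotient_topology :: "'a topology \<Rightarrow> ('a \<times> 'a) set \<Rightarrow> 'a set topology" where
  "quotient_topology X R = topology (\<lambda>U. U \<subseteq> topspace X // R \<and> openin X (\<Union>U))"

abbreviation simplex_space :: "nat \<Rightarrow> (nat \<Rightarrow> real) topology" where
  "simplex_space n \<equiv> subtopology (powertop_real UNIV) (standard_simplex n)"

text \<open>The affine map of standard simplices given on vertices by \<open>\<theta>\<close>.\<close>

definition simplex_push :: "nat \<Rightarrow> (nat \<Rightarrow> nat) \<Rightarrow> (nat \<Rightarrow> real) \<Rightarrow> nat \<Rightarrow> real" where
  "simplex_push m \<theta> t = (\<lambda>j. \<Sum>i | i \<le> m \<and> \<theta> i = j. t i)"

abbreviation std_vertex :: "nat \<Rightarrow> nat \<Rightarrow> real" where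
  "std_vertex i \<equiv> (\<lambda>j. if j = i then 1 else 0)"

definition pre_realization :: "'a sset \<Rightarrow> (nat \<times> 'a \<times> (nat \<Rightarrow> real)) topology" where
  "pre_realization X =
     sum_topology (\<lambda>n. prod_topology (discrete_topology (simplices X n)) (simplex_space n)) UNIV"

definition glue :: "'a sset \<Rightarrow> ((nat \<times> 'a \<times> (nat \<Rightarrow> real)) \<times> (nat \<times> 'a \<times> (nat \<Rightarrow> real))) set" where
  "glue X = {((m, act X n m \<theta> x, t), (n, x, simplex_push m \<theta> t)) | m n \<theta> x t.
               \<theta> \<in> Delta m n \<and> x \<in> simplices X n \<and> t \<in> standard_simplex m}"

definition glue_equiv :: "'a sset \<Rightarrow> ((nat \<times> 'a \<times> (nat \<Rightarrow> real)) \<times> (nat \<times> 'a \<times> (nat \<Rightarrow> real))) set" where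
  "glue_equiv X = (glue X \<union> (glue X)\<inverse>)\<^sup>* \<inter> topspace (pre_realization X) \<times> topspace (pre_realization X)"

definition realization :: "'a sset \<Rightarrow> (nat \<times> 'a \<times> (nat \<Rightarrow> real)) set topology" where
  "realization X = quotient_topology (pre_realization X) (glue_equiv X)"

text \<open>A point of the realization is a class of the gluing relation; the map below sends the class
  of \<open>(n, x, t)\<close> to the class of \<open>(n, f n x, t)\<close>.\<close>

definition realization_map ::
    "'b sset \<Rightarrow> (nat \<Rightarrow> 'a \<Rightarrow> 'b) \<Rightarrow> (nat \<times> 'a \<times> (nat \<Rightarrow> real)) set \<Rightarrow> (nat \<times> 'b \<times> (nat \<Rightarrow> real)) set" where
  "realization_map Y f c = glue_equiv Y `` ((\<lambda>(n, x, t). (n, f n x, t)) ` c)"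

definition realization_base :: "'a sset \<Rightarrow> (nat \<times> 'a \<times> (nat \<Rightarrow> real)) set" where
  "realization_base X = glue_equiv X `` {(0, the_elem (simplices X 0), std_vertex 0)}"

definition Sing :: "'a topology \<Rightarrow> 'a \<Rightarrow> ((nat \<Rightarrow> real) \<Rightarrow> 'a) sset" where
  "Sing X b =
     \<lparr>simplices = (\<lambda>n. {\<sigma>. singular_simplex n X \<sigma> \<and> (\<forall>i\<le>n. \<sigma> (std_vertex i) = b)}),
      act = (\<lambda>n m \<theta> \<sigma>. restrict (\<sigma> \<circ> simplex_push m \<theta>) (standard_simplex m))\<rparr>"

section \<open>Weak homotopy equivalences\<close>

definition cube :: "nat \<Rightarrow> (nat \<Rightarrow> real) topology" where
  "cube n = product_topology (\<lambda>_. top_of_set {0..1}) {..<n}"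

definition cube_boundary :: "nat \<Rightarrow> (nat \<Rightarrow> real) set" where
  "cube_boundary n = {t \<in> topspace (cube n). \<exists>i<n. t i = 0 \<or> t i = 1}"

definition spheroids :: "nat \<Rightarrow> 'a topology \<Rightarrow> 'a \<Rightarrow> ((nat \<Rightarrow> real) \<Rightarrow> 'a) set" where
  "spheroids n X b = {g. continuous_map (cube n) X g \<and> g \<in> extensional (topspace (cube n)) \<and>
                         (\<forall>t\<in>cube_boundary n. g t = b)}"

definition homotopy_rel ::
    "nat \<Rightarrow> 'a topology \<Rightarrow> 'a \<Rightarrow> (((nat \<Rightarrow> real) \<Rightarrow> 'a) \<times> ((nat \<Rightarrow> real) \<Rightarrow> 'a)) set" where
  "homotopy_rel n X b = {(g, h). g \<in> spheroids n X b \<and> h \<in> spheroids n X b \<and>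
      homotopic_with (\<lambda>u. \<forall>t\<in>cube_boundary n. u t = b) (cube n) X g h}"

definition homotopy_classes :: "nat \<Rightarrow> 'a topology \<Rightarrow> 'a \<Rightarrow> ((nat \<Rightarrow> real) \<Rightarrow> 'a) set set" where
  "homotopy_classes n X b = spheroids n X b // homotopy_rel n X b"

definition homotopy_induced :: "nat \<Rightarrow> 'a topology \<Rightarrow> 'b topology \<Rightarrow> ('a \<Rightarrow> 'b) \<Rightarrow> 'a \<Rightarrow>
    ((nat \<Rightarrow> real) \<Rightarrow> 'a) set \<Rightarrow> ((nat \<Rightarrow> real) \<Rightarrow> 'b) set" where
  "homotopy_induced n X Y f b c =
     homotopy_rel n Y (f b) `` ((\<lambda>g. restrict (f \<circ> g) (topspace (cube n))) ` c)"

text \<open>For \<open>n \<ge> 1\<close> the map induced on the n-th homotopy groups is a group homomorphism for every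
  continuous map, so it is an isomorphism iff it is bijective on the underlying sets.\<close>

definition weak_homotopy_equivalence :: "'a topology \<Rightarrow> 'b topology \<Rightarrow> ('a \<Rightarrow> 'b) \<Rightarrow> bool" where
  "weak_homotopy_equivalence X Y f \<longleftrightarrow>
     continuous_map X Y f \<and>
     bij_betw (\<lambda>C. \<Union>x\<in>C. path_component_of_set Y (f x)) (path_components_of X) (path_components_of Y) \<and>
     (\<forall>n\<ge>1. \<forall>b\<in>topspace X.
        bij_betw (homotopy_induced n X Y f b) (homotopy_classes n X b) (homotopy_classes n Y (f b)))"

definition kan_weak_equivalence :: "'a sset \<Rightarrow> 'b sset \<Rightarrow> (nat \<Rightarrow> 'a \<Rightarrow> 'b) \<Rightarrow> bool" where
  "kan_weak_equivalence X Y f \<longleftrightarrow>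
     sset_map X Y f \<and> weak_homotopy_equivalence (realization X) (realization Y) (realization_map Y f)"

section \<open>Free modules\<close>

text \<open>The free module on a set of type \<open>'b\<close> consists of the finitely supported functions
  with support in that set. Tensor products of free modules are free on pairs of basis elements.\<close>

definition smul :: "'k::comm_ring_1 \<Rightarrow> ('b \<Rightarrow>\<^sub>0 'k) \<Rightarrow> ('b \<Rightarrow>\<^sub>0 'k)" where
  "smul a x = Poly_Mapping.map ((*) a) x"

abbreviation gen :: "'b \<Rightarrow> ('b \<Rightarrow>\<^sub>0 'k::comm_ring_1)" where
  "gen b \<equiv> Poly_Mapping.single b 1"

definition lin :: "('b \<Rightarrow> ('c \<Rightarrow>\<^sub>0 'k)) \<Rightarrow> ('b \<Rightarrow>\<^sub>0 'k::comm_ring_1) \<Rightarrow> ('c \<Rightarrow>\<^sub>0 'k)" where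
  "lin f x = (\<Sum>b\<in>Poly_Mapping.keys x. smul (Poly_Mapping.lookup x b) (f b))"

definition lin_form :: "('b \<Rightarrow> 'k) \<Rightarrow> ('b \<Rightarrow>\<^sub>0 'k::comm_ring_1) \<Rightarrow> 'k" where
  "lin_form e x = (\<Sum>b\<in>Poly_Mapping.keys x. Poly_Mapping.lookup x b * e b)"

definition bilin :: "('b \<Rightarrow> 'c \<Rightarrow> 'd) \<Rightarrow> ('b \<Rightarrow>\<^sub>0 'k) \<Rightarrow> ('c \<Rightarrow>\<^sub>0 'k) \<Rightarrow> ('d \<Rightarrow>\<^sub>0 'k::comm_ring_1)" where
  "bilin p x y = lin (\<lambda>a. lin (\<lambda>b. gen (p a b)) y) x"

abbreviation tensor :: "('b \<Rightarrow>\<^sub>0 'k) \<Rightarrow> ('c \<Rightarrow>\<^sub>0 'k) \<Rightarrow> ('b \<times> 'c \<Rightarrow>\<^sub>0 'k::comm_ring_1)" where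
  "tensor \<equiv> bilin Pair"

section \<open>Connected dg coalgebras, free over the ground ring\<close>

text \<open>A dg coalgebra that is free over the ground ring in each degree is given by a homogeneous
  basis together with the values of its structure maps on basis elements; morphisms are arbitrary
  (not basis preserving) and are also given by their values on basis elements. In the connected
  case the basis of the degree 0 part is the single element 1, on which the counit takes the
  value 1.\<close>

record (overloaded) ('b, 'k) dgc =
  basis :: "'b set"
  bdeg :: "'b \<Rightarrow> nat"
  bd :: "'b \<Rightarrow> ('b \<Rightarrow>\<^sub>0 'k)"
  cop :: "'b \<Rightarrow> ('b \<times> 'b \<Rightarrow>\<^sub>0 'k)"
  counit :: "'b \<Rightarrow> 'k"
  unit_elt :: "'b"

definition connected_dg_coalgebra :: "('b, 'k::comm_ring_1) dgc \<Rightarrow> bool" where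
  "connected_dg_coalgebra C \<longleftrightarrow>
     (\<forall>b\<in>basis C. Poly_Mapping.keys (bd C b) \<subseteq> {a \<in> basis C. bdeg C a + 1 = bdeg C b}) \<and>
     (\<forall>b\<in>basis C. lin (bd C) (bd C b) = 0) \<and>
     (\<forall>b\<in>basis C. Poly_Mapping.keys (cop C b) \<subseteq>
        {(x, y). x \<in> basis C \<and> y \<in> basis C \<and> bdeg C x + bdeg C y = bdeg C b}) \<and>
     \<comment> \<open>the coproduct is a chain map and is coassociative\<close>
     (\<forall>b\<in>basis C. lin (cop C) (bd C b) =
        lin (\<lambda>(x, y). tensor (bd C x) (gen y) + smul ((-1) ^ bdeg C x) (tensor (gen x) (bd C y))) (cop C b)) \<and>
     (\<forall>b\<in>basis C. lin (\<lambda>(x, y). lin (\<lambda>(x1, x2). gen (x1, x2, y)) (cop C x)) (cop C b) =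
                  lin (\<lambda>(x, y). lin (\<lambda>(y1, y2). gen (x, y1, y2)) (cop C y)) (cop C b)) \<and>
     \<comment> \<open>counit: a chain map of degree 0, with the two counit laws\<close>
     (\<forall>b\<in>basis C. 0 < bdeg C b \<longrightarrow> counit C b = 0) \<and>
     (\<forall>b\<in>basis C. lin_form (counit C) (bd C b) = 0) \<and>
     (\<forall>b\<in>basis C. lin (\<lambda>(x, y). smul (counit C x) (gen y)) (cop C b) = gen b) \<and>
     (\<forall>b\<in>basis C. lin (\<lambda>(x, y). smul (counit C y) (gen x)) (cop C b) = gen b) \<and>
     \<comment> \<open>connectedness\<close>
     {b \<in> basis C. bdeg C b = 0} = {unit_elt C} \<and> counit C (unit_elt C) = 1"

definition dg_coalgebra_map ::
    "('b, 'k::comm_ring_1) dgc \<Rightarrow> ('c, 'k) dgc \<Rightarrow> ('b \<Rightarrow> ('c \<Rightarrow>\<^sub>0 'k)) \<Rightarrow> bool" where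
  "dg_coalgebra_map C C' \<phi> \<longleftrightarrow>
     (\<forall>b\<in>basis C. Poly_Mapping.keys (\<phi> b) \<subseteq> {c \<in> basis C'. bdeg C' c = bdeg C b}) \<and>
     (\<forall>b\<in>basis C. lin \<phi> (bd C b) = lin (bd C') (\<phi> b)) \<and>
     (\<forall>b\<in>basis C. lin (\<lambda>(x, y). tensor (\<phi> x) (\<phi> y)) (cop C b) = lin (cop C') (\<phi> b)) \<and>
     (\<forall>b\<in>basis C. lin_form (counit C') (\<phi> b) = counit C b)"

section \<open>Dg algebras and the cobar construction\<close>

record (overloaded) ('w, 'k) dga =
  grade :: "nat \<Rightarrow> ('w \<Rightarrow>\<^sub>0 'k) set"
  diff :: "('w \<Rightarrow>\<^sub>0 'k) \<Rightarrow> ('w \<Rightarrow>\<^sub>0 'k)"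
  amul :: "('w \<Rightarrow>\<^sub>0 'k) \<Rightarrow> ('w \<Rightarrow>\<^sub>0 'k) \<Rightarrow> ('w \<Rightarrow>\<^sub>0 'k)"
  aone :: "'w \<Rightarrow>\<^sub>0 'k"

definition dga_map ::
    "('v, 'k::comm_ring_1) dga \<Rightarrow> ('w, 'k) dga \<Rightarrow> (('v \<Rightarrow>\<^sub>0 'k) \<Rightarrow> ('w \<Rightarrow>\<^sub>0 'k)) \<Rightarrow> bool" where
  "dga_map A B h \<longleftrightarrow>
     (\<forall>n. \<forall>x\<in>grade A n. h x \<in> grade B n \<and> h (diff A x) = diff B (h x)) \<and>
     (\<forall>n. \<forall>x\<in>grade A n. \<forall>y\<in>grade A n. h (x + y) = h x + h y) \<and>
     (\<forall>n r. \<forall>x\<in>grade A n. h (smul r x) = smul r (h x)) \<and>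
     (\<forall>m n. \<forall>x\<in>grade A m. \<forall>y\<in>grade A n. h (amul A x y) = amul B (h x) (h y)) \<and>
     h (aone A) = aone B"

definition cycles :: "('w, 'k::comm_ring_1) dga \<Rightarrow> nat \<Rightarrow> ('w \<Rightarrow>\<^sub>0 'k) set" where
  "cycles A n = {x \<in> grade A n. diff A x = 0}"

definition homologous :: "('w, 'k::comm_ring_1) dga \<Rightarrow> nat \<Rightarrow> (('w \<Rightarrow>\<^sub>0 'k) \<times> ('w \<Rightarrow>\<^sub>0 'k)) set" where
  "homologous A n = {(x, y). x \<in> cycles A n \<and> y \<in> cycles A n \<and> x - y \<in> diff A ` grade A (Suc n)}"

definition dga_homology :: "('w, 'k::comm_ring_1) dga \<Rightarrow> nat \<Rightarrow> ('w \<Rightarrow>\<^sub>0 'k) set set" where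
  "dga_homology A n = cycles A n // homologous A n"

text \<open>The map induced on homology by a map of dg algebras is linear, so it is an isomorphism iff it
  is bijective.\<close>

definition dga_quasi_iso ::
    "('v, 'k::comm_ring_1) dga \<Rightarrow> ('w, 'k) dga \<Rightarrow> (('v \<Rightarrow>\<^sub>0 'k) \<Rightarrow> ('w \<Rightarrow>\<^sub>0 'k)) \<Rightarrow> bool" where
  "dga_quasi_iso A B h \<longleftrightarrow> dga_map A B h \<and>
     (\<forall>n. bij_betw (\<lambda>c. homologous B n `` (h ` c)) (dga_homology A n) (dga_homology B n))"

text \<open>The tensor algebra on the desuspension of the positive degree part is free on words in the
  basis elements of positive degree, the letter \<open>b\<close> standing for \<open>s b\<close> of degree
  \<open>bdeg C b - 1\<close>; multiplication is concatenation.\<close>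

definition cobar_words :: "('b, 'k::comm_ring_1) dgc \<Rightarrow> nat \<Rightarrow> 'b list set" where
  "cobar_words C n =
     {w. set w \<subseteq> {b \<in> basis C. 0 < bdeg C b} \<and> sum_list (map (\<lambda>b. bdeg C b - 1) w) = n}"

abbreviation concat_mul :: "('b list \<Rightarrow>\<^sub>0 'k) \<Rightarrow> ('b list \<Rightarrow>\<^sub>0 'k) \<Rightarrow> ('b list \<Rightarrow>\<^sub>0 'k::comm_ring_1)" where
  "concat_mul \<equiv> bilin (@)"

definition desusp :: "('b, 'k::comm_ring_1) dgc \<Rightarrow> ('b \<Rightarrow>\<^sub>0 'k) \<Rightarrow> ('b list \<Rightarrow>\<^sub>0 'k)" where
  "desusp C = lin (\<lambda>b. if bdeg C b = 0 then 0 else gen [b])"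

definition reduced_cop :: "('b, 'k::comm_ring_1) dgc \<Rightarrow> 'b \<Rightarrow> ('b \<times> 'b \<Rightarrow>\<^sub>0 'k)" where
  "reduced_cop C b = cop C b - gen (b, unit_elt C) - gen (unit_elt C, b)"

definition cobar_gen_diff :: "('b, 'k::comm_ring_1) dgc \<Rightarrow> 'b \<Rightarrow> ('b list \<Rightarrow>\<^sub>0 'k)" where
  "cobar_gen_diff C b =
     - desusp C (bd C b) +
     lin (\<lambda>(x, y). smul ((-1) ^ bdeg C x) (concat_mul (desusp C (gen x)) (desusp C (gen y))))
         (reduced_cop C b)"

primrec cobar_word_diff :: "('b, 'k::comm_ring_1) dgc \<Rightarrow> 'b list \<Rightarrow> ('b list \<Rightarrow>\<^sub>0 'k)" where
  "cobar_word_diff C [] = 0"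
| "cobar_word_diff C (b # w) =
     concat_mul (cobar_gen_diff C b) (gen w) +
     smul ((-1) ^ (bdeg C b - 1)) (concat_mul (gen [b]) (cobar_word_diff C w))"

definition cobar :: "('b, 'k::comm_ring_1) dgc \<Rightarrow> ('b list, 'k) dga" where
  "cobar C = \<lparr>grade = (\<lambda>n. {x. Poly_Mapping.keys x \<subseteq> cobar_words C n}),
              diff = lin (cobar_word_diff C),
              amul = concat_mul,
              aone = gen []\<rparr>"

primrec cobar_word_map ::
    "('c, 'k::comm_ring_1) dgc \<Rightarrow> ('b \<Rightarrow> ('c \<Rightarrow>\<^sub>0 'k)) \<Rightarrow> 'b list \<Rightarrow> ('c list \<Rightarrow>\<^sub>0 'k)" where
  "cobar_word_map C' \<phi> [] = gen []"
| "cobar_word_map C' \<phi> (b # w) = concat_mul (desusp C' (\<phi> b)) (cobar_word_map C' \<phi> w)"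

definition cobar_map ::
    "('c, 'k::comm_ring_1) dgc \<Rightarrow> ('b \<Rightarrow> ('c \<Rightarrow>\<^sub>0 'k)) \<Rightarrow> ('b list \<Rightarrow>\<^sub>0 'k) \<Rightarrow> ('c list \<Rightarrow>\<^sub>0 'k)" where
  "cobar_map C' \<phi> = lin (cobar_word_map C' \<phi>)"

definition omega_quasi_iso ::
    "('b, 'k::comm_ring_1) dgc \<Rightarrow> ('c, 'k) dgc \<Rightarrow> ('b \<Rightarrow> ('c \<Rightarrow>\<^sub>0 'k)) \<Rightarrow> bool" where
  "omega_quasi_iso C C' \<phi> \<longleftrightarrow>
     connected_dg_coalgebra C \<and> connected_dg_coalgebra C' \<and> dg_coalgebra_map C C' \<phi> \<and>
     dga_quasi_iso (cobar C) (cobar C') (cobar_map C' \<phi>)"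

section \<open>Normalized chains\<close>

text \<open>The degenerate simplices span a free summand of the simplicial chains, so the quotient is free
  on the nondegenerate simplices. \<open>nchain X n x\<close> is the class in this quotient of an arbitrary
  n-simplex \<open>x\<close>.\<close>

definition nchain :: "'a sset \<Rightarrow> nat \<Rightarrow> 'a \<Rightarrow> (nat \<times> 'a \<Rightarrow>\<^sub>0 'k::comm_ring_1)" where
  "nchain X n x = (if degenerate X n x then 0 else gen (n, x))"

definition Q_Delta :: "'a sset \<Rightarrow> (nat \<times> 'a, 'k::comm_ring_1) dgc" where
  "Q_Delta X =
     \<lparr>basis = {(n, x). x \<in> simplices X n \<and> \<not> degenerate X n x},
      bdeg = fst,
      bd = (\<lambda>(n, x). if n = 0 then 0 else
              (\<Sum>i\<le>n. smul ((-1) ^ i) (nchain X (n - 1) (act X n (n - 1) (coface n i) x)))),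
      cop = (\<lambda>(n, x). \<Sum>p\<le>n. tensor (nchain X p (act X n p (front_inc p) x))
                                    (nchain X (n - p) (act X n (n - p) (last_inc p (n - p)) x))),
      counit = (\<lambda>(n, x). if n = 0 then 1 else 0),
      unit_elt = (0, the_elem (simplices X 0))\<rparr>"

definition Q_Delta_map :: "'b sset \<Rightarrow> (nat \<Rightarrow> 'a \<Rightarrow> 'b) \<Rightarrow> nat \<times> 'a \<Rightarrow> (nat \<times> 'b \<Rightarrow>\<^sub>0 'k::comm_ring_1)" where
  "Q_Delta_map Y f = (\<lambda>(n, x). nchain Y n (f n x))"

type_synonym 'a realization_point = "(nat \<times> 'a \<times> (nat \<Rightarrow> real)) set"

definition Sing_realization :: "'a sset \<Rightarrow> ((nat \<Rightarrow> real) \<Rightarrow> 'a realization_point) sset" where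
  "Sing_realization X = Sing (realization X) (realization_base X)"

definition QK :: "'a sset \<Rightarrow> (nat \<times> ((nat \<Rightarrow> real) \<Rightarrow> 'a realization_point), 'k::comm_ring_1) dgc" where
  "QK X = Q_Delta (Sing_realization X)"

definition QK_map :: "'b sset \<Rightarrow> (nat \<Rightarrow> 'a \<Rightarrow> 'b) \<Rightarrow> nat \<times> ((nat \<Rightarrow> real) \<Rightarrow> 'a realization_point) \<Rightarrow>
    (nat \<times> ((nat \<Rightarrow> real) \<Rightarrow> 'b realization_point) \<Rightarrow>\<^sub>0 'k::comm_ring_1)" where
  "QK_map Y f = Q_Delta_map (Sing_realization Y) (\<lambda>n. simplex_map n (realization_map Y f))"

section \<open>Basic facts\<close>

lemma istopology_quotient:
  assumes "equiv (topspace X) R"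
  shows "istopology (\<lambda>U. U \<subseteq> topspace X // R \<and> openin X (\<Union>U))"
proof -
  have "\<Union>(U \<inter> V) = \<Union>U \<inter> \<Union>V" if "U \<subseteq> topspace X // R" "V \<subseteq> topspace X // R" for U V
  proof
    show "\<Union>U \<inter> \<Union>V \<subseteq> \<Union>(U \<inter> V)"
    proof
      fix x assume "x \<in> \<Union>U \<inter> \<Union>V"
      then obtain A B where "A \<in> U" "B \<in> V" "x \<in> A" "x \<in> B" by blast
      with that quotient_disj[OF assms, of A B] have "A = B" by blast
      with \<open>A \<in> U\<close> \<open>B \<in> V\<close> \<open>x \<in> A\<close> show "x \<in> \<Union>(U \<inter> V)" by blast
    qed
  qed blast
  moreover have "openin X (\<Union>(\<Union>K))" if "\<forall>U\<in>K. openin X (\<Union>U)" for K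
  proof -
    have "\<Union>(\<Union>K) = \<Union>(Union ` K)" by blast
    with that show ?thesis by (metis (no_types, lifting) image_iff openin_Union)
  qed
  ultimately show ?thesis
    unfolding istopology_def by (auto simp: openin_Int)
qed

lemma openin_quotient_topology:
  assumes "equiv (topspace X) R"
  shows "openin (quotient_topology X R) U \<longleftrightarrow> U \<subseteq> topspace X // R \<and> openin X (\<Union>U)"
  using fun_cong[OF topology_inverse'[OF istopology_quotient[OF assms]]]
  unfolding quotient_topology_def .

lemma topspace_quotient_topology:
  assumes "equiv (topspace X) R"
  shows "topspace (quotient_topology X R) = topspace X // R"
proof
  show "topspace (quotient_topology X R) \<subseteq> topspace X // R"
    using openin_quotient_topology[OF assms, of "topspace (quotient_topology X R)"] by blast
  have "openin (quotient_topology X R) (topspace X // R)"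
    by (simp add: openin_quotient_topology[OF assms] Union_quotient[OF assms])
  then show "topspace X // R \<subseteq> topspace (quotient_topology X R)"
    by (rule openin_subset)
qed

lemma quotient_map_quotient_topology:
  assumes "equiv (topspace X) R"
  shows "quotient_map X (quotient_topology X R) (\<lambda>x. R `` {x})"
proof -
  have "{x \<in> topspace X. R `` {x} \<in> U} = \<Union>U" if U: "U \<subseteq> topspace X // R" for U
  proof
    show "{x \<in> topspace X. R `` {x} \<in> U} \<subseteq> \<Union>U"
      using equiv_class_self[OF assms] by blast
    show "\<Union>U \<subseteq> {x \<in> topspace X. R `` {x} \<in> U}"
    proof
      fix x assume "x \<in> \<Union>U"
      then obtain A where A: "A \<in> U" "x \<in> A" by blast
      then obtain a where a: "A = R `` {a}" "a \<in> topspace X"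
        using U unfolding quotient_def by blast
      with A have "(a, x) \<in> R" by blast
      then have "R `` {x} \<in> U" "x \<in> topspace X"
        using A(1) a(1) equiv_class_eq[OF assms, of a x] subsetD[OF equiv_type[OF assms], of "(a, x)"]
        by simp_all
      then show "x \<in> {x \<in> topspace X. R `` {x} \<in> U}" by simp
    qed
  qed
  note pre = this
  have "(\<lambda>x. R `` {x}) ` topspace X = topspace X // R"
    unfolding quotient_def by blast
  moreover have "openin X {x \<in> topspace X. R `` {x} \<in> U} \<longleftrightarrow> U \<subseteq> topspace X // R \<and> openin X (\<Union>U)"
    if "U \<subseteq> topspace X // R" for U
    unfolding pre[OF that] using that by simp
  ultimately show ?thesis
    unfolding quotient_map_def topspace_quotient_topology[OF assms]
      openin_quotient_topology[OF assms] by simp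
qed

lemma equiv_glue_equiv: "equiv (topspace (pre_realization X)) (glue_equiv X)"
proof (rule equivI)
  have "sym ((glue X \<union> (glue X)\<inverse>)\<^sup>*)"
    by (intro sym_rtrancl) (auto simp: sym_def)
  then show "sym (glue_equiv X)"
    unfolding glue_equiv_def sym_def by blast
  show "trans (glue_equiv X)"
    unfolding glue_equiv_def by (intro trans_Int trans_rtrancl) (auto simp: trans_def)
  show "refl_on (topspace (pre_realization X)) (glue_equiv X)"
    unfolding glue_equiv_def refl_on_def by blast
  show "glue_equiv X \<subseteq> topspace (pre_realization X) \<times> topspace (pre_realization X)"
    unfolding glue_equiv_def by blast
qed

lemma in_pre_realization:
  "(n, x, t) \<in> topspace (pre_realization X) \<longleftrightarrow> x \<in> simplices X n \<and> t \<in> standard_simplex n"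
  by (simp add: pre_realization_def)

lemma realization_map_class:
  assumes f: "sset_map X Y f" and x: "x \<in> simplices X n" "t \<in> standard_simplex n"
  shows "realization_map Y f (glue_equiv X `` {(n, x, t)}) = glue_equiv Y `` {(n, f n x, t)}"
proof -
  define F :: "nat \<times> 'a \<times> (nat \<Rightarrow> real) \<Rightarrow> nat \<times> 'b \<times> (nat \<Rightarrow> real)"
    where "F = (\<lambda>(n, x, t). (n, f n x, t))"
  have top: "F p \<in> topspace (pre_realization Y)" if "p \<in> topspace (pre_realization X)" for p
    using that f by (cases p) (auto simp: in_pre_realization F_def sset_map_def)
  have step: "(F p, F q) \<in> glue Y" if "(p, q) \<in> glue X" for p q
    using that f unfolding glue_def F_def sset_map_def by fastforce
  have "(F p, F q) \<in> (glue Y \<union> (glue Y)\<inverse>)\<^sup>*" if "(p, q) \<in> (glue X \<union> (glue X)\<inverse>)\<^sup>*" for p q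
    using that
  proof (induction rule: rtrancl_induct)
    case (step q r)
    then have "(F q, F r) \<in> glue Y \<union> (glue Y)\<inverse>"
      using \<open>\<And>p q. (p, q) \<in> glue X \<Longrightarrow> (F p, F q) \<in> glue Y\<close> by blast
    with step.IH show ?case by (rule rtrancl_into_rtrancl)
  qed simp
  then have F: "(F p, F q) \<in> glue_equiv Y" if "(p, q) \<in> glue_equiv X" for p q
    using that top unfolding glue_equiv_def by blast
  have "((n, x, t), (n, x, t)) \<in> glue_equiv X"
    using x unfolding glue_equiv_def by (simp add: in_pre_realization)
  then have "glue_equiv Y `` (F ` (glue_equiv X `` {(n, x, t)})) = glue_equiv Y `` {F (n, x, t)}"
    using F equiv_class_eq[OF equiv_glue_equiv[of Y]] by blast
  then show ?thesis
    by (simp add: realization_map_def F_def)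
qed

lemma simplex_push_in_standard_simplex:
  assumes "\<theta> \<in> Delta m n" "t \<in> standard_simplex m"
  shows "simplex_push m \<theta> t \<in> standard_simplex n"
proof -
  have t: "0 \<le> t i" "(\<Sum>i\<le>m. t i) = 1" for i
    using assms(2) by (auto simp: standard_simplex_def)
  have \<theta>: "\<theta> ` {..m} \<subseteq> {..n}"
    using assms(1) by (auto simp: Delta_def)
  have "simplex_push m \<theta> t j \<le> (\<Sum>i\<le>m. t i)" for j
    unfolding simplex_push_def by (rule sum_mono2) (auto simp: t)
  moreover have "simplex_push m \<theta> t j = 0" if "j > n" for j
    using that \<theta> unfolding simplex_push_def by (intro sum.neutral) force
  moreover have "(\<Sum>j\<le>n. simplex_push m \<theta> t j) = (\<Sum>i\<le>m. t i)"
    using sum.group[of "{..m}" "{..n}" \<theta> t] \<theta> by (simp add: simplex_push_def)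
  ultimately show ?thesis
    by (simp add: standard_simplex_def t simplex_push_def sum_nonneg)
qed

end

theory Submission
  imports Defs
begin

text \<open>A weak homotopy equivalence \<open>g\<close> induces a homotopy equivalence on the reduced simplicial sets
  of singular simplices with all vertices at the base point, and the cobar construction of the normalized
  chains turns simplicial homotopies into chain homotopies. The two halves are independent.

  The algebraic half. The prism operator of a simplicial homotopy that is constant on the base point is not
  only a chain homotopy, it is also strictly compatible with the Alexander-Whitney coproduct: an
  Alexander-Whitney cut of a simplex of the prism separates it into a piece in the bottom and a piece of a prism,
  or into a piece of a prism and a piece in the top. So it is a coderivation along the two chain maps
  (\<open>coderivation_homotopy_prism\<close>). Such a homotopy extends to the words in the desuspended
  generators as a derivation along the two induced algebra maps, and the extension is a chain homotopy between
  them because this has to be checked on letters only (\<open>cobar_word_homotopy_diff\<close>). Hence a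
  simplicial homotopy equivalence of reduced simplicial sets is an \<open>\<Omega>\<close>-quasi-isomorphism
  (\<open>omega_quasi_iso_homotopy_equivalence\<close>), whatever the fundamental groups are.

  The topological half. The map on singular simplices factors through the path fibration of \<open>g\<close>, whose
  points are pairs of a point of the source and a path in the target that starts at its image: a simplex is sent
  to its constant paths, and paths are sent to their end points. Constant paths are inverse up to homotopy to
  the projection to the source, as paths can be contracted to their source
  (\<open>simplicial_homotopy_contract_path\<close>). The end point map has the right lifting property against the
  boundary inclusions of simplices (\<open>trivial_fibration_path_end\<close>), and lifting simplex by simplex
  gives a section and a homotopy that makes it a homotopy inverse
  (\<open>trivial_fibration_homotopy_inverse\<close>). Both homotopies are constant on the base point.

  The lifting property is the geometric core (\<open>solvable_weak_homotopy_equivalence\<close>). A collar of the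
  simplex absorbs the homotopies over its boundary, so that only maps of the simplex with boundary exactly the
  image of the given one have to be lifted, and a homotopy of the boundary data does not matter. Therefore all
  faces but one may be pushed to a vertex. The simplex is a quotient of the cube, and on the cube the remaining
  face is a spheroid in the source whose image is nullhomotopic. Injectivity of \<open>g\<close> on the homotopy
  group of this face extends the boundary map over the cube; surjectivity on the homotopy group one dimension
  higher corrects the extension so that its image has the prescribed homotopy class relative to the
  boundary.\<close>

section \<open>Free modules\<close>

lemma lookup_smul [simp]: "Poly_Mapping.lookup (smul a x) k = a * Poly_Mapping.lookup x k"
  unfolding smul_def by (simp add: Poly_Mapping.map.rep_eq when_def)

lemma lin_superset:
  assumes "finite A" "Poly_Mapping.keys x \<subseteq> A"
  shows "lin f x = (\<Sum>b\<in>A. smul (Poly_Mapping.lookup x b) (f b))"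
  unfolding lin_def
  by (rule sum.mono_neutral_left)
     (use assms in \<open>auto simp: poly_mapping_eq_iff fun_eq_iff in_keys_iff\<close>)

lemma smul_simps [simp]:
  "smul a 0 = 0" "smul 0 x = 0" "smul 1 x = x" "smul a (smul b x) = smul (a * b) x"
  "smul a (- x) = - smul a x" "smul (- a) x = - smul a x"
  by (auto intro!: poly_mapping_eqI simp: mult.assoc)

lemma smul_distribs:
  "smul a (x + y) = smul a x + smul a y" "smul a (x - y) = smul a x - smul a y"
  "smul (a + b) x = smul a x + smul b x" "smul (a - b) x = smul a x - smul b x"
  by (auto intro!: poly_mapping_eqI simp: lookup_add lookup_minus algebra_simps)

lemma smul_sum: "smul a (\<Sum>i\<in>I. f i) = (\<Sum>i\<in>I. smul a (f i))"
  by (rule poly_mapping_eqI) (simp add: lookup_sum sum_distrib_left)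

lemma lin_cong: "(\<And>b. b \<in> Poly_Mapping.keys x \<Longrightarrow> f b = g b) \<Longrightarrow> lin f x = lin g x"
  unfolding lin_def by simp

lemma lin_add [simp]: "lin f (x + y) = lin f x + lin f y"
proof -
  let ?A = "Poly_Mapping.keys x \<union> Poly_Mapping.keys y"
  have "Poly_Mapping.keys (x + y) \<subseteq> ?A"
    by (rule keys_add)
  then show ?thesis
    by (simp add: lin_superset[of ?A] lookup_add smul_distribs sum.distrib)
qed

lemma lin_smul [simp]: "lin f (smul a x) = smul a (lin f x)"
proof -
  have "Poly_Mapping.keys (smul a x) \<subseteq> Poly_Mapping.keys x"
    by (auto simp: in_keys_iff)
  then show ?thesis
    by (simp add: lin_superset[of "Poly_Mapping.keys x"] smul_sum)
qed

lemma lin_zero [simp]: "lin f 0 = 0"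
  by (simp add: lin_def)

lemma lin_uminus [simp]: "lin f (- x) = - lin f x"
  using lin_smul[of f "-1" x] by simp

lemma lin_diff [simp]: "lin f (x - y) = lin f x - lin f y"
  using lin_add[of f x "- y"] by simp

lemma lin_sum [simp]: "lin f (\<Sum>i\<in>I. x i) = (\<Sum>i\<in>I. lin f (x i))"
  by (induction I rule: infinite_finite_induct) auto

lemma lin_gen [simp]: "lin f (gen b) = f b"
  by (simp add: lin_def)

lemma lin_fun_add: "lin (\<lambda>b. f b + g b) x = lin f x + lin g x"
  unfolding lin_def by (simp add: smul_distribs sum.distrib)

lemma lin_fun_zero [simp]: "lin (\<lambda>b. 0) x = 0"
  unfolding lin_def by simp

lemma lin_fun_uminus: "lin (\<lambda>b. - f b) x = - lin f x"
  unfolding lin_def by (simp add: sum_negf)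

lemma lin_fun_diff: "lin (\<lambda>b. f b - g b) x = lin f x - lin g x"
  unfolding lin_def by (simp add: smul_distribs sum_subtractf)

lemma lin_fun_smul: "lin (\<lambda>b. smul a (f b)) x = smul a (lin f x)"
  unfolding lin_def by (simp add: smul_sum mult.commute)

lemma lin_fun_sum: "lin (\<lambda>b. \<Sum>i\<in>I. f i b) x = (\<Sum>i\<in>I. lin (f i) x)"
  unfolding lin_def by (simp add: smul_sum) (rule sum.swap)

lemma lin_lin: "lin f (lin g x) = lin (\<lambda>b. lin f (g b)) x"
  unfolding lin_def[of g x] lin_def[of "\<lambda>b. lin f (g b)" x] by simp

lemma lin_gen_id [simp]: "lin gen x = x"
proof (rule poly_mapping_eqI)
  fix k
  have "Poly_Mapping.lookup (lin gen x) k =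
      (\<Sum>b\<in>Poly_Mapping.keys x. if b = k then Poly_Mapping.lookup x b else 0)"
    unfolding lin_def lookup_sum by (intro sum.cong) (auto simp: lookup_single when_def)
  then show "Poly_Mapping.lookup (lin gen x) k = Poly_Mapping.lookup x k"
    by (simp add: in_keys_iff)
qed

lemma lin_swap: "lin (\<lambda>a. lin (\<lambda>b. F a b) y) x = lin (\<lambda>b. lin (\<lambda>a. F a b) x) y"
  unfolding lin_def smul_sum by (subst sum.swap) (simp add: mult.commute)

lemma keys_smul: "Poly_Mapping.keys (smul a x) \<subseteq> Poly_Mapping.keys x"
  by (auto simp: in_keys_iff)

lemma keys_uminus [simp]: "Poly_Mapping.keys (- x) = Poly_Mapping.keys (x :: 'b \<Rightarrow>\<^sub>0 'k::comm_ring_1)"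
  by (auto simp: in_keys_iff)

lemma keys_sum_subset:
  "(\<And>i. i \<in> I \<Longrightarrow> Poly_Mapping.keys (f i) \<subseteq> A) \<Longrightarrow> Poly_Mapping.keys (\<Sum>i\<in>I. f i) \<subseteq> A"
proof (induction I rule: infinite_finite_induct)
  case (insert i I)
  then show ?case using keys_add[of "f i" "sum f I"] by fastforce
qed auto

lemma keys_lin_subset:
  "(\<And>b. b \<in> Poly_Mapping.keys x \<Longrightarrow> Poly_Mapping.keys (f b) \<subseteq> A) \<Longrightarrow> Poly_Mapping.keys (lin f x) \<subseteq> A"
  unfolding lin_def by (rule keys_sum_subset) (rule order_trans[OF keys_smul])

lemma bilin_zero [simp]: "bilin p 0 y = 0" "bilin p x 0 = 0"
  by (simp_all add: bilin_def)

lemma bilin_add: "bilin p (x + x') y = bilin p x y + bilin p x' y" "bilin p x (y + y') = bilin p x y + bilin p x y'"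
  by (simp_all add: bilin_def lin_fun_add)

lemma bilin_diff: "bilin p (x - x') y = bilin p x y - bilin p x' y" "bilin p x (y - y') = bilin p x y - bilin p x y'"
  by (simp_all add: bilin_def lin_fun_diff)

lemma bilin_uminus [simp]: "bilin p (- x) y = - bilin p x y" "bilin p x (- y) = - bilin p x y"
  by (simp_all add: bilin_def lin_fun_uminus)

lemma bilin_smul [simp]: "bilin p (smul a x) y = smul a (bilin p x y)" "bilin p x (smul a y) = smul a (bilin p x y)"
  by (simp_all add: bilin_def lin_fun_smul)

lemma bilin_sum: "bilin p (\<Sum>i\<in>I. f i) y = (\<Sum>i\<in>I. bilin p (f i) y)"
  "bilin p x (\<Sum>i\<in>I. g i) = (\<Sum>i\<in>I. bilin p x (g i))"
  by (simp_all add: bilin_def lin_fun_sum)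

lemma bilin_gen [simp]: "bilin p (gen a) (gen b) = gen (p a b)"
  by (simp add: bilin_def)

lemma bilin_lin_left: "bilin p (lin f x) y = lin (\<lambda>a. bilin p (f a) y) x"
  by (simp add: bilin_def lin_lin)

lemma bilin_lin_right: "bilin p x (lin g y) = lin (\<lambda>b. bilin p x (g b)) y"
  unfolding bilin_def lin_lin by (rule lin_swap)

lemmas bilin_lin = bilin_lin_left bilin_lin_right

lemma lin_bilin: "lin g (bilin p x y) = lin (\<lambda>a. lin (\<lambda>b. g (p a b)) y) x"
  by (simp add: bilin_def lin_lin)

lemma keys_bilin_subset:
  "(\<And>a b. a \<in> Poly_Mapping.keys x \<Longrightarrow> b \<in> Poly_Mapping.keys y \<Longrightarrow> p a b \<in> A) \<Longrightarrow> Poly_Mapping.keys (bilin p x y) \<subseteq> A"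
  unfolding bilin_def by (intro keys_lin_subset) auto

lemma concat_mul_assoc: "concat_mul (concat_mul x y) z = concat_mul x (concat_mul y z)"
  by (simp add: bilin_def lin_lin)

lemma concat_mul_one [simp]: "concat_mul (gen []) x = x" "concat_mul x (gen []) = x"
  by (simp_all add: bilin_def)

lemma lin_form_zero [simp]: "lin_form e 0 = 0"
  by (simp add: lin_form_def)

section \<open>The cobar construction\<close>

lemma connected_dg_coalgebraD:
  assumes "connected_dg_coalgebra C"
  shows "b \<in> basis C \<Longrightarrow> Poly_Mapping.keys (bd C b) \<subseteq> {a \<in> basis C. bdeg C a + 1 = bdeg C b}"
    and "b \<in> basis C \<Longrightarrow> Poly_Mapping.keys (cop C b) \<subseteq>
        {(x, y). x \<in> basis C \<and> y \<in> basis C \<and> bdeg C x + bdeg C y = bdeg C b}"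
    and "unit_elt C \<in> basis C" "bdeg C (unit_elt C) = 0" "counit C (unit_elt C) = 1"
    and "b \<in> basis C \<Longrightarrow> bdeg C b = 0 \<Longrightarrow> b = unit_elt C"
  using assms unfolding connected_dg_coalgebra_def by blast+

lemma dg_coalgebra_mapD:
  assumes "dg_coalgebra_map C C' \<phi>"
  shows "b \<in> basis C \<Longrightarrow> Poly_Mapping.keys (\<phi> b) \<subseteq> {c \<in> basis C'. bdeg C' c = bdeg C b}"
    and "b \<in> basis C \<Longrightarrow> lin \<phi> (bd C b) = lin (bd C') (\<phi> b)"
    and "b \<in> basis C \<Longrightarrow> lin (\<lambda>(x, y). tensor (\<phi> x) (\<phi> y)) (cop C b) = lin (cop C') (\<phi> b)"
  using assms unfolding dg_coalgebra_map_def by blast+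

abbreviation word_deg :: "('b, 'k::comm_ring_1) dgc \<Rightarrow> 'b list \<Rightarrow> nat" where
  "word_deg C w \<equiv> sum_list (map (\<lambda>b. bdeg C b - 1) w)"

abbreviation pos_basis :: "('b, 'k::comm_ring_1) dgc \<Rightarrow> 'b set" where
  "pos_basis C \<equiv> {b \<in> basis C. 0 < bdeg C b}"

lemma desusp_gen: "desusp C (gen b) = (if bdeg C b = 0 then 0 else gen [b])"
  by (simp add: desusp_def)

lemma desusp_linear [simp]:
  "desusp C 0 = 0" "desusp C (x + y) = desusp C x + desusp C y" "desusp C (x - y) = desusp C x - desusp C y"
  "desusp C (- x) = - desusp C x" "desusp C (smul a x) = smul a (desusp C x)"
  by (simp_all add: desusp_def)

lemma desusp_lin: "desusp C (lin f x) = lin (\<lambda>b. desusp C (f b)) x"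
  by (simp add: desusp_def lin_lin)

lemma lin_desusp: "lin F (desusp C x) = lin (\<lambda>b. if bdeg C b = 0 then 0 else F [b]) x"
  by (auto simp: desusp_def lin_lin intro!: lin_cong)

lemma desusp_deg_0:
  assumes "\<And>b. b \<in> Poly_Mapping.keys x \<Longrightarrow> bdeg C b = 0"
  shows "desusp C x = 0"
proof -
  have "desusp C x = lin (\<lambda>b. 0) x"
    unfolding desusp_def using assms by (intro lin_cong) auto
  then show ?thesis by simp
qed

lemma keys_desusp_subset:
  assumes "\<And>b. b \<in> Poly_Mapping.keys x \<Longrightarrow> 0 < bdeg C b \<Longrightarrow> [b] \<in> A"
  shows "Poly_Mapping.keys (desusp C x) \<subseteq> A"
  unfolding desusp_def using assms by (intro keys_lin_subset) auto

text \<open>The quadratic part of the differential of the cobar construction; the sign arises when a desuspension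
  passes the first factor.\<close>

definition cup :: "('b, 'k::comm_ring_1) dgc \<Rightarrow> 'b \<times> 'b \<Rightarrow> ('b list \<Rightarrow>\<^sub>0 'k)" where
  "cup C = (\<lambda>(u, v). smul ((-1) ^ bdeg C u) (concat_mul (desusp C (gen u)) (desusp C (gen v))))"

lemma lin_cup:
  assumes "\<And>u. u \<in> Poly_Mapping.keys x \<Longrightarrow> bdeg C u = m"
  shows "lin (cup C) (tensor x y) = smul ((-1) ^ m) (concat_mul (desusp C x) (desusp C y))"
proof -
  have "lin (cup C) (tensor x y) = lin (\<lambda>u. smul ((-1) ^ m) (concat_mul (desusp C (gen u)) (desusp C y))) x"
    unfolding lin_bilin
  proof (rule lin_cong)
    fix u assume u: "u \<in> Poly_Mapping.keys x"
    have "lin (\<lambda>v. cup C (u, v)) y = smul ((-1) ^ m) (concat_mul (desusp C (gen u)) (lin (\<lambda>v. desusp C (gen v)) y))"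
      using assms[OF u] by (simp add: cup_def lin_fun_smul bilin_lin)
    then show "lin (\<lambda>v. cup C (u, v)) y = smul ((-1) ^ m) (concat_mul (desusp C (gen u)) (desusp C y))"
      by (simp add: desusp_lin[symmetric])
  qed
  then show ?thesis
    by (simp add: lin_fun_smul bilin_lin(1)[symmetric] desusp_lin[symmetric])
qed

text \<open>The unit has no desuspension, so in the differential of the cobar construction the reduced
  coproduct may be replaced by the coproduct.\<close>

lemma cobar_gen_diff_cop:
  assumes "connected_dg_coalgebra C"
  shows "cobar_gen_diff C b = - desusp C (bd C b) + lin (cup C) (cop C b)"
  using connected_dg_coalgebraD(4)[OF assms]
  by (simp add: cobar_gen_diff_def reduced_cop_def desusp_gen cup_def)

lemma word_deg_cobar_gen_diff:
  assumes "connected_dg_coalgebra C" "b \<in> basis C" "u \<in> Poly_Mapping.keys (cobar_gen_diff C b)"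
  shows "word_deg C u + 2 = bdeg C b"
proof -
  let ?A = "{u. word_deg C u + 2 = bdeg C b}"
  have "Poly_Mapping.keys (desusp C (bd C b)) \<subseteq> ?A"
    using connected_dg_coalgebraD(1)[OF assms(1,2)] by (intro keys_desusp_subset) auto
  moreover have "Poly_Mapping.keys (lin (cup C) (cop C b)) \<subseteq> ?A"
  proof (rule keys_lin_subset, clarify)
    fix x y u assume xy: "(x, y) \<in> Poly_Mapping.keys (cop C b)" and u: "u \<in> Poly_Mapping.keys (cup C (x, y))"
    from xy have deg: "bdeg C x + bdeg C y = bdeg C b"
      using connected_dg_coalgebraD(2)[OF assms(1,2)] by auto
    from u have "cup C (x, y) \<noteq> 0" by auto
    then have pos: "0 < bdeg C x" "0 < bdeg C y"
      by (auto simp: cup_def desusp_gen split: if_splits)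
    have "u = [x, y]"
      using u keys_smul[of "(-1) ^ bdeg C x" "gen [x, y] :: _ \<Rightarrow>\<^sub>0 'b"] pos
      by (auto simp: cup_def desusp_gen)
    with pos deg show "word_deg C u + 2 = bdeg C b" by simp
  qed
  ultimately show ?thesis
    using assms(3) keys_add[of "- desusp C (bd C b)" "lin (cup C) (cop C b)"]
    unfolding cobar_gen_diff_cop[OF assms(1)] by auto
qed

lemma cobar_words_append:
  "u \<in> cobar_words C m \<Longrightarrow> v \<in> cobar_words C n \<Longrightarrow> u @ v \<in> cobar_words C (m + n)"
  by (auto simp: cobar_words_def)

lemma cobar_words_Cons:
  "b # w \<in> cobar_words C n \<longleftrightarrow>
     b \<in> pos_basis C \<and> bdeg C b - 1 \<le> n \<and> w \<in> cobar_words C (n - (bdeg C b - 1))"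
  by (auto simp: cobar_words_def)

lemma cobar_words_single: "b \<in> pos_basis C \<Longrightarrow> bdeg C b = Suc n \<Longrightarrow> [b] \<in> cobar_words C n"
  by (simp add: cobar_words_def)

lemma keys_concat_mul:
  assumes "Poly_Mapping.keys x \<subseteq> cobar_words C m" "Poly_Mapping.keys y \<subseteq> cobar_words C n"
  shows "Poly_Mapping.keys (concat_mul x y) \<subseteq> cobar_words C (m + n)"
  using assms by (intro keys_bilin_subset) (auto intro: cobar_words_append)

lemma cobar_word_diff_append:
  "cobar_word_diff C (u @ w) = concat_mul (cobar_word_diff C u) (gen w) +
     smul ((-1) ^ word_deg C u) (concat_mul (gen u) (cobar_word_diff C w))"
proof (induction u)
  case (Cons b u)
  have "concat_mul x (gen (u @ w)) = concat_mul (concat_mul x (gen u)) (gen w)"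
    "concat_mul (gen (b # u)) y = concat_mul (gen [b]) (concat_mul (gen u) y)" for x y :: "'a list \<Rightarrow>\<^sub>0 'b"
    by (simp_all add: concat_mul_assoc concat_mul_assoc[symmetric])
  with Cons show ?case
    by (simp add: bilin_add smul_distribs power_add concat_mul_assoc)
qed simp

lemma diff_concat_mul:
  assumes "\<And>u. u \<in> Poly_Mapping.keys x \<Longrightarrow> word_deg C u = m"
  shows "lin (cobar_word_diff C) (concat_mul x y) = concat_mul (lin (cobar_word_diff C) x) y +
     smul ((-1) ^ m) (concat_mul x (lin (cobar_word_diff C) y))"
proof -
  let ?D = "cobar_word_diff C"
  have "lin ?D (concat_mul x y) =
      lin (\<lambda>u. concat_mul (?D u) y + smul ((-1) ^ m) (concat_mul (gen u) (lin ?D y))) x"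
  proof (unfold lin_bilin, rule lin_cong)
    fix u assume "u \<in> Poly_Mapping.keys x"
    then have "lin (\<lambda>w. ?D (u @ w)) y = lin (\<lambda>w. concat_mul (?D u) (gen w) +
        smul ((-1) ^ m) (concat_mul (gen u) (?D w))) y"
      by (simp add: cobar_word_diff_append assms del: One_nat_def)
    also have "\<dots> = concat_mul (?D u) y + smul ((-1) ^ m) (concat_mul (gen u) (lin ?D y))"
      by (simp add: lin_fun_add lin_fun_smul bilin_lin(2)[symmetric])
    finally show "lin (\<lambda>w. ?D (u @ w)) y = concat_mul (?D u) y + smul ((-1) ^ m) (concat_mul (gen u) (lin ?D y))" .
  qed
  also have "\<dots> = concat_mul (lin ?D x) y + smul ((-1) ^ m) (concat_mul x (lin ?D y))"
    by (simp add: lin_fun_add lin_fun_smul bilin_lin(1)[symmetric])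
  finally show ?thesis .
qed

lemma cobar_word_map_append:
  "cobar_word_map C' \<phi> (u @ w) = concat_mul (cobar_word_map C' \<phi> u) (cobar_word_map C' \<phi> w)"
  by (induction u) (simp_all add: concat_mul_assoc)

lemma cobar_map_concat_mul:
  "cobar_map C' \<phi> (concat_mul x y) = concat_mul (cobar_map C' \<phi> x) (cobar_map C' \<phi> y)"
  by (simp add: cobar_map_def lin_bilin cobar_word_map_append bilin_lin_left bilin_lin_right[symmetric])

lemma cobar_map_linear [simp]:
  "cobar_map C' \<phi> 0 = 0" "cobar_map C' \<phi> (x + y) = cobar_map C' \<phi> x + cobar_map C' \<phi> y"
  "cobar_map C' \<phi> (x - y) = cobar_map C' \<phi> x - cobar_map C' \<phi> y"
  "cobar_map C' \<phi> (- x) = - cobar_map C' \<phi> x" "cobar_map C' \<phi> (smul a x) = smul a (cobar_map C' \<phi> x)"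
  by (simp_all add: cobar_map_def)

lemma cobar_simps [simp]:
  "grade (cobar C) n = {x. Poly_Mapping.keys x \<subseteq> cobar_words C n}"
  "diff (cobar C) = lin (cobar_word_diff C)" "amul (cobar C) = concat_mul" "aone (cobar C) = gen []"
  by (simp_all add: cobar_def)

lemma keys_cobar_word_map:
  assumes "\<And>b. b \<in> basis C \<Longrightarrow> Poly_Mapping.keys (\<phi> b) \<subseteq> {c \<in> basis C'. bdeg C' c = bdeg C b}"
    and "w \<in> cobar_words C n"
  shows "Poly_Mapping.keys (cobar_word_map C' \<phi> w) \<subseteq> cobar_words C' n"
  using assms(2)
proof (induction w arbitrary: n)
  case (Cons b w)
  then have b: "b \<in> pos_basis C" "bdeg C b - 1 \<le> n" "w \<in> cobar_words C (n - (bdeg C b - 1))"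
    by (auto simp: cobar_words_Cons)
  then have "Poly_Mapping.keys (desusp C' (\<phi> b)) \<subseteq> cobar_words C' (bdeg C b - 1)"
    using assms(1)[of b] by (intro keys_desusp_subset cobar_words_single) auto
  from keys_concat_mul[OF this Cons.IH[OF b(3)]] b(2) show ?case by simp
qed (simp add: cobar_words_def)

lemma cobar_gen_map:
  assumes "connected_dg_coalgebra C" "dg_coalgebra_map C C' \<phi>" "Poly_Mapping.keys x \<subseteq> basis C"
  shows "cobar_map C' \<phi> (desusp C x) = desusp C' (lin \<phi> x)"
  unfolding cobar_map_def lin_desusp desusp_lin
proof (rule lin_cong)
  fix b assume "b \<in> Poly_Mapping.keys x"
  then have "b \<in> basis C" using assms(3) by blast
  then have "desusp C' (\<phi> b) = 0" if "bdeg C b = 0"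
    using dg_coalgebra_mapD(1)[OF assms(2), of b] that by (intro desusp_deg_0) auto
  then show "(if bdeg C b = 0 then 0 else cobar_word_map C' \<phi> [b]) = desusp C' (\<phi> b)"
    by simp
qed

lemma diff_desusp:
  assumes "\<And>c. c \<in> Poly_Mapping.keys x \<Longrightarrow> 0 < bdeg C c"
  shows "lin (cobar_word_diff C) (desusp C x) = lin (cobar_gen_diff C) x"
  unfolding lin_desusp using assms by (intro lin_cong) (simp add: less_not_refl2)

text \<open>Both sides are derivations along the algebra map, so it is enough to compare them on the
  letters, where the identity says that the given map is a map of chain complexes and of
  coalgebras.\<close>

lemma cobar_word_map_diff:
  assumes C: "connected_dg_coalgebra C" and C': "connected_dg_coalgebra C'"
    and \<phi>: "dg_coalgebra_map C C' \<phi>" and w: "set w \<subseteq> pos_basis C"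
  shows "cobar_map C' \<phi> (cobar_word_diff C w) = lin (cobar_word_diff C') (cobar_word_map C' \<phi> w)"
  using w
proof (induction w)
  case (Cons b w)
  let ?\<Phi> = "cobar_map C' \<phi>" and ?D' = "lin (cobar_word_diff C')"
  from Cons.prems have b: "b \<in> basis C" "0 < bdeg C b" by auto
  have \<phi>b: "c \<in> basis C' \<and> bdeg C' c = bdeg C b" if "c \<in> Poly_Mapping.keys (\<phi> b)" "b \<in> basis C" for b c
    using dg_coalgebra_mapD(1)[OF \<phi> that(2)] that(1) by auto
  have gen_step: "?\<Phi> (cobar_gen_diff C b) = ?D' (desusp C' (\<phi> b))"
  proof -
    have "?\<Phi> (desusp C (bd C b)) = lin (\<lambda>c. desusp C' (bd C' c)) (\<phi> b)"
      using connected_dg_coalgebraD(1)[OF C b(1)] dg_coalgebra_mapD(2)[OF \<phi> b(1)]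
      by (subst cobar_gen_map[OF C \<phi>]) (auto simp: desusp_lin)
    moreover have "?\<Phi> (lin (cup C) (cop C b))
        = lin (\<lambda>c. lin (cup C') (cop C' c)) (\<phi> b)" (is "?l = ?r")
    proof -
      have "?l = lin (\<lambda>(x, y). lin (cup C') (tensor (\<phi> x) (\<phi> y))) (cop C b)"
        unfolding cobar_map_def[of C' \<phi>] lin_lin
      proof (rule lin_cong, clarify)
        fix x y assume "(x, y) \<in> Poly_Mapping.keys (cop C b)"
        then have xy: "x \<in> basis C" "y \<in> basis C"
          using connected_dg_coalgebraD(2)[OF C b(1)] by auto
        show "lin (cobar_word_map C' \<phi>) (cup C (x, y))
            = lin (cup C') (tensor (\<phi> x) (\<phi> y))"
          using xy \<phi>b
          by (simp add: cobar_map_def[symmetric] cobar_map_concat_mul cobar_gen_map[OF C \<phi>] lin_cup[of _ _ "bdeg C x"] cup_def[of C])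
      qed
      also have "\<dots> = lin (cup C') (lin (\<lambda>(x, y). tensor (\<phi> x) (\<phi> y)) (cop C b))"
        unfolding lin_lin by (intro lin_cong) auto
      also have "\<dots> = ?r"
        using dg_coalgebra_mapD(3)[OF \<phi> b(1)] by (simp add: lin_lin)
      finally show ?thesis .
    qed
    moreover have "?D' (desusp C' (\<phi> b)) = lin (\<lambda>c. - desusp C' (bd C' c) + lin (cup C') (cop C' c)) (\<phi> b)"
      using \<phi>b b by (subst diff_desusp) (auto simp: cobar_gen_diff_cop[OF C'] cup_def cong: lin_cong)
    ultimately show ?thesis
      by (simp add: cobar_gen_diff_cop[OF C] lin_fun_add lin_fun_uminus lin_fun_diff cobar_map_def)
  qed
  have deg: "word_deg C' u = bdeg C b - 1" if "u \<in> Poly_Mapping.keys (desusp C' (\<phi> b))" for u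
    using keys_desusp_subset[of "\<phi> b" C' "{u. word_deg C' u = bdeg C b - 1}"] \<phi>b b that by auto
  have "?\<Phi> (cobar_word_diff C (b # w)) = concat_mul (?\<Phi> (cobar_gen_diff C b)) (?\<Phi> (gen w)) +
      smul ((-1) ^ (bdeg C b - 1)) (concat_mul (?\<Phi> (gen [b])) (?\<Phi> (cobar_word_diff C w)))"
    by (simp add: cobar_map_concat_mul)
  moreover have "?\<Phi> (gen [b]) = desusp C' (\<phi> b)" "?\<Phi> (gen w) = cobar_word_map C' \<phi> w"
    by (simp_all add: cobar_map_def)
  ultimately show ?case
    using Cons by (simp add: gen_step diff_concat_mul[OF deg])
qed (simp add: cobar_map_def)

lemma keys_cobar_map:
  assumes "dg_coalgebra_map C C' \<phi>" "Poly_Mapping.keys x \<subseteq> cobar_words C n"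
  shows "Poly_Mapping.keys (cobar_map C' \<phi> x) \<subseteq> cobar_words C' n"
  unfolding cobar_map_def
proof (rule keys_lin_subset)
  fix w assume "w \<in> Poly_Mapping.keys x"
  with assms(2) have "w \<in> cobar_words C n" by blast
  from keys_cobar_word_map[OF dg_coalgebra_mapD(1)[OF assms(1)] this]
  show "Poly_Mapping.keys (cobar_word_map C' \<phi> w) \<subseteq> cobar_words C' n" .
qed

lemma cobar_map_diff:
  assumes "connected_dg_coalgebra C" "connected_dg_coalgebra C'"
    and "dg_coalgebra_map C C' \<phi>" "Poly_Mapping.keys x \<subseteq> cobar_words C n"
  shows "cobar_map C' \<phi> (lin (cobar_word_diff C) x) = lin (cobar_word_diff C') (cobar_map C' \<phi> x)"
proof -
  have "lin (\<lambda>w. cobar_map C' \<phi> (cobar_word_diff C w)) x =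
      lin (\<lambda>w. lin (cobar_word_diff C') (cobar_word_map C' \<phi> w)) x"
    using assms(4) by (intro lin_cong cobar_word_map_diff[OF assms(1-3)]) (auto simp: cobar_words_def)
  then show ?thesis by (simp add: cobar_map_def lin_lin)
qed

lemma dga_map_cobar_map:
  assumes "connected_dg_coalgebra C" "connected_dg_coalgebra C'" "dg_coalgebra_map C C' \<phi>"
  shows "dga_map (cobar C) (cobar C') (cobar_map C' \<phi>)"
  unfolding dga_map_def
  using keys_cobar_map[OF assms(3)] cobar_map_diff[OF assms] cobar_map_concat_mul[of C' \<phi>]
  by (auto simp: cobar_map_def)

section \<open>Homotopies of cobar constructions\<close>

text \<open>A homotopy between maps of dg coalgebras that is compatible with the coproducts; the sign
  is that of a map of degree 1 passing the left factor.\<close>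

definition coderivation_homotopy ::
  "('b, 'k::comm_ring_1) dgc \<Rightarrow> ('c, 'k) dgc \<Rightarrow> ('b \<Rightarrow> ('c \<Rightarrow>\<^sub>0 'k)) \<Rightarrow> ('b \<Rightarrow> ('c \<Rightarrow>\<^sub>0 'k)) \<Rightarrow> ('b \<Rightarrow> ('c \<Rightarrow>\<^sub>0 'k)) \<Rightarrow> bool"
  where
  "coderivation_homotopy C C' \<phi> \<psi> h \<longleftrightarrow>
     (\<forall>b\<in>basis C. Poly_Mapping.keys (h b) \<subseteq> {c \<in> basis C'. bdeg C' c = bdeg C b + 1}) \<and>
     (\<forall>b\<in>basis C. lin (bd C') (h b) + lin h (bd C b) = \<phi> b - \<psi> b) \<and>
     (\<forall>b\<in>basis C. lin (cop C') (h b) =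
        lin (\<lambda>(x, y). tensor (h x) (\<psi> y) + smul ((-1) ^ bdeg C x) (tensor (\<phi> x) (h y))) (cop C b)) \<and>
     h (unit_elt C) = 0"

text \<open>The derivation along the algebra maps induced by \<open>\<phi>\<close> and \<open>\<psi>\<close>, of degree 1, whose
  value on the letter \<open>sb\<close> is \<open>- s(h b)\<close>: the homotopy changes its sign when it passes the
  desuspension.\<close>

primrec cobar_word_homotopy ::
  "('b, 'k::comm_ring_1) dgc \<Rightarrow> ('c, 'k) dgc \<Rightarrow> ('b \<Rightarrow> ('c \<Rightarrow>\<^sub>0 'k)) \<Rightarrow> ('b \<Rightarrow> ('c \<Rightarrow>\<^sub>0 'k)) \<Rightarrow> ('b \<Rightarrow> ('c \<Rightarrow>\<^sub>0 'k))
     \<Rightarrow> 'b list \<Rightarrow> ('c list \<Rightarrow>\<^sub>0 'k)" where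
  "cobar_word_homotopy C C' \<phi> \<psi> h [] = 0"
| "cobar_word_homotopy C C' \<phi> \<psi> h (b # w) =
     - concat_mul (desusp C' (h b)) (cobar_word_map C' \<psi> w) +
     smul ((-1) ^ (bdeg C b - 1)) (concat_mul (desusp C' (\<phi> b)) (cobar_word_homotopy C C' \<phi> \<psi> h w))"

lemma cobar_word_homotopy_append:
  "cobar_word_homotopy C C' \<phi> \<psi> h (u @ w) =
     concat_mul (cobar_word_homotopy C C' \<phi> \<psi> h u) (cobar_word_map C' \<psi> w) +
     smul ((-1) ^ word_deg C u) (concat_mul (cobar_word_map C' \<phi> u) (cobar_word_homotopy C C' \<phi> \<psi> h w))"
  by (induction u)
     (simp_all add: cobar_word_map_append bilin_add smul_distribs power_add concat_mul_assoc bilin_diff)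

lemma keys_cobar_word_homotopy:
  assumes "dg_coalgebra_map C C' \<phi>" "dg_coalgebra_map C C' \<psi>" "coderivation_homotopy C C' \<phi> \<psi> h"
    and "w \<in> cobar_words C n"
  shows "Poly_Mapping.keys (cobar_word_homotopy C C' \<phi> \<psi> h w) \<subseteq> cobar_words C' (Suc n)"
  using assms(4)
proof (induction w arbitrary: n)
  case (Cons b w)
  let ?k = "bdeg C b - 1"
  from Cons.prems have b: "b \<in> pos_basis C" "?k \<le> n" "w \<in> cobar_words C (n - ?k)"
    by (auto simp: cobar_words_Cons)
  have "Poly_Mapping.keys (desusp C' (h b)) \<subseteq> cobar_words C' (Suc ?k)"
    using assms(3) b unfolding coderivation_homotopy_def
    by (intro keys_desusp_subset cobar_words_single) auto
  then have 1: "Poly_Mapping.keys (concat_mul (desusp C' (h b)) (cobar_word_map C' \<psi> w)) \<subseteq> cobar_words C' (Suc n)"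
    using keys_concat_mul[OF _ keys_cobar_word_map[OF dg_coalgebra_mapD(1)[OF assms(2)] b(3)]] b(2)
    by (metis add_Suc le_add_diff_inverse)
  have "Poly_Mapping.keys (desusp C' (\<phi> b)) \<subseteq> cobar_words C' ?k"
    using dg_coalgebra_mapD(1)[OF assms(1), of b] b by (intro keys_desusp_subset cobar_words_single) auto
  then have 2: "Poly_Mapping.keys (concat_mul (desusp C' (\<phi> b)) (cobar_word_homotopy C C' \<phi> \<psi> h w)) \<subseteq> cobar_words C' (Suc n)"
    using keys_concat_mul[OF _ Cons.IH[OF b(3)]] b(2) by (metis add_Suc_right le_add_diff_inverse)
  from order_trans[OF keys_smul 2] 1 show ?case
    unfolding cobar_word_homotopy.simps by (intro order_trans[OF keys_add] Un_least) simp_all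
qed (simp add: cobar_words_def)

lemma homotopy_concat_mul:
  assumes "\<And>u. u \<in> Poly_Mapping.keys x \<Longrightarrow> word_deg C u = m"
  shows "lin (cobar_word_homotopy C C' \<phi> \<psi> h) (concat_mul x y) =
     concat_mul (lin (cobar_word_homotopy C C' \<phi> \<psi> h) x) (cobar_map C' \<psi> y) +
     smul ((-1) ^ m) (concat_mul (cobar_map C' \<phi> x) (lin (cobar_word_homotopy C C' \<phi> \<psi> h) y))"
proof -
  let ?S = "cobar_word_homotopy C C' \<phi> \<psi> h"
  have "lin ?S (concat_mul x y) =
      lin (\<lambda>u. concat_mul (?S u) (cobar_map C' \<psi> y) + smul ((-1) ^ m) (concat_mul (cobar_word_map C' \<phi> u) (lin ?S y))) x"
  proof (unfold lin_bilin, rule lin_cong)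
    fix u assume "u \<in> Poly_Mapping.keys x"
    then show "lin (\<lambda>w. ?S (u @ w)) y = concat_mul (?S u) (cobar_map C' \<psi> y) +
        smul ((-1) ^ m) (concat_mul (cobar_word_map C' \<phi> u) (lin ?S y))"
      by (simp del: One_nat_def add: cobar_word_homotopy_append assms lin_fun_add lin_fun_smul bilin_lin(2)[symmetric] cobar_map_def)
  qed
  also have "\<dots> = concat_mul (lin ?S x) (cobar_map C' \<psi> y) +
     smul ((-1) ^ m) (concat_mul (cobar_map C' \<phi> x) (lin ?S y))"
    by (simp add: lin_fun_add lin_fun_smul bilin_lin(1)[symmetric] cobar_map_def)
  finally show ?thesis .
qed

lemma homotopy_desusp:
  assumes "connected_dg_coalgebra C" "coderivation_homotopy C C' \<phi> \<psi> h" "Poly_Mapping.keys x \<subseteq> basis C"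
  shows "lin (cobar_word_homotopy C C' \<phi> \<psi> h) (desusp C x) = - desusp C' (lin h x)"
  unfolding lin_desusp desusp_lin lin_fun_uminus[symmetric]
proof (rule lin_cong)
  fix b assume "b \<in> Poly_Mapping.keys x"
  then have "b \<in> basis C" using assms(3) by blast
  then have "h b = 0" if "bdeg C b = 0"
    using connected_dg_coalgebraD(6)[OF assms(1) _ that] assms(2) unfolding coderivation_homotopy_def by simp
  then show "(if bdeg C b = 0 then 0 else cobar_word_homotopy C C' \<phi> \<psi> h [b]) = - desusp C' (h b)"
    by simp
qed

text \<open>On letters the identity is the definition of a coderivation homotopy; the extension to words is the
  one for which the difference of both sides is a derivation along the two algebra maps.\<close>

lemma cobar_word_homotopy_diff:
  assumes C: "connected_dg_coalgebra C" and C': "connected_dg_coalgebra C'"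
    and \<phi>: "dg_coalgebra_map C C' \<phi>" and \<psi>: "dg_coalgebra_map C C' \<psi>"
    and h: "coderivation_homotopy C C' \<phi> \<psi> h" and w: "set w \<subseteq> pos_basis C"
  shows "lin (cobar_word_diff C') (cobar_word_homotopy C C' \<phi> \<psi> h w) +
      lin (cobar_word_homotopy C C' \<phi> \<psi> h) (cobar_word_diff C w) =
      cobar_word_map C' \<phi> w - cobar_word_map C' \<psi> w"
  using w
proof (induction w)
  case (Cons b w)
  let ?\<Phi> = "cobar_map C' \<phi>" and ?\<Psi> = "cobar_map C' \<psi>" and ?D' = "lin (cobar_word_diff C')"
  let ?S = "lin (cobar_word_homotopy C C' \<phi> \<psi> h)" and ?D = "lin (cobar_word_diff C)"
  from Cons.prems have b: "b \<in> basis C" "0 < bdeg C b" by auto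
  have \<phi>b: "c \<in> basis C' \<and> bdeg C' c = bdeg C b" if "c \<in> Poly_Mapping.keys (\<phi> b)" "b \<in> basis C" for b c
    using dg_coalgebra_mapD(1)[OF \<phi> that(2)] that(1) by auto
  have hb: "c \<in> basis C' \<and> bdeg C' c = Suc (bdeg C b)" if "c \<in> Poly_Mapping.keys (h b)" "b \<in> basis C" for b c
    using h that unfolding coderivation_homotopy_def by fastforce
  have gen_step: "?S (cobar_gen_diff C b) - ?D' (desusp C' (h b)) = desusp C' (\<phi> b) - desusp C' (\<psi> b)"
  proof -
    have 1: "?S (desusp C (bd C b)) = - desusp C' (lin h (bd C b))"
      using connected_dg_coalgebraD(1)[OF C b(1)] by (intro homotopy_desusp[OF C h]) auto
    have 2: "?S (lin (cup C) (cop C b))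
        = lin (cup C') (lin (cop C') (h b))" (is "?l = ?r")
    proof -
      have "?l = lin (\<lambda>(x, y). lin (cup C') (tensor (h x) (\<psi> y) + smul ((-1) ^ bdeg C x) (tensor (\<phi> x) (h y)))) (cop C b)"
        unfolding lin_lin
      proof (rule lin_cong, clarify)
        fix x y assume "(x, y) \<in> Poly_Mapping.keys (cop C b)"
        then have xy: "x \<in> basis C" "y \<in> basis C"
          using connected_dg_coalgebraD(2)[OF C b(1)] by auto
        have deg: "word_deg C u = bdeg C x - 1" if "u \<in> Poly_Mapping.keys (desusp C (gen x))" for u
          using that by (simp add: desusp_gen split: if_splits)
        have zero: "desusp C' (\<phi> x) = 0" if "bdeg C x = 0"
          using \<phi>b[OF _ xy(1)] that by (intro desusp_deg_0) simp
        have "?S (concat_mul (desusp C (gen x)) (desusp C (gen y))) =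
            - concat_mul (desusp C' (h x)) (desusp C' (\<psi> y)) -
            smul ((-1) ^ (bdeg C x - 1)) (concat_mul (desusp C' (\<phi> x)) (desusp C' (h y)))"
          using xy by (simp add: homotopy_concat_mul[OF deg] cobar_gen_map[OF C \<phi>] cobar_gen_map[OF C \<psi>]
              homotopy_desusp[OF C h])
        also have "smul ((-1) ^ (bdeg C x - 1)) (concat_mul (desusp C' (\<phi> x)) (desusp C' (h y))) =
            - smul ((-1) ^ bdeg C x) (concat_mul (desusp C' (\<phi> x)) (desusp C' (h y)))"
          using zero by (cases "bdeg C x") auto
        finally show "?S (cup C (x, y))
            = lin (cup C') (tensor (h x) (\<psi> y) + smul ((-1) ^ bdeg C x) (tensor (\<phi> x) (h y)))"
          using xy \<phi>b hb
          by (simp add: lin_cup[of "h x" C' "Suc (bdeg C x)"] lin_cup[of "\<phi> x" C' "bdeg C x"] smul_distribs cup_def[of C]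
              flip: power_mult_distrib)
      qed
      also have "\<dots> = lin (cup C') (lin (\<lambda>(x, y). tensor (h x) (\<psi> y) + smul ((-1) ^ bdeg C x) (tensor (\<phi> x) (h y))) (cop C b))"
        unfolding lin_lin by (intro lin_cong) auto
      also have "\<dots> = ?r"
        using h b(1) unfolding coderivation_homotopy_def by simp
      finally show ?thesis .
    qed
    have 3: "?D' (desusp C' (h b)) = lin (\<lambda>c. - desusp C' (bd C' c) + lin (cup C') (cop C' c)) (h b)"
      using hb b by (subst diff_desusp) (auto simp: cobar_gen_diff_cop[OF C'] cup_def cong: lin_cong)
    have 4: "desusp C' (lin (bd C') (h b)) + desusp C' (lin h (bd C b)) = desusp C' (\<phi> b) - desusp C' (\<psi> b)"
      using h b(1) unfolding coderivation_homotopy_def by (metis desusp_linear(2,3))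
    show ?thesis
      using 4 unfolding cobar_gen_diff_cop[OF C] lin_add lin_uminus 1 2 3
      by (simp add: lin_fun_add lin_fun_uminus lin_fun_diff lin_lin desusp_lin add.commute)
  qed
  have \<phi>_step: "?\<Phi> (cobar_gen_diff C b) = ?D' (desusp C' (\<phi> b))"
    using cobar_word_map_diff[OF C C' \<phi>, of "[b]"] b by simp
  have \<Psi>w: "?\<Psi> (cobar_word_diff C w) = ?D' (cobar_word_map C' \<psi> w)"
    using cobar_word_map_diff[OF C C' \<psi>, of w] Cons.prems by simp
  have deg_\<phi>: "word_deg C' u = bdeg C b - 1" if "u \<in> Poly_Mapping.keys (desusp C' (\<phi> b))" for u
    using keys_desusp_subset[of "\<phi> b" C' "{u. word_deg C' u = bdeg C b - 1}"] \<phi>b b that by auto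
  have deg_h: "word_deg C' u = bdeg C b" if "u \<in> Poly_Mapping.keys (desusp C' (h b))" for u
    using keys_desusp_subset[of "h b" C' "{u. word_deg C' u = bdeg C b}"] hb b that by auto
  note deg_D = word_deg_cobar_gen_diff[OF C b(1)]
  have neg: "(-1) ^ bdeg C b = - ((-1) ^ (bdeg C b - 1) :: 'b)"
    using b(2) by (cases "bdeg C b") auto
  have "?S (concat_mul (cobar_gen_diff C b) (gen w)) = concat_mul (?S (cobar_gen_diff C b)) (cobar_word_map C' \<psi> w) +
      smul ((-1) ^ bdeg C b) (concat_mul (?\<Phi> (cobar_gen_diff C b)) (cobar_word_homotopy C C' \<phi> \<psi> h w))"
  proof (cases "bdeg C b \<ge> 2")
    case True
    then obtain d where d: "bdeg C b = d + 2" by (metis add.commute le_iff_add)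
    have "word_deg C u = d" if "u \<in> Poly_Mapping.keys (cobar_gen_diff C b)" for u
      using deg_D[OF that] d by simp
    from homotopy_concat_mul[of "cobar_gen_diff C b" C d C', OF this] d show ?thesis by (simp add: cobar_map_def)
  next
    case False
    then have "cobar_gen_diff C b = 0"
      using deg_D by (metis keys_eq_empty ex_in_conv le_add2)
    then show ?thesis by simp
  qed
  moreover have "?S (concat_mul (gen [b]) (cobar_word_diff C w)) =
      concat_mul (- desusp C' (h b)) (?\<Psi> (cobar_word_diff C w)) +
      smul ((-1) ^ (bdeg C b - 1)) (concat_mul (desusp C' (\<phi> b)) (?S (cobar_word_diff C w)))"
    by (subst homotopy_concat_mul[where m = "bdeg C b - 1"]) (simp_all add: cobar_map_def)
  ultimately have SD: "?S (cobar_word_diff C (b # w)) =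
      concat_mul (?S (cobar_gen_diff C b)) (cobar_word_map C' \<psi> w) +
      smul ((-1) ^ bdeg C b) (concat_mul (?\<Phi> (cobar_gen_diff C b)) (cobar_word_homotopy C C' \<phi> \<psi> h w)) +
      smul ((-1) ^ (bdeg C b - 1)) (concat_mul (- desusp C' (h b)) (?\<Psi> (cobar_word_diff C w))) +
      concat_mul (desusp C' (\<phi> b)) (?S (cobar_word_diff C w))"
    by (simp add: smul_distribs add.assoc flip: power_mult_distrib)
  have DS: "?D' (cobar_word_homotopy C C' \<phi> \<psi> h (b # w)) =
     - (concat_mul (?D' (desusp C' (h b))) (cobar_word_map C' \<psi> w) +
        smul ((-1) ^ bdeg C b) (concat_mul (desusp C' (h b)) (?D' (cobar_word_map C' \<psi> w)))) +
     smul ((-1) ^ (bdeg C b - 1)) (concat_mul (?D' (desusp C' (\<phi> b))) (cobar_word_homotopy C C' \<phi> \<psi> h w)) +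
     concat_mul (desusp C' (\<phi> b)) (?D' (cobar_word_homotopy C C' \<phi> \<psi> h w))"
    by (simp add: diff_concat_mul[OF deg_\<phi>] diff_concat_mul[OF deg_h] smul_distribs flip: power_mult_distrib)
  have IH: "?D' (cobar_word_homotopy C C' \<phi> \<psi> h w) + ?S (cobar_word_diff C w) =
      cobar_word_map C' \<phi> w - cobar_word_map C' \<psi> w"
    using Cons by simp
  have "?D' (cobar_word_homotopy C C' \<phi> \<psi> h (b # w)) + ?S (cobar_word_diff C (b # w)) =
      concat_mul (?S (cobar_gen_diff C b) - ?D' (desusp C' (h b))) (cobar_word_map C' \<psi> w) +
      concat_mul (desusp C' (\<phi> b)) (?D' (cobar_word_homotopy C C' \<phi> \<psi> h w) + ?S (cobar_word_diff C w))"
    unfolding SD DS \<phi>_step \<Psi>w neg by (simp add: bilin_add bilin_diff)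
  also have "\<dots> = cobar_word_map C' \<phi> (b # w) - cobar_word_map C' \<psi> (b # w)"
    unfolding gen_step IH by (simp add: bilin_diff)
  finally show ?case .
qed simp

lemma cobar_map_homotopic:
  assumes C: "connected_dg_coalgebra C" and C': "connected_dg_coalgebra C'"
    and \<phi>: "dg_coalgebra_map C C' \<phi>" and \<psi>: "dg_coalgebra_map C C' \<psi>"
    and h: "coderivation_homotopy C C' \<phi> \<psi> h" and x: "x \<in> cycles (cobar C) n"
  shows "cobar_map C' \<phi> x - cobar_map C' \<psi> x \<in> diff (cobar C') ` grade (cobar C') (Suc n)"
proof -
  let ?S = "lin (cobar_word_homotopy C C' \<phi> \<psi> h)" and ?D' = "lin (cobar_word_diff C')"
  have keys: "Poly_Mapping.keys x \<subseteq> cobar_words C n" and cyc: "lin (cobar_word_diff C) x = 0"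
    using x by (auto simp: cycles_def)
  have "Poly_Mapping.keys (?S x) \<subseteq> cobar_words C' (Suc n)"
    using keys by (intro keys_lin_subset keys_cobar_word_homotopy[OF \<phi> \<psi> h]) auto
  moreover have "lin (\<lambda>w. ?D' (cobar_word_homotopy C C' \<phi> \<psi> h w) + ?S (cobar_word_diff C w)) x =
      lin (\<lambda>w. cobar_word_map C' \<phi> w - cobar_word_map C' \<psi> w) x"
    using keys by (intro lin_cong cobar_word_homotopy_diff[OF C C' \<phi> \<psi> h]) (auto simp: cobar_words_def)
  then have "?D' (?S x) + ?S (lin (cobar_word_diff C) x) = cobar_map C' \<phi> x - cobar_map C' \<psi> x"
    by (simp add: lin_fun_add lin_fun_diff lin_lin cobar_map_def)
  ultimately show ?thesis
    using cyc by (intro image_eqI[of _ _ "?S x"]) simp_all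
qed

lemma cobar_map_comp:
  assumes C: "connected_dg_coalgebra C" and C': "connected_dg_coalgebra C'"
    and \<phi>: "dg_coalgebra_map C C' \<phi>" and \<psi>: "dg_coalgebra_map C' C'' \<psi>"
    and \<gamma>: "\<And>b. b \<in> basis C \<Longrightarrow> \<gamma> b = lin \<psi> (\<phi> b)"
    and x: "Poly_Mapping.keys x \<subseteq> cobar_words C n"
  shows "cobar_map C'' \<psi> (cobar_map C' \<phi> x) = cobar_map C'' \<gamma> x"
proof -
  have "cobar_map C'' \<psi> (cobar_word_map C' \<phi> w) = cobar_word_map C'' \<gamma> w" if "set w \<subseteq> pos_basis C" for w
    using that
  proof (induction w)
    case (Cons b w)
    then have b: "b \<in> basis C" by simp
    have "Poly_Mapping.keys (\<phi> b) \<subseteq> basis C'"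
      using dg_coalgebra_mapD(1)[OF \<phi> b] by auto
    with Cons \<gamma>[OF b] show ?case
      by (simp add: cobar_map_concat_mul cobar_gen_map[OF C' \<psi>])
  qed (simp add: cobar_map_def)
  then have "lin (\<lambda>w. cobar_map C'' \<psi> (cobar_word_map C' \<phi> w)) x = cobar_map C'' \<gamma> x"
    using x unfolding cobar_map_def[of C'' \<gamma>] by (intro lin_cong) (auto simp: cobar_words_def)
  then show ?thesis by (simp add: cobar_map_def lin_lin)
qed

lemma cobar_map_id:
  assumes \<iota>: "\<And>b. b \<in> basis C \<Longrightarrow> \<iota> b = gen b" and x: "Poly_Mapping.keys x \<subseteq> cobar_words C n"
  shows "cobar_map C \<iota> x = x"
proof -
  have "cobar_word_map C \<iota> w = gen w" if "set w \<subseteq> pos_basis C" for w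
    using that by (induction w) (auto simp: \<iota> desusp_gen)
  then have "cobar_map C \<iota> x = lin gen x"
    using x unfolding cobar_map_def by (intro lin_cong) (auto simp: cobar_words_def)
  then show ?thesis by simp
qed

lemma equiv_homologous_cobar: "equiv (cycles (cobar C) n) (homologous (cobar C) n)"
proof (rule equivI)
  let ?B = "diff (cobar C) ` grade (cobar C) (Suc n)"
  have neg: "- z \<in> ?B" if "z \<in> ?B" for z
  proof -
    from that obtain y where "z = lin (cobar_word_diff C) y" "Poly_Mapping.keys y \<subseteq> cobar_words C (Suc n)"
      by auto
    then show ?thesis by (intro image_eqI[of _ _ "- y"]) simp_all
  qed
  have add: "z + z' \<in> ?B" if "z \<in> ?B" "z' \<in> ?B" for z z'
  proof -
    from that obtain y y' where "z = lin (cobar_word_diff C) y" "Poly_Mapping.keys y \<subseteq> cobar_words C (Suc n)"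
      "z' = lin (cobar_word_diff C) y'" "Poly_Mapping.keys y' \<subseteq> cobar_words C (Suc n)"
      by auto
    then show ?thesis
      using keys_add[of y y'] by (intro image_eqI[of _ _ "y + y'"]) auto
  qed
  have "0 \<in> ?B" by (rule image_eqI[of _ _ 0]) simp_all
  then show "refl_on (cycles (cobar C) n) (homologous (cobar C) n)"
    by (auto simp: refl_on_def homologous_def)
  show "sym (homologous (cobar C) n)"
  proof (rule symI)
    fix x y assume "(x, y) \<in> homologous (cobar C) n"
    then show "(y, x) \<in> homologous (cobar C) n"
      using neg[of "x - y"] by (simp add: homologous_def)
  qed
  show "trans (homologous (cobar C) n)"
  proof (rule transI)
    fix x y z assume "(x, y) \<in> homologous (cobar C) n" "(y, z) \<in> homologous (cobar C) n"
    then show "(x, z) \<in> homologous (cobar C) n"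
      using add[of "x - y" "y - z"] by (simp add: homologous_def)
  qed
  show "homologous (cobar C) n \<subseteq> cycles (cobar C) n \<times> cycles (cobar C) n"
    by (auto simp: homologous_def)
qed

lemma cobar_map_cycles:
  assumes "connected_dg_coalgebra C" "connected_dg_coalgebra C'" "dg_coalgebra_map C C' \<phi>"
    and "x \<in> cycles (cobar C) n"
  shows "cobar_map C' \<phi> x \<in> cycles (cobar C') n"
  using assms(4) keys_cobar_map[OF assms(3)] cobar_map_diff[OF assms(1-3), of x n] by (simp add: cycles_def)

lemma cobar_map_homologous:
  assumes "connected_dg_coalgebra C" "connected_dg_coalgebra C'" "dg_coalgebra_map C C' \<phi>"
    and "(x, y) \<in> homologous (cobar C) n"
  shows "(cobar_map C' \<phi> x, cobar_map C' \<phi> y) \<in> homologous (cobar C') n"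
proof -
  obtain z where z: "x - y = lin (cobar_word_diff C) z" "Poly_Mapping.keys z \<subseteq> cobar_words C (Suc n)"
    using assms(4) by (auto simp: homologous_def)
  then have "cobar_map C' \<phi> x - cobar_map C' \<phi> y = lin (cobar_word_diff C') (cobar_map C' \<phi> z)"
    using cobar_map_diff[OF assms(1-3), of z] by (metis cobar_map_linear(3))
  moreover have "cobar_map C' \<phi> z \<in> grade (cobar C') (Suc n)"
    using keys_cobar_map[OF assms(3) z(2)] by simp
  ultimately show ?thesis
    using assms(4) cobar_map_cycles[OF assms(1-3)] unfolding homologous_def by auto
qed

text \<open>Homotopic maps agree on homology, so a homotopy inverse induces an inverse there. The composites and
  the identities are represented by functions that agree with them on the bases, because the values
  outside the basis are arbitrary.\<close>

lemma dga_quasi_iso_cobar_map: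
  assumes C: "connected_dg_coalgebra C" and C': "connected_dg_coalgebra C'"
    and \<phi>: "dg_coalgebra_map C C' \<phi>" and \<psi>: "dg_coalgebra_map C' C \<psi>"
    and \<gamma>: "dg_coalgebra_map C C \<gamma>" "\<And>b. b \<in> basis C \<Longrightarrow> \<gamma> b = lin \<psi> (\<phi> b)"
    and \<iota>: "dg_coalgebra_map C C \<iota>" "\<And>b. b \<in> basis C \<Longrightarrow> \<iota> b = gen b"
    and h: "coderivation_homotopy C C \<gamma> \<iota> h"
    and \<gamma>': "dg_coalgebra_map C' C' \<gamma>'" "\<And>b. b \<in> basis C' \<Longrightarrow> \<gamma>' b = lin \<phi> (\<psi> b)"
    and \<iota>': "dg_coalgebra_map C' C' \<iota>'" "\<And>b. b \<in> basis C' \<Longrightarrow> \<iota>' b = gen b"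
    and h': "coderivation_homotopy C' C' \<gamma>' \<iota>' h'"
  shows "dga_quasi_iso (cobar C) (cobar C') (cobar_map C' \<phi>)"
  unfolding dga_quasi_iso_def
proof (intro conjI allI)
  show "dga_map (cobar C) (cobar C') (cobar_map C' \<phi>)"
    by (rule dga_map_cobar_map[OF C C' \<phi>])
  fix n
  let ?R = "homologous (cobar C) n" and ?R' = "homologous (cobar C') n"
  let ?f = "cobar_map C' \<phi>" and ?g = "cobar_map C \<psi>"
  note eq = equiv_homologous_cobar[of C n] equiv_homologous_cobar[of C' n]
  have f: "(?f x, ?f y) \<in> ?R'" if "(x, y) \<in> ?R" for x y
    by (rule cobar_map_homologous[OF C C' \<phi> that])
  have g: "(?g x, ?g y) \<in> ?R" if "(x, y) \<in> ?R'" for x y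
    by (rule cobar_map_homologous[OF C' C \<psi> that])
  note cyc = cobar_map_cycles[OF C C' \<phi>] and cyc' = cobar_map_cycles[OF C' C \<psi>]
  have gf: "(?g (?f x), x) \<in> ?R" if x: "x \<in> cycles (cobar C) n" for x
  proof -
    have k: "Poly_Mapping.keys x \<subseteq> cobar_words C n" using x by (simp add: cycles_def)
    have e: "cobar_map C \<gamma> x = ?g (?f x)" "cobar_map C \<iota> x = x"
      using cobar_map_comp[OF C C' \<phi> \<psi> \<gamma>(2) k] cobar_map_id[OF \<iota>(2) k] by simp_all
    show ?thesis
      using cobar_map_homotopic[OF C C \<gamma>(1) \<iota>(1) h x] x cyc'[OF cyc[OF x]]
      unfolding homologous_def by (simp add: e)
  qed
  have fg: "(?f (?g x), x) \<in> ?R'" if x: "x \<in> cycles (cobar C') n" for x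
  proof -
    have k: "Poly_Mapping.keys x \<subseteq> cobar_words C' n" using x by (simp add: cycles_def)
    have e: "cobar_map C' \<gamma>' x = ?f (?g x)" "cobar_map C' \<iota>' x = x"
      using cobar_map_comp[OF C' C \<psi> \<phi> \<gamma>'(2) k] cobar_map_id[OF \<iota>'(2) k] by simp_all
    show ?thesis
      using cobar_map_homotopic[OF C' C' \<gamma>'(1) \<iota>'(1) h' x] x cyc[OF cyc'[OF x]]
      unfolding homologous_def by (simp add: e)
  qed
  have cls: "?R' `` (?f ` (?R `` {x})) = ?R' `` {?f x}" if "x \<in> cycles (cobar C) n" for x
  proof -
    have "?R' `` {?f y} = ?R' `` {?f x}" if "(x, y) \<in> ?R" for y
      using equiv_class_eq[OF eq(2) f[OF that]] by simp
    moreover have "(x, x) \<in> ?R"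
      using eq(1) that by (simp add: equiv_def refl_on_def)
    ultimately show ?thesis by blast
  qed
  show "bij_betw (\<lambda>c. ?R' `` (?f ` c)) (dga_homology (cobar C) n) (dga_homology (cobar C') n)"
    unfolding bij_betw_def
  proof
    show "inj_on (\<lambda>c. ?R' `` (?f ` c)) (dga_homology (cobar C) n)"
    proof (rule inj_onI)
      fix c d assume "c \<in> dga_homology (cobar C) n" "d \<in> dga_homology (cobar C) n"
        and eqcd: "?R' `` (?f ` c) = ?R' `` (?f ` d)"
      then obtain x y where xy: "c = ?R `` {x}" "d = ?R `` {y}" "x \<in> cycles (cobar C) n" "y \<in> cycles (cobar C) n"
        unfolding dga_homology_def by (auto elim!: quotientE)
      then have "(?f x, ?f y) \<in> ?R'"
        using eqcd eq_equiv_class[OF _ eq(2)] cyc by (simp add: cls)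
      then have "(?g (?f x), ?g (?f y)) \<in> ?R" by (rule g)
      then have "(x, y) \<in> ?R"
        using gf[OF xy(3)] gf[OF xy(4)] eq(1) unfolding equiv_def by (meson symD transD)
      then show "c = d" using xy equiv_class_eq[OF eq(1)] by simp
    qed
    have "\<exists>c\<in>dga_homology (cobar C) n. d = ?R' `` (?f ` c)" if "d \<in> dga_homology (cobar C') n" for d
    proof -
      from that obtain y where y: "d = ?R' `` {y}" "y \<in> cycles (cobar C') n"
        unfolding dga_homology_def by (auto elim!: quotientE)
      have "d = ?R' `` {?f (?g y)}"
        using y equiv_class_eq[OF eq(2) fg[OF y(2)]] by simp
      also have "\<dots> = ?R' `` (?f ` (?R `` {?g y}))"
        by (rule cls[OF cyc'[OF y(2)], symmetric])
      finally show ?thesis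
        using cyc'[OF y(2)] unfolding dga_homology_def by (blast intro: quotientI)
    qed
    moreover have "?R' `` (?f ` c) \<in> dga_homology (cobar C') n" if "c \<in> dga_homology (cobar C) n" for c
      using that cls cyc unfolding dga_homology_def by (auto elim!: quotientE intro!: quotientI)
    ultimately show "(\<lambda>c. ?R' `` (?f ` c)) ` dga_homology (cobar C) n = dga_homology (cobar C') n"
      by blast
  qed
qed

section \<open>Simplicial operators\<close>

lemma DeltaI:
  assumes "\<theta> \<in> extensional {..m}" "\<And>i. i \<le> m \<Longrightarrow> \<theta> i \<le> n" "\<And>i j. i \<le> j \<Longrightarrow> j \<le> m \<Longrightarrow> \<theta> i \<le> \<theta> j"
  shows "\<theta> \<in> Delta m n"
  using assms by (auto simp: Delta_def PiE_def mono_on_def)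

lemma DeltaD:
  assumes "\<theta> \<in> Delta m n"
  shows "\<theta> \<in> extensional {..m}" "i \<le> m \<Longrightarrow> \<theta> i \<le> n" "i \<le> j \<Longrightarrow> j \<le> m \<Longrightarrow> \<theta> i \<le> \<theta> j"
  using assms by (auto simp: Delta_def PiE_def mono_on_def)

lemma Delta_eqI:
  assumes "\<theta> \<in> Delta m n" "\<eta> \<in> Delta m n'" "\<And>i. i \<le> m \<Longrightarrow> \<theta> i = \<eta> i"
  shows "\<theta> = \<eta>"
  using DeltaD(1)[OF assms(1)] DeltaD(1)[OF assms(2)] assms(3) by (intro extensionalityI) auto

lemma Delta_id [simp]: "(\<lambda>i\<in>{..n}. i) \<in> Delta n n"
  by (rule DeltaI) auto

lemma Delta_compose:
  assumes "\<theta> \<in> Delta m n" "\<eta> \<in> Delta l m"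
  shows "compose {..l} \<theta> \<eta> \<in> Delta l n"
  using DeltaD[OF assms(1)] DeltaD[OF assms(2)] by (intro DeltaI) (auto simp: compose_def)

lemma coface_Delta [simp]: "i \<le> Suc n \<Longrightarrow> coface (Suc n) i \<in> Delta n (Suc n)"
  by (rule DeltaI) (auto simp: coface_def)

lemma codegen_Delta [simp]: "i \<le> n \<Longrightarrow> codegen n i \<in> Delta (Suc n) n"
  by (rule DeltaI) (auto simp: codegen_def)

lemma front_inc_Delta [simp]: "p \<le> n \<Longrightarrow> front_inc p \<in> Delta p n"
  by (rule DeltaI) (auto simp: front_inc_def)

lemma last_inc_Delta [simp]: "p + q \<le> n \<Longrightarrow> last_inc p q \<in> Delta q n"
  by (rule DeltaI) (auto simp: last_inc_def)

lemma operator_apply [simp]: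
  "j \<le> n \<Longrightarrow> coface (Suc n) i j = (if j < i then j else Suc j)"
  "j \<le> Suc n \<Longrightarrow> codegen n i j = (if j \<le> i then j else j - 1)"
  "i \<le> p \<Longrightarrow> front_inc p i = i" "i \<le> q \<Longrightarrow> last_inc p q i = i + p"
  "i \<le> n \<Longrightarrow> compose {..n} \<theta> \<eta> i = \<theta> (\<eta> i)"
  by (auto simp: coface_def codegen_def front_inc_def last_inc_def compose_def)

lemma simplicial_setD:
  assumes "simplicial_set X" "x \<in> simplices X n"
  shows "\<theta> \<in> Delta m n \<Longrightarrow> act X n m \<theta> x \<in> simplices X m"
    and "act X n n (\<lambda>i\<in>{..n}. i) x = x"
    and "\<theta> \<in> Delta m n \<Longrightarrow> \<eta> \<in> Delta l m \<Longrightarrow> act X m l \<eta> (act X n m \<theta> x) = act X n l (compose {..l} \<theta> \<eta>) x"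
  using assms unfolding simplicial_set_def by blast+

lemma act_act_eq:
  assumes "simplicial_set X" "x \<in> simplices X n"
    and "\<theta> \<in> Delta m n" "\<eta> \<in> Delta l m" "\<theta>' \<in> Delta m' n" "\<eta>' \<in> Delta l m'"
    and "\<And>i. i \<le> l \<Longrightarrow> \<theta> (\<eta> i) = \<theta>' (\<eta>' i)"
  shows "act X m l \<eta> (act X n m \<theta> x) = act X m' l \<eta>' (act X n m' \<theta>' x)"
proof -
  have "compose {..l} \<theta> \<eta> = compose {..l} \<theta>' \<eta>'"
    using assms(7) by (auto simp: compose_def restrict_def)
  then show ?thesis
    by (simp add: simplicial_setD(3)[OF assms(1,2)] assms(3-6))
qed

lemma act_act_eq1:
  assumes "simplicial_set X" "x \<in> simplices X n"
    and "\<theta> \<in> Delta m n" "\<eta> \<in> Delta l m" "\<zeta> \<in> Delta l n"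
    and "\<And>i. i \<le> l \<Longrightarrow> \<theta> (\<eta> i) = \<zeta> i"
  shows "act X m l \<eta> (act X n m \<theta> x) = act X n l \<zeta> x"
proof -
  have "compose {..l} \<theta> \<eta> = \<zeta>"
    using assms by (intro Delta_eqI[OF Delta_compose]) (auto simp: compose_def)
  then show ?thesis
    by (simp add: simplicial_setD(3)[OF assms(1,2)] assms(3-6))
qed

lemma degenerate_if_repeats:
  assumes X: "simplicial_set X" "x \<in> simplices X n" and \<theta>: "\<theta> \<in> Delta m n" and i: "i < m" "\<theta> i = \<theta> (Suc i)"
  shows "degenerate X m (act X n m \<theta> x)"
proof -
  obtain k where k: "m = Suc k" using i by (cases m) auto
  define \<eta> where "\<eta> = compose {..k} \<theta> (coface (Suc k) (Suc i))"
  have \<eta>: "\<eta> \<in> Delta k n"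
    unfolding \<eta>_def using i k \<theta> by (intro Delta_compose[of _ m]) auto
  have "act X k m (codegen k i) (act X n k \<eta> x) = act X n m \<theta> x"
    using i k \<theta> \<eta> by (intro act_act_eq1[OF X]) (auto simp: \<eta>_def le_Suc_eq not_le le_less_Suc_eq)
  then show ?thesis
    unfolding degenerate_def using k i simplicial_setD(1)[OF X \<eta>] by (metis less_Suc_eq_le)
qed

lemma degenerate_act:
  assumes X: "simplicial_set X" and x: "x \<in> simplices X n" and deg: "x = act X n' n (codegen n' j) y"
    "n = Suc n'" "j \<le> n'" "y \<in> simplices X n'"
    and \<eta>: "\<eta> \<in> Delta m n" "a < m" "\<eta> a = j" "\<eta> (Suc a) = Suc j"
  shows "degenerate X m (act X n m \<eta> x)"
proof -
  have "act X n m \<eta> x = act X n' m (compose {..m} (codegen n' j) \<eta>) y"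
    unfolding deg(1) using deg \<eta> by (subst simplicial_setD(3)[OF X]) auto
  moreover have "compose {..m} (codegen n' j) \<eta> \<in> Delta m n'"
    using deg \<eta> by (intro Delta_compose[of _ n]) auto
  ultimately show ?thesis
    using degenerate_if_repeats[OF X deg(4), of _ m a] \<eta> deg by auto
qed

lemma degenerate_simplices:
  assumes "simplicial_set X" "degenerate X n x"
  shows "x \<in> simplices X n"
  using assms simplicial_setD(1)[OF assms(1)] unfolding degenerate_def by auto

lemma sset_mapD:
  assumes "sset_map X Y f" "x \<in> simplices X n"
  shows "f n x \<in> simplices Y n" "\<theta> \<in> Delta m n \<Longrightarrow> f m (act X n m \<theta> x) = act Y n m \<theta> (f n x)"
  using assms unfolding sset_map_def by blast+

lemma degenerate_sset_map:
  assumes f: "sset_map X Y f" and "degenerate X n x"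
  shows "degenerate Y n (f n x)"
proof -
  obtain m i y where *: "n = Suc m" "i \<le> m" "y \<in> simplices X m" "x = act X m n (codegen m i) y"
    using assms(2) unfolding degenerate_def by blast
  then have "f n x = act Y m n (codegen m i) (f m y)"
    using sset_mapD(2)[OF f *(3)] by simp
  with * sset_mapD(1)[OF f *(3)] show ?thesis
    unfolding degenerate_def by blast
qed

section \<open>Normalized chains\<close>

lemma nchain_degenerate [simp]: "degenerate X n x \<Longrightarrow> nchain X n x = 0"
  by (simp add: nchain_def)

lemma Q_Delta_simps [simp]:
  "basis (Q_Delta X) = {(n, x). x \<in> simplices X n \<and> \<not> degenerate X n x}"
  "bdeg (Q_Delta X) = fst"
  "counit (Q_Delta X) = (\<lambda>(n, x). if n = 0 then 1 else 0)"
  "unit_elt (Q_Delta X) = (0, the_elem (simplices X 0))"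
  by (simp_all add: Q_Delta_def)

definition face_sum :: "'a sset \<Rightarrow> nat \<Rightarrow> 'a \<Rightarrow> (nat \<times> 'a \<Rightarrow>\<^sub>0 'k::comm_ring_1)" where
  "face_sum X n x = (\<Sum>i\<le>Suc n. smul ((-1) ^ i) (nchain X n (act X (Suc n) n (coface (Suc n) i) x)))"

definition AW_sum :: "'a sset \<Rightarrow> nat \<Rightarrow> 'a \<Rightarrow> ((nat \<times> 'a) \<times> (nat \<times> 'a) \<Rightarrow>\<^sub>0 'k::comm_ring_1)" where
  "AW_sum X n x = (\<Sum>p\<le>n. tensor (nchain X p (act X n p (front_inc p) x))
                              (nchain X (n - p) (act X n (n - p) (last_inc p (n - p)) x)))"

lemma bd_Q_Delta: "bd (Q_Delta X) (0, x) = 0" "bd (Q_Delta X) (Suc n, x) = face_sum X n x"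
  by (simp_all add: Q_Delta_def face_sum_def)

lemma cop_Q_Delta: "cop (Q_Delta X) (n, x) = AW_sum X n x"
  by (simp add: Q_Delta_def AW_sum_def)

text \<open>The two faces that remove the repeated vertex of a degenerate simplex cancel, the others are degenerate.\<close>

lemma face_sum_degenerate:
  assumes X: "simplicial_set X" and deg: "degenerate X (Suc n) x"
  shows "face_sum X n x = 0"
proof -
  obtain j y where j: "j \<le> n" "y \<in> simplices X n" "x = act X n (Suc n) (codegen n j) y"
    using deg unfolding degenerate_def by blast
  have x: "x \<in> simplices X (Suc n)"
    by (rule degenerate_simplices[OF X deg])
  let ?d = "\<lambda>i. act X (Suc n) n (coface (Suc n) i) x"
  have y: "?d i = y" if "i = j \<or> i = Suc j" for i
  proof -
    have "?d i = act X n n (\<lambda>i\<in>{..n}. i) y"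
      unfolding j(3) using that j by (intro act_act_eq1[OF X]) auto
    then show ?thesis using simplicial_setD(2)[OF X j(2)] by simp
  qed
  have other: "degenerate X n (?d i)" if "i \<le> Suc n" "i \<noteq> j" "i \<noteq> Suc j" for i
  proof (cases "i < j")
    case True
    then show ?thesis
      using that j by (intro degenerate_act[OF X x j(3) refl j(1,2), where a = "j - 1"]) auto
  next
    case False
    then show ?thesis
      using that j by (intro degenerate_act[OF X x j(3) refl j(1,2), where a = j]) auto
  qed
  have "face_sum X n x = (\<Sum>i\<in>{j, Suc j}. smul ((-1) ^ i) (nchain X n (?d i)) :: _ \<Rightarrow>\<^sub>0 'b)"
    unfolding face_sum_def using other j by (intro sum.mono_neutral_right) auto
  then show ?thesis
    by (simp add: y)
qed

text \<open>The front and the back face of a cut share a vertex, so the two equal consecutive vertices of a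
  degenerate simplex lie together in one of them.\<close>

lemma AW_sum_degenerate:
  assumes X: "simplicial_set X" and deg: "degenerate X n x"
  shows "AW_sum X n x = 0"
proof -
  obtain m j y where j: "n = Suc m" "j \<le> m" "y \<in> simplices X m" "x = act X m n (codegen m j) y"
    using deg unfolding degenerate_def by blast
  have x: "x \<in> simplices X n"
    by (rule degenerate_simplices[OF X deg])
  have "degenerate X p (act X n p (front_inc p) x) \<or> degenerate X (n - p) (act X n (n - p) (last_inc p (n - p)) x)"
    if "p \<le> n" for p
  proof (cases "p \<le> j")
    case True
    have "degenerate X (n - p) (act X n (n - p) (last_inc p (n - p)) x)"
      using True that j by (intro degenerate_act[OF X x j(4) j(1-3), where a = "j - p"]) auto
    then show ?thesis ..
  next
    case False
    have "degenerate X p (act X n p (front_inc p) x)"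
      using False that j by (intro degenerate_act[OF X x j(4) j(1-3), where a = j]) auto
    then show ?thesis ..
  qed
  then have "tensor (nchain X p (act X n p (front_inc p) x))
      (nchain X (n - p) (act X n (n - p) (last_inc p (n - p)) x)) = 0" if "p \<le> n" for p
    using that by fastforce
  then show ?thesis
    unfolding AW_sum_def by (intro sum.neutral) blast
qed

lemma lin_bd_nchain:
  assumes X: "simplicial_set X"
  shows "lin (bd (Q_Delta X)) (nchain X (Suc n) x) = face_sum X n x"
    "lin (bd (Q_Delta X)) (nchain X 0 x) = 0"
  by (simp_all add: nchain_def bd_Q_Delta face_sum_degenerate[OF X])

lemma lin_cop_nchain:
  assumes X: "simplicial_set X"
  shows "lin (cop (Q_Delta X)) (nchain X n x) = AW_sum X n x"
  by (simp add: nchain_def cop_Q_Delta AW_sum_degenerate[OF X])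

text \<open>The cancellation behind the vanishing of the square of an alternating sum of faces: the index pairs
  below the diagonal are matched with those above it.\<close>

lemma alternating_double_sum:
  fixes F :: "nat \<Rightarrow> nat \<Rightarrow> ('b \<Rightarrow>\<^sub>0 'k::comm_ring_1)"
  assumes "\<And>i j. i < j \<Longrightarrow> j \<le> Suc n \<Longrightarrow> F i j = F (j - 1) i"
  shows "(\<Sum>j\<le>Suc n. \<Sum>i\<le>n. smul ((-1) ^ (i + j)) (F i j)) = 0"
proof -
  let ?g = "\<lambda>(j, i). smul ((-1) ^ (i + j)) (F i j)"
  let ?A = "{(j, i). i < j \<and> j \<le> Suc n}" and ?B = "{(j, i). j \<le> i \<and> i \<le> n}"
  have fin: "finite ?A" "finite ?B"
    by (rule finite_subset[of _ "{..Suc n} \<times> {..Suc n}"]; force)+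
  have "(\<Sum>j\<le>Suc n. \<Sum>i\<le>n. smul ((-1) ^ (i + j)) (F i j)) = sum ?g ({..Suc n} \<times> {..n})"
    by (simp only: sum.cartesian_product)
  also have "{..Suc n} \<times> {..n} = ?A \<union> ?B" by auto
  also have "sum ?g (?A \<union> ?B) = sum ?g ?A + sum ?g ?B"
  proof (rule sum.union_disjoint[OF fin])
    show "?A \<inter> ?B = {}" by fastforce
  qed
  also have "sum ?g ?A = sum (\<lambda>p. - ?g p) ?B"
  proof (rule sum.reindex_bij_witness[of _ "\<lambda>(j, i). (Suc i, j)" "\<lambda>(j, i). (i, j - 1)"]; clarify?)
    fix i j assume "i < j" "j \<le> Suc n"
    then show "- smul ((-1) ^ (j - 1 + i)) (F (j - 1) i) = smul ((-1) ^ (i + j)) (F i j)"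
      using assms[of i j] by (cases j) (auto simp: add.commute)
  qed auto
  finally show ?thesis by (simp add: sum_negf)
qed

lemma triangle_sum:
  fixes g :: "nat \<Rightarrow> nat \<Rightarrow> 'c::comm_monoid_add"
  shows "(\<Sum>i\<le>n. \<Sum>p\<le>i. g i p) = (\<Sum>p\<le>n. \<Sum>j\<le>n - p. g (p + j) p)"
proof -
  have "(\<Sum>i\<le>n. \<Sum>p\<le>i. g i p) = (\<Sum>(i, p)\<in>(SIGMA i:{..n}. {..i}). g i p)"
    by (rule sum.Sigma) auto
  also have "\<dots> = (\<Sum>(p, j)\<in>(SIGMA p:{..n}. {..n - p}). g (p + j) p)"
    by (rule sum.reindex_bij_witness[of _ "\<lambda>(p, j). (p + j, p)" "\<lambda>(i, p). (p, i - p)"]) auto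
  also have "\<dots> = (\<Sum>p\<le>n. \<Sum>j\<le>n - p. g (p + j) p)"
    by (rule sum.Sigma[symmetric]) auto
  finally show ?thesis .
qed

lemma face_sum_face_sum:
  assumes X: "simplicial_set X" and x: "x \<in> simplices X (Suc n)"
  shows "lin (bd (Q_Delta X)) (face_sum X n x) = 0"
proof (cases n)
  case 0
  then show ?thesis
    by (simp add: face_sum_def lin_bd_nchain(2)[OF X])
next
  case (Suc m)
  let ?dd = "\<lambda>i j. act X (Suc m) m (coface (Suc m) i) (act X (Suc (Suc m)) (Suc m) (coface (Suc (Suc m)) j) x)"
  have "lin (bd (Q_Delta X)) (face_sum X n x) =
     (\<Sum>j\<le>Suc (Suc m). \<Sum>i\<le>Suc m. smul ((-1) ^ (i + j)) (nchain X m (?dd i j)) :: _ \<Rightarrow>\<^sub>0 'b)"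
    unfolding Suc face_sum_def[of X "Suc m"]
    by (simp add: lin_bd_nchain(1)[OF X] face_sum_def[of X m] smul_sum power_add mult.commute del: sum.atMost_Suc)
  also have "\<dots> = 0"
  proof (rule alternating_double_sum, rule arg_cong[where f = "nchain X m"])
    fix i j assume "i < j" "j \<le> Suc (Suc m)"
    then show "?dd i j = ?dd (j - 1) i"
      using x Suc by (intro act_act_eq[OF X]) auto
  qed
  finally show ?thesis .
qed

lemma front_last_identities:
  assumes X: "simplicial_set X" "x \<in> simplices X n"
  shows "p \<le> n \<Longrightarrow> q \<le> p \<Longrightarrow> act X p q (front_inc q) (act X n p (front_inc p) x) = act X n q (front_inc q) x"
    and "p + q + r \<le> n \<Longrightarrow> act X (q + r) r (last_inc q r) (act X n (q + r) (last_inc p (q + r)) x) = act X n r (last_inc (p + q) r) x"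
    and "p + q \<le> n \<Longrightarrow> act X (p + q) q (last_inc p q) (act X n (p + q) (front_inc (p + q)) x) =
      act X (n - p) q (front_inc q) (act X n (n - p) (last_inc p (n - p)) x)"
    subgoal by (intro act_act_eq1[OF X]) auto
   subgoal by (intro act_act_eq1[OF X]) auto
  subgoal by (intro act_act_eq[OF X]) auto
  done

text \<open>Both sides are the sum over all ways of cutting the simplex at two vertices into a front, a middle and a
  back face.\<close>

lemma AW_sum_coassoc:
  assumes X: "simplicial_set X" and x: "x \<in> simplices X n"
  shows "lin (\<lambda>(x, y). lin (\<lambda>(x1, x2). gen (x1, x2, y)) (cop (Q_Delta X) x)) (AW_sum X n x :: _ \<Rightarrow>\<^sub>0 'k::comm_ring_1) =
    lin (\<lambda>(x, y). lin (\<lambda>(y1, y2). gen (x, y1, y2)) (cop (Q_Delta X) y)) (AW_sum X n x)"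
proof -
  let ?F = "\<lambda>p. (nchain X p (act X n p (front_inc p) x) :: _ \<Rightarrow>\<^sub>0 'k)"
  let ?L = "\<lambda>p. (nchain X (n - p) (act X n (n - p) (last_inc p (n - p)) x) :: _ \<Rightarrow>\<^sub>0 'k)"
  let ?M = "\<lambda>q p. (nchain X p (act X (n - q) p (front_inc p) (act X n (n - q) (last_inc q (n - q)) x)) :: _ \<Rightarrow>\<^sub>0 'k)"
  define tri where "tri = (\<lambda>a b c. bilin (\<lambda>x (y, z). (x, y, z)) a (tensor b c) :: (nat \<times> 'a) \<times> (nat \<times> 'a) \<times> (nat \<times> 'a) \<Rightarrow>\<^sub>0 'k)"
  have tri: "bilin (\<lambda>(x, y) z. (x, y, z)) (tensor a b) c = tri a b c" for a b c
    by (simp add: tri_def bilin_def lin_lin)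
  have left: "lin (\<lambda>(x, y). lin (\<lambda>(x1, x2). gen (x1, x2, y)) (cop (Q_Delta X) x)) (tensor a c) =
      bilin (\<lambda>(x, y) z. (x, y, z)) (lin (cop (Q_Delta X)) a) c" for a c :: "nat \<times> 'a \<Rightarrow>\<^sub>0 'k"
    by (simp add: bilin_def lin_lin) (simp add: lin_swap[of _ c] case_prod_unfold)
  have "lin (\<lambda>(x, y). lin (\<lambda>(x1, x2). gen (x1, x2, y)) (cop (Q_Delta X) x)) (AW_sum X n x) =
      (\<Sum>p\<le>n. bilin (\<lambda>(x, y) z. (x, y, z)) (AW_sum X p (act X n p (front_inc p) x)) (?L p))"
    unfolding AW_sum_def[of X n] lin_sum by (simp only: left lin_cop_nchain[OF X])
  also have "\<dots> = (\<Sum>p\<le>n. \<Sum>q\<le>p. tri (?F q) (?M q (p - q)) (?L p))"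
    unfolding AW_sum_def bilin_sum tri
  proof (intro sum.cong refl)
    fix p q assume "p \<in> {..n}" "q \<in> {..p}"
    then show "tri (nchain X q (act X p q (front_inc q) (act X n p (front_inc p) x)))
         (nchain X (p - q) (act X p (p - q) (last_inc q (p - q)) (act X n p (front_inc p) x))) (?L p)
       = tri (?F q) (?M q (p - q)) (?L p)"
      using front_last_identities(1)[OF X x, of p q] front_last_identities(3)[OF X x, of q "p - q"] by simp
  qed
  also have "\<dots> = (\<Sum>q\<le>n. \<Sum>r\<le>n - q. tri (?F q) (?M q r) (?L (q + r)))"
    by (subst triangle_sum) simp
  also have "\<dots> = (\<Sum>q\<le>n. bilin (\<lambda>x (y, z). (x, y, z)) (?F q)
      (AW_sum X (n - q) (act X n (n - q) (last_inc q (n - q)) x)))"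
    unfolding AW_sum_def bilin_sum tri_def
  proof (intro sum.cong refl)
    fix q r assume "q \<in> {..n}" "r \<in> {..n - q}"
    then show "bilin (\<lambda>x (y, z). (x, y, z)) (?F q) (tensor (?M q r) (?L (q + r))) =
       bilin (\<lambda>x (y, z). (x, y, z)) (?F q) (tensor (?M q r) (nchain X (n - q - r)
         (act X (n - q) (n - q - r) (last_inc r (n - q - r)) (act X n (n - q) (last_inc q (n - q)) x))))"
      using front_last_identities(2)[OF X x, of q r "n - q - r"] by simp
  qed
  also have "\<dots> = lin (\<lambda>(x, y). lin (\<lambda>(y1, y2). gen (x, y1, y2)) (cop (Q_Delta X) y)) (AW_sum X n x)"
  proof -
    have right: "lin (\<lambda>(x, y). lin (\<lambda>(y1, y2). gen (x, y1, y2)) (cop (Q_Delta X) y)) (tensor a c) =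
        bilin (\<lambda>x (y, z). (x, y, z)) a (lin (cop (Q_Delta X)) c)" for a c :: "nat \<times> 'a \<Rightarrow>\<^sub>0 'k"
      by (simp add: bilin_def lin_lin) (simp add: case_prod_unfold)
    show ?thesis
      unfolding AW_sum_def[of X n] lin_sum by (simp only: right lin_cop_nchain[OF X])
  qed
  finally show ?thesis .
qed

text \<open>In the boundary of the coproduct of an n-simplex the last face of each front face and the first
  face of the matching back face cancel in pairs.\<close>

lemma AW_sum_face_sum:
  assumes X: "simplicial_set X" and x: "x \<in> simplices X (Suc n)"
  shows "(\<Sum>i\<le>Suc n. smul ((-1) ^ i) (AW_sum X n (act X (Suc n) n (coface (Suc n) i) x))) =
    lin (\<lambda>(x, y). tensor (bd (Q_Delta X) x) (gen y) + smul ((-1) ^ fst x) (tensor (gen x) (bd (Q_Delta X) y)))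
      (AW_sum X (Suc n) x)"
proof -
  define F :: "nat \<Rightarrow> (nat \<times> 'a \<Rightarrow>\<^sub>0 'b)" where "F p = nchain X p (act X (Suc n) p (front_inc p) x)" for p
  define L :: "nat \<Rightarrow> (nat \<times> 'a \<Rightarrow>\<^sub>0 'b)"
    where "L p = nchain X (Suc n - p) (act X (Suc n) (Suc n - p) (last_inc p (Suc n - p)) x)" for p
  define dF :: "nat \<Rightarrow> nat \<Rightarrow> (nat \<times> 'a \<Rightarrow>\<^sub>0 'b)"
    where "dF p i = nchain X p (act X (Suc p) p (coface (Suc p) i) (act X (Suc n) (Suc p) (front_inc (Suc p)) x))" for p i
  define dL :: "nat \<Rightarrow> nat \<Rightarrow> (nat \<times> 'a \<Rightarrow>\<^sub>0 'b)"
    where "dL p j = nchain X (n - p) (act X (Suc (n - p)) (n - p) (coface (Suc (n - p)) j)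
       (act X (Suc n) (Suc (n - p)) (last_inc p (Suc (n - p))) x))" for p j
  have 1: "tensor (nchain X p (act X n p (front_inc p) (act X (Suc n) n (coface (Suc n) i) x)))
        (nchain X (n - p) (act X n (n - p) (last_inc p (n - p)) (act X (Suc n) n (coface (Suc n) i) x))) =
      (if i \<le> p then tensor (dF p i) (L (Suc p)) else tensor (F p) (dL p (i - p)))"
    if "p \<le> n" "i \<le> Suc n" for p i
  proof (cases "i \<le> p")
    case True
    have "act X n p (front_inc p) (act X (Suc n) n (coface (Suc n) i) x) =
        act X (Suc p) p (coface (Suc p) i) (act X (Suc n) (Suc p) (front_inc (Suc p)) x)"
      using that True by (intro act_act_eq[OF X x]) auto
    moreover have "act X n (n - p) (last_inc p (n - p)) (act X (Suc n) n (coface (Suc n) i) x) =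
        act X (Suc n) (Suc n - Suc p) (last_inc (Suc p) (Suc n - Suc p)) x"
      using that True by (simp, intro act_act_eq1[OF X x]) auto
    ultimately show ?thesis using True by (simp add: dF_def L_def)
  next
    case False
    have "act X n p (front_inc p) (act X (Suc n) n (coface (Suc n) i) x) = act X (Suc n) p (front_inc p) x"
      using that False by (intro act_act_eq1[OF X x]) auto
    moreover have "act X n (n - p) (last_inc p (n - p)) (act X (Suc n) n (coface (Suc n) i) x) =
        act X (Suc (n - p)) (n - p) (coface (Suc (n - p)) (i - p)) (act X (Suc n) (Suc (n - p)) (last_inc p (Suc (n - p))) x)"
      using that False by (intro act_act_eq[OF X x]) auto
    ultimately show ?thesis using False by (simp add: F_def dL_def)
  qed
  have lastF: "dF p (Suc p) = F p" if "p \<le> n" for p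
  proof -
    have "act X (Suc p) p (coface (Suc p) (Suc p)) (act X (Suc n) (Suc p) (front_inc (Suc p)) x) =
        act X (Suc n) p (front_inc p) x"
      using that by (intro act_act_eq1[OF X x]) auto
    then show ?thesis by (simp add: dF_def F_def)
  qed
  have firstL: "dL p 0 = L (Suc p)" if "p \<le> n" for p
  proof -
    have "act X (Suc (n - p)) (n - p) (coface (Suc (n - p)) 0) (act X (Suc n) (Suc (n - p)) (last_inc p (Suc (n - p))) x) =
        act X (Suc n) (n - p) (last_inc (Suc p) (n - p)) x"
      using that by (intro act_act_eq1[OF X x]) auto
    then show ?thesis by (simp add: dL_def L_def)
  qed
  let ?A = "\<Sum>p\<le>n. \<Sum>i\<le>p. smul ((-1) ^ i) (tensor (dF p i) (L (Suc p)))"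
  let ?B = "\<Sum>p\<le>n. \<Sum>j\<in>{1..Suc n - p}. smul ((-1) ^ (p + j)) (tensor (F p) (dL p j))"
  have "(\<Sum>i\<le>Suc n. smul ((-1) ^ i) (AW_sum X n (act X (Suc n) n (coface (Suc n) i) x))) =
      (\<Sum>i\<le>Suc n. \<Sum>p\<le>n. smul ((-1) ^ i)
        (if i \<le> p then tensor (dF p i) (L (Suc p)) else tensor (F p) (dL p (i - p))))"
    unfolding AW_sum_def smul_sum by (intro sum.cong refl) (simp add: 1)
  also have "\<dots> = (\<Sum>p\<le>n. \<Sum>i\<le>Suc n. smul ((-1) ^ i)
        (if i \<le> p then tensor (dF p i) (L (Suc p)) else tensor (F p) (dL p (i - p))))"
    by (rule sum.swap)
  also have "\<dots> = (\<Sum>p\<le>n. (\<Sum>i\<le>p. smul ((-1) ^ i) (tensor (dF p i) (L (Suc p)))) +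
       (\<Sum>j\<in>{1..Suc n - p}. smul ((-1) ^ (p + j)) (tensor (F p) (dL p j))))"
  proof (rule sum.cong[OF refl])
    fix p assume "p \<in> {..n}"
    then have p: "{..Suc n} = {..p} \<union> {Suc p..Suc n}" by auto
    have "(\<Sum>i\<le>Suc n. smul ((-1) ^ i) (if i \<le> p then tensor (dF p i) (L (Suc p)) else tensor (F p) (dL p (i - p)))) =
        (\<Sum>i\<le>p. smul ((-1) ^ i) (tensor (dF p i) (L (Suc p)))) +
        (\<Sum>i\<in>{Suc p..Suc n}. smul ((-1) ^ i) (tensor (F p) (dL p (i - p))))"
      unfolding p by (subst sum.union_disjoint) (auto intro!: arg_cong2[where f = "(+)"] sum.cong)
    also have "(\<Sum>i\<in>{Suc p..Suc n}. smul ((-1) ^ i) (tensor (F p) (dL p (i - p)))) =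
        (\<Sum>j\<in>{1..Suc n - p}. smul ((-1) ^ (p + j)) (tensor (F p) (dL p j)))"
      by (rule sum.reindex_bij_witness[of _ "\<lambda>j. p + j" "\<lambda>i. i - p"]) auto
    finally show "(\<Sum>i\<le>Suc n. smul ((-1) ^ i) (if i \<le> p then tensor (dF p i) (L (Suc p)) else tensor (F p) (dL p (i - p)))) =
        (\<Sum>i\<le>p. smul ((-1) ^ i) (tensor (dF p i) (L (Suc p)))) +
        (\<Sum>j\<in>{1..Suc n - p}. smul ((-1) ^ (p + j)) (tensor (F p) (dL p j)))" .
  qed
  also have "\<dots> = ?A + ?B" by (rule sum.distrib)
  finally have lhs: "(\<Sum>i\<le>Suc n. smul ((-1) ^ i) (AW_sum X n (act X (Suc n) n (coface (Suc n) i) x))) = ?A + ?B" .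
  let ?d = "lin (bd (Q_Delta X))"
  have tens: "lin (\<lambda>(x, y). tensor (bd (Q_Delta X) x) (gen y) + smul ((-1) ^ fst x) (tensor (gen x) (bd (Q_Delta X) y)))
        (tensor a c) = tensor (?d a) c + smul ((-1) ^ p) (tensor a (?d c))"
    if "\<And>u. u \<in> Poly_Mapping.keys a \<Longrightarrow> fst u = p" for a c p
  proof -
    have "lin (\<lambda>(x, y). tensor (bd (Q_Delta X) x) (gen y) + smul ((-1) ^ fst x) (tensor (gen x) (bd (Q_Delta X) y))) (tensor a c) =
      lin (\<lambda>x. tensor (bd (Q_Delta X) x) c + smul ((-1) ^ p) (tensor (gen x) (?d c))) a"
      unfolding lin_bilin using that
      by (intro lin_cong) (simp add: lin_fun_add lin_fun_smul bilin_lin_right[symmetric])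
    also have "\<dots> = tensor (?d a) c + smul ((-1) ^ p) (tensor a (?d c))"
      by (simp add: lin_fun_add lin_fun_smul bilin_lin_left[symmetric])
    finally show ?thesis .
  qed
  have keysF: "fst u = p" if "u \<in> Poly_Mapping.keys (F p)" for u p
    using that by (auto simp: F_def nchain_def split: if_splits)
  have dF: "?d (F (Suc p)) = (\<Sum>i\<le>Suc p. smul ((-1) ^ i) (dF p i))" for p
    by (simp only: F_def lin_bd_nchain(1)[OF X] face_sum_def dF_def)
  have dL: "?d (L p) = (\<Sum>j\<le>Suc (n - p). smul ((-1) ^ j) (dL p j))" if "p \<le> n" for p
    using that by (simp only: L_def Suc_diff_le lin_bd_nchain(1)[OF X] face_sum_def dL_def)
  have "lin (\<lambda>(x, y). tensor (bd (Q_Delta X) x) (gen y) + smul ((-1) ^ fst x) (tensor (gen x) (bd (Q_Delta X) y)))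
      (AW_sum X (Suc n) x) = (\<Sum>p\<le>Suc n. tensor (?d (F p)) (L p) + smul ((-1) ^ p) (tensor (F p) (?d (L p))))"
    unfolding AW_sum_def lin_sum F_def[symmetric] L_def[symmetric] by (simp only: tens[OF keysF])
  also have "\<dots> = (\<Sum>p\<le>Suc n. tensor (?d (F p)) (L p)) + (\<Sum>p\<le>Suc n. smul ((-1) ^ p) (tensor (F p) (?d (L p))))"
    by (rule sum.distrib)
  also have "(\<Sum>p\<le>Suc n. tensor (?d (F p)) (L p)) = (\<Sum>p\<le>n. tensor (?d (F (Suc p))) (L (Suc p)))"
    by (simp add: sum.atMost_Suc_shift F_def lin_bd_nchain(2)[OF X] del: sum.atMost_Suc)
  also have "\<dots> = ?A + (\<Sum>p\<le>n. smul ((-1) ^ Suc p) (tensor (F p) (L (Suc p))))"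
    by (simp add: dF bilin_diff bilin_sum lastF sum_subtractf sum_negf)
  also have "(\<Sum>p\<le>Suc n. smul ((-1) ^ p) (tensor (F p) (?d (L p)))) = (\<Sum>p\<le>n. smul ((-1) ^ p) (tensor (F p) (?d (L p))))"
    by (simp add: L_def lin_bd_nchain(2)[OF X])
  also have "\<dots> = (\<Sum>p\<le>n. smul ((-1) ^ p) (tensor (F p) (L (Suc p))) +
      (\<Sum>j\<in>{1..Suc n - p}. smul ((-1) ^ (p + j)) (tensor (F p) (dL p j))))"
  proof (rule sum.cong[OF refl])
    fix p assume "p \<in> {..n}"
    then have p: "p \<le> n" by simp
    have "{..Suc (n - p)} = insert 0 {1..Suc n - p}" using p by auto
    then show "smul ((-1) ^ p) (tensor (F p) (?d (L p))) = smul ((-1) ^ p) (tensor (F p) (L (Suc p))) +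
      (\<Sum>j\<in>{1..Suc n - p}. smul ((-1) ^ (p + j)) (tensor (F p) (dL p j)))"
      by (simp add: dL[OF p] bilin_add bilin_sum smul_distribs smul_sum power_add firstL[OF p] del: sum.atMost_Suc)
  qed
  finally show ?thesis
    unfolding lhs by (simp add: sum.distrib sum_negf)
qed

lemma reduced_ssetD:
  assumes "reduced_sset X"
  shows "simplicial_set X" "simplices X 0 = {the_elem (simplices X 0)}"
  using assms unfolding reduced_sset_def by (simp, metis the_elem_eq)

lemma nondegenerate_0 [simp]: "\<not> degenerate X 0 x"
  by (simp add: degenerate_def)

lemma nchain_0 [simp]: "nchain X 0 x = gen (0, x)"
  by (simp add: nchain_def)

lemma face_sum_0:
  assumes X: "reduced_sset X" and x: "x \<in> simplices X (Suc 0)"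
  shows "face_sum X 0 x = 0"
proof -
  have "act X (Suc 0) 0 (coface (Suc 0) i) x = the_elem (simplices X 0)" if "i \<le> Suc 0" for i
    using simplicial_setD(1)[OF reduced_ssetD(1)[OF X] x coface_Delta[OF that]] reduced_ssetD(2)[OF X] by blast
  then show ?thesis by (simp add: face_sum_def)
qed

lemma AW_sum_counit:
  assumes X: "simplicial_set X" and x: "x \<in> simplices X n"
  shows "lin (\<lambda>(x, y). smul (counit (Q_Delta X) x) (gen y)) (AW_sum X n x) = (nchain X n x :: _ \<Rightarrow>\<^sub>0 'k::comm_ring_1)"
    "lin (\<lambda>(x, y). smul (counit (Q_Delta X) y) (gen x)) (AW_sum X n x) = (nchain X n x :: _ \<Rightarrow>\<^sub>0 'k::comm_ring_1)"
proof -
  let ?F = "\<lambda>p. (nchain X p (act X n p (front_inc p) x) :: _ \<Rightarrow>\<^sub>0 'k)"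
  let ?L = "\<lambda>p. (nchain X (n - p) (act X n (n - p) (last_inc p (n - p)) x) :: _ \<Rightarrow>\<^sub>0 'k)"
  have id: "act X n n (last_inc 0 n) x = x" "act X n n (front_inc n) x = x"
    using simplicial_setD(2)[OF X x] by (simp_all add: last_inc_def front_inc_def)
  have l: "lin (\<lambda>(x, y). smul (counit (Q_Delta X) x) (gen y)) (tensor (?F p) c) = (if p = 0 then c else 0)"
    for p and c :: "nat \<times> 'a \<Rightarrow>\<^sub>0 'k"
    by (simp add: lin_bilin nchain_def)
  have "lin (\<lambda>(x, y). smul (counit (Q_Delta X) x) (gen y)) (AW_sum X n x) = (\<Sum>p\<le>n. if p = 0 then ?L p :: _ \<Rightarrow>\<^sub>0 'k else 0)"
    unfolding AW_sum_def lin_sum by (simp only: l)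
  then show "lin (\<lambda>(x, y). smul (counit (Q_Delta X) x) (gen y)) (AW_sum X n x) = (nchain X n x :: _ \<Rightarrow>\<^sub>0 'k)"
    by (simp add: id)
  have r: "lin (\<lambda>(x, y). smul (counit (Q_Delta X) y) (gen x)) (tensor c (?L p)) = (if p = n then c else 0)"
    if "p \<le> n" for p and c :: "nat \<times> 'a \<Rightarrow>\<^sub>0 'k"
    using that by (simp add: lin_bilin nchain_def)
  have "lin (\<lambda>(x, y). smul (counit (Q_Delta X) y) (gen x)) (AW_sum X n x) = (\<Sum>p\<le>n. if p = n then ?F p :: _ \<Rightarrow>\<^sub>0 'k else 0)"
    unfolding AW_sum_def lin_sum by (intro sum.cong refl r) auto
  then show "lin (\<lambda>(x, y). smul (counit (Q_Delta X) y) (gen x)) (AW_sum X n x) = (nchain X n x :: _ \<Rightarrow>\<^sub>0 'k)"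
    by (simp add: id)
qed

lemma keys_nchain_subset:
  assumes "x \<in> simplices X n"
  shows "Poly_Mapping.keys (nchain X n x) \<subseteq> {(m, y). m = n \<and> y \<in> simplices X m \<and> \<not> degenerate X m y}"
  using assms by (auto simp: nchain_def)

lemma keys_face_sum:
  assumes X: "simplicial_set X" and x: "x \<in> simplices X (Suc n)"
  shows "Poly_Mapping.keys (face_sum X n x) \<subseteq> {(m, y). m = n \<and> y \<in> simplices X m \<and> \<not> degenerate X m y}"
  unfolding face_sum_def
  using simplicial_setD(1)[OF X x] by (intro keys_sum_subset order_trans[OF keys_smul keys_nchain_subset]) auto

lemma keys_AW_sum:
  assumes X: "simplicial_set X" and x: "x \<in> simplices X n"
  shows "Poly_Mapping.keys (AW_sum X n x :: _ \<Rightarrow>\<^sub>0 'k::comm_ring_1) \<subseteq>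
    {(u, v). u \<in> basis (Q_Delta X :: (_, 'k) dgc) \<and> v \<in> basis (Q_Delta X :: (_, 'k) dgc) \<and> fst u + fst v = n}"
  unfolding AW_sum_def
proof (intro keys_sum_subset keys_bilin_subset)
  fix p u v
  assume p: "p \<in> {..n}"
    and u: "u \<in> Poly_Mapping.keys (nchain X p (act X n p (front_inc p) x) :: _ \<Rightarrow>\<^sub>0 'k)"
    and v: "v \<in> Poly_Mapping.keys (nchain X (n - p) (act X n (n - p) (last_inc p (n - p)) x) :: _ \<Rightarrow>\<^sub>0 'k)"
  have "act X n p (front_inc p) x \<in> simplices X p" "act X n (n - p) (last_inc p (n - p)) x \<in> simplices X (n - p)"
    using p by (auto intro!: simplicial_setD(1)[OF X x])
  from keys_nchain_subset[OF this(1)] keys_nchain_subset[OF this(2)] u v p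
  show "(u, v) \<in> {(u, v). u \<in> basis (Q_Delta X :: (_, 'k) dgc) \<and> v \<in> basis (Q_Delta X :: (_, 'k) dgc) \<and> fst u + fst v = n}"
    by fastforce
qed

theorem connected_dg_coalgebra_Q_Delta:
  assumes X: "reduced_sset X"
  shows "connected_dg_coalgebra (Q_Delta X :: (nat \<times> 'a, 'k::comm_ring_1) dgc)"
proof -
  note X' = reduced_ssetD(1)[OF X]
  let ?Q = "Q_Delta X :: (nat \<times> 'a, 'k) dgc"
  have basis: "\<exists>n x. b = (n, x) \<and> x \<in> simplices X n \<and> \<not> degenerate X n x" if "b \<in> basis ?Q" for b
    using that by auto
  have all: "\<forall>b\<in>basis ?Q. Poly_Mapping.keys (bd ?Q b) \<subseteq> {a \<in> basis ?Q. bdeg ?Q a + 1 = bdeg ?Q b} \<and>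
      lin (bd ?Q) (bd ?Q b) = 0 \<and>
      Poly_Mapping.keys (cop ?Q b) \<subseteq> {(x, y). x \<in> basis ?Q \<and> y \<in> basis ?Q \<and> bdeg ?Q x + bdeg ?Q y = bdeg ?Q b} \<and>
      lin (cop ?Q) (bd ?Q b) =
        lin (\<lambda>(x, y). tensor (bd ?Q x) (gen y) + smul ((-1) ^ bdeg ?Q x) (tensor (gen x) (bd ?Q y))) (cop ?Q b) \<and>
      lin (\<lambda>(x, y). lin (\<lambda>(x1, x2). gen (x1, x2, y)) (cop ?Q x)) (cop ?Q b) =
        lin (\<lambda>(x, y). lin (\<lambda>(y1, y2). gen (x, y1, y2)) (cop ?Q y)) (cop ?Q b) \<and>
      (0 < bdeg ?Q b \<longrightarrow> counit ?Q b = 0) \<and>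
      lin_form (counit ?Q) (bd ?Q b) = 0 \<and>
      lin (\<lambda>(x, y). smul (counit ?Q x) (gen y)) (cop ?Q b) = gen b \<and>
      lin (\<lambda>(x, y). smul (counit ?Q y) (gen x)) (cop ?Q b) = gen b" (is "\<forall>b\<in>_. ?P b")
  proof
    fix b assume b: "b \<in> basis ?Q"
    obtain n x where nx: "b = (n, x)" "x \<in> simplices X n" "\<not> degenerate X n x"
      using basis[OF b] by blast
    have 1: "Poly_Mapping.keys (bd ?Q b) \<subseteq> {a \<in> basis ?Q. bdeg ?Q a + 1 = bdeg ?Q b}"
      using keys_face_sum[OF X', of x "n - 1"] nx by (cases n) (auto simp: bd_Q_Delta)
    have 2: "lin (bd ?Q) (bd ?Q b) = 0"
      using face_sum_face_sum[OF X', of x "n - 1"] nx by (cases n) (auto simp: bd_Q_Delta)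
    have 3: "Poly_Mapping.keys (cop ?Q b) \<subseteq> {(x, y). x \<in> basis ?Q \<and> y \<in> basis ?Q \<and> bdeg ?Q x + bdeg ?Q y = bdeg ?Q b}"
      using keys_AW_sum[OF X' nx(2), where 'k = 'k] nx(1) by (simp add: cop_Q_Delta)
    have 4: "lin (cop ?Q) (bd ?Q b) =
        lin (\<lambda>(x, y). tensor (bd ?Q x) (gen y) + smul ((-1) ^ bdeg ?Q x) (tensor (gen x) (bd ?Q y))) (cop ?Q b)"
    proof (cases n)
      case 0
      then show ?thesis
        using nx by (simp add: bd_Q_Delta cop_Q_Delta AW_sum_def)
    next
      case (Suc m)
      then have "lin (cop ?Q) (bd ?Q b) = (\<Sum>i\<le>Suc m. smul ((-1) ^ i) (AW_sum X m (act X (Suc m) m (coface (Suc m) i) x)))"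
        unfolding nx Suc bd_Q_Delta face_sum_def lin_sum by (simp only: lin_smul lin_cop_nchain[OF X'])
      with AW_sum_face_sum[OF X', of x m] nx Suc show ?thesis
        by (simp add: cop_Q_Delta)
    qed
    have 5: "lin_form (counit ?Q) (bd ?Q b) = 0"
    proof (cases n)
      case (Suc m)
      show ?thesis
      proof (cases m)
        case 0
        then show ?thesis using nx Suc by (simp add: bd_Q_Delta face_sum_0[OF X])
      next
        case (Suc l)
        have "lin_form (counit ?Q) (bd ?Q b) = (\<Sum>a\<in>Poly_Mapping.keys (bd ?Q b). 0)"
          unfolding lin_form_def
        proof (rule sum.cong[OF refl])
          fix a assume "a \<in> Poly_Mapping.keys (bd ?Q b)"
          then have "fst a + 1 = n" using 1 nx by auto
          then show "poly_mapping.lookup (bd ?Q b) a * counit ?Q a = 0"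
            using \<open>n = Suc m\<close> Suc by (cases a) simp
        qed
        then show ?thesis by simp
      qed
    qed (simp add: nx bd_Q_Delta)
    have 6: "nchain X n x = gen b" using nx by (simp add: nchain_def)
    show "?P b"
      using 1 2 3 4 5 AW_sum_coassoc[OF X' nx(2), where 'k = 'k] AW_sum_counit[OF X' nx(2), where 'k = 'k] 6 nx
      by (intro conjI) (simp_all add: cop_Q_Delta)
  qed
  have unit: "{b \<in> basis ?Q. bdeg ?Q b = 0} = {unit_elt ?Q}"
  proof -
    obtain e where "simplices X 0 = {e}" using X unfolding reduced_sset_def by blast
    then have "{b \<in> basis ?Q. bdeg ?Q b = 0} = {(0, e)}" "the_elem (simplices X 0) = e"
      unfolding Q_Delta_simps by (force, simp)
    then show ?thesis by (simp only: Q_Delta_simps)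
  qed
  have "counit ?Q (unit_elt ?Q) = 1" by simp
  with all unit show ?thesis
    unfolding connected_dg_coalgebra_def ball_conj_distrib
    by - (elim conjE, (intro conjI, assumption+)[1])
qed

lemma lin_Q_Delta_map_nchain:
  assumes "sset_map X Y f"
  shows "lin (Q_Delta_map Y f) (nchain X n x) = nchain Y n (f n x)"
  using degenerate_sset_map[OF assms, of n x] by (simp add: nchain_def Q_Delta_map_def)

theorem dg_coalgebra_map_Q_Delta_map:
  assumes X: "simplicial_set X" and Y: "simplicial_set Y" and f: "sset_map X Y f"
  shows "dg_coalgebra_map (Q_Delta X :: (nat \<times> 'a, 'k::comm_ring_1) dgc) (Q_Delta Y) (Q_Delta_map Y f)"
proof -
  let ?Q = "Q_Delta X :: (nat \<times> 'a, 'k) dgc" and ?Q' = "Q_Delta Y :: (nat \<times> 'b, 'k) dgc"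
  let ?\<phi> = "Q_Delta_map Y f :: _ \<Rightarrow> _ \<Rightarrow>\<^sub>0 'k"
  have "Poly_Mapping.keys (?\<phi> b) \<subseteq> {c \<in> basis ?Q'. bdeg ?Q' c = bdeg ?Q b} \<and>
      lin ?\<phi> (bd ?Q b) = lin (bd ?Q') (?\<phi> b) \<and>
      lin (\<lambda>(x, y). tensor (?\<phi> x) (?\<phi> y)) (cop ?Q b) = lin (cop ?Q') (?\<phi> b) \<and>
      lin_form (counit ?Q') (?\<phi> b) = counit ?Q b" if "b \<in> basis ?Q" for b
  proof -
    from that obtain n x where nx: "b = (n, x)" "x \<in> simplices X n"
      by (cases b) auto
    have \<phi>b: "?\<phi> b = nchain Y n (f n x)" by (simp add: nx Q_Delta_map_def)
    have 1: "lin ?\<phi> (bd ?Q b) = lin (bd ?Q') (?\<phi> b)"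
    proof (cases n)
      case (Suc m)
      have "lin ?\<phi> (face_sum X m x) = face_sum Y m (f n x)"
        unfolding face_sum_def lin_sum lin_smul lin_Q_Delta_map_nchain[OF f]
        using sset_mapD(2)[OF f nx(2)] Suc by (intro sum.cong refl) simp
      then show ?thesis
        unfolding \<phi>b unfolding nx Suc by (simp add: bd_Q_Delta lin_bd_nchain[OF Y])
    qed (simp only: \<phi>b, simp add: nx bd_Q_Delta)
    have tens: "lin (\<lambda>(x, y). tensor (?\<phi> x) (?\<phi> y)) (tensor a c) = tensor (lin ?\<phi> a) (lin ?\<phi> c)" for a c
      by (simp add: lin_bilin bilin_lin_left bilin_lin_right[symmetric])
    have "lin (\<lambda>(x, y). tensor (?\<phi> x) (?\<phi> y)) (AW_sum X n x) = AW_sum Y n (f n x)"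
      unfolding AW_sum_def lin_sum
      using sset_mapD(2)[OF f nx(2)] by (intro sum.cong refl) (simp add: tens lin_Q_Delta_map_nchain[OF f])
    then have 2: "lin (\<lambda>(x, y). tensor (?\<phi> x) (?\<phi> y)) (cop ?Q b) = lin (cop ?Q') (?\<phi> b)"
      unfolding \<phi>b unfolding nx by (simp add: cop_Q_Delta lin_cop_nchain[OF Y])
    have 3: "lin_form (counit ?Q') (?\<phi> b) = counit ?Q b"
      unfolding \<phi>b unfolding nx by (simp add: nchain_def lin_form_def)
    have 4: "Poly_Mapping.keys (?\<phi> b) \<subseteq> {c \<in> basis ?Q'. bdeg ?Q' c = bdeg ?Q b}"
      unfolding \<phi>b unfolding nx using keys_nchain_subset[OF sset_mapD(1)[OF f nx(2)]] by fastforce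
    show ?thesis using 1 2 3 4 by blast
  qed
  then show ?thesis
    unfolding dg_coalgebra_map_def by blast
qed

section \<open>Simplicial homotopies\<close>

text \<open>The product with the standard 1-simplex, whose n-simplices are the operators from [n] to [1].\<close>

definition prism :: "'a sset \<Rightarrow> ('a \<times> (nat \<Rightarrow> nat)) sset" where
  "prism X = \<lparr>simplices = (\<lambda>n. simplices X n \<times> Delta n 1),
     act = (\<lambda>n m \<theta> (x, \<alpha>). (act X n m \<theta> x, compose {..m} \<alpha> \<theta>))\<rparr>"

definition step_map :: "nat \<Rightarrow> nat \<Rightarrow> nat \<Rightarrow> nat" where
  "step_map n i = (\<lambda>j\<in>{..n}. if j \<le> i then 0 else 1)"

abbreviation const_map :: "nat \<Rightarrow> nat \<Rightarrow> nat \<Rightarrow> nat" where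
  "const_map n c \<equiv> (\<lambda>j\<in>{..n}. c)"

text \<open>The last condition makes the homotopy constant on vertices, so that its prism operator vanishes on the
  unit of the coalgebra of chains.\<close>

definition simplicial_homotopy :: "'a sset \<Rightarrow> 'b sset \<Rightarrow> (nat \<Rightarrow> 'a \<Rightarrow> 'b) \<Rightarrow> (nat \<Rightarrow> 'a \<Rightarrow> 'b) \<Rightarrow>
    (nat \<Rightarrow> 'a \<times> (nat \<Rightarrow> nat) \<Rightarrow> 'b) \<Rightarrow> bool" where
  "simplicial_homotopy X Y u v H \<longleftrightarrow> sset_map (prism X) Y H \<and>
     (\<forall>n. \<forall>x\<in>simplices X n. H n (x, const_map n 0) = u n x \<and> H n (x, const_map n 1) = v n x) \<and>
     (\<forall>x\<in>simplices X 0. degenerate Y 1 (H 1 (act X 0 1 (codegen 0 0) x, step_map 1 0)))"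

text \<open>The prism over an n-simplex is triangulated by n + 1 simplices, of which the i-th climbs from the bottom to
  the top over the vertex i.\<close>

definition prism_sum :: "'a sset \<Rightarrow> 'b sset \<Rightarrow> (nat \<Rightarrow> 'a \<times> (nat \<Rightarrow> nat) \<Rightarrow> 'b) \<Rightarrow> nat \<times> 'a \<Rightarrow> (nat \<times> 'b \<Rightarrow>\<^sub>0 'k::comm_ring_1)" where
  "prism_sum X Y H = (\<lambda>(n, x). \<Sum>i\<le>n. smul ((-1) ^ i)
     (nchain Y (Suc n) (H (Suc n) (act X n (Suc n) (codegen n i) x, step_map (Suc n) i))))"

lemma step_map_Delta [simp]: "step_map n i \<in> Delta n (Suc 0)" "step_map n i \<in> Delta n 1"
  by (rule DeltaI; auto simp: step_map_def)+

lemma const_map_Delta [simp]: "c \<le> 1 \<Longrightarrow> const_map n c \<in> Delta n (Suc 0)" "c \<le> 1 \<Longrightarrow> const_map n c \<in> Delta n 1"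
  by (rule DeltaI; auto)+

lemma step_map_apply [simp]: "j \<le> n \<Longrightarrow> step_map n i j = (if j \<le> i then 0 else 1)"
  by (simp add: step_map_def)

lemma prism_simps [simp]: "simplices (prism X) n = simplices X n \<times> Delta n 1"
  "act (prism X) n m \<theta> (x, \<alpha>) = (act X n m \<theta> x, compose {..m} \<alpha> \<theta>)"
  by (simp_all add: prism_def)

lemma simplicial_set_prism: "simplicial_set X \<Longrightarrow> simplicial_set (prism X)"
  unfolding simplicial_set_def[of "prism X"]
  apply (intro conjI allI ballI; clarsimp simp: simplicial_setD Delta_compose)
  subgoal by (intro Delta_eqI) (auto intro!: Delta_compose)
  subgoal by (intro Delta_eqI) (auto intro!: Delta_compose simp: DeltaD)
  done

lemma prism_map_act:
  assumes X: "simplicial_set X" "x \<in> simplices X n" and H: "sset_map (prism X) Y H"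
    and ops: "\<theta> \<in> Delta m n" "\<alpha> \<in> Delta m 1" "\<eta> \<in> Delta l m" "\<zeta> \<in> Delta l n" "\<beta> \<in> Delta l 1"
    and eq: "\<And>i. i \<le> l \<Longrightarrow> \<theta> (\<eta> i) = \<zeta> i" "\<And>i. i \<le> l \<Longrightarrow> \<alpha> (\<eta> i) = \<beta> i"
  shows "act Y m l \<eta> (H m (act X n m \<theta> x, \<alpha>)) = H l (act X n l \<zeta> x, \<beta>)"
proof -
  have "compose {..l} \<alpha> \<eta> = \<beta>"
    using ops eq by (intro Delta_eqI[OF Delta_compose]) auto
  moreover have "act X m l \<eta> (act X n m \<theta> x) = act X n l \<zeta> x"
    using ops eq by (intro act_act_eq1[OF X])
  ultimately show ?thesis
    using sset_mapD(2)[OF H, of "(act X n m \<theta> x, \<alpha>)" m \<eta> l] ops simplicial_setD(1)[OF X] by simp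
qed

lemma degenerate_prism_map:
  assumes X: "simplicial_set X" "x \<in> simplices X n" and Y: "simplicial_set Y" and H: "sset_map (prism X) Y H"
    and ops: "\<theta> \<in> Delta m n" "\<alpha> \<in> Delta m 1" and a: "a < m" "\<theta> a = \<theta> (Suc a)" "\<alpha> a = \<alpha> (Suc a)"
  shows "degenerate Y m (H m (act X n m \<theta> x, \<alpha>))"
proof -
  obtain k where k: "m = Suc k" using a by (cases m) auto
  \<comment> \<open>The idempotent operator that identifies the two equal vertices fixes the simplex of the prism.\<close>
  define \<epsilon> where "\<epsilon> = compose {..m} (coface m (Suc a)) (codegen k a)"
  have \<epsilon>: "\<epsilon> \<in> Delta m m"
    unfolding \<epsilon>_def using a k by (intro Delta_compose[of _ k]) auto
  have \<epsilon>_apply: "\<epsilon> i = (if i = Suc a then a else i)" if "i \<le> m" for i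
    using that a k unfolding \<epsilon>_def by auto
  have "act Y m m \<epsilon> (H m (act X n m \<theta> x, \<alpha>)) = H m (act X n m \<theta> x, \<alpha>)"
    using a ops \<epsilon> by (intro prism_map_act[OF X H]) (auto simp: \<epsilon>_apply)
  moreover have "H m (act X n m \<theta> x, \<alpha>) \<in> simplices Y m"
    using sset_mapD(1)[OF H] ops simplicial_setD(1)[OF X] by simp
  ultimately show ?thesis
    using degenerate_if_repeats[OF Y _ \<epsilon> a(1)] a \<epsilon>_apply by (metis Suc_leI less_imp_le_nat n_not_Suc_n)
qed

lemma prism_sum_degenerate:
  assumes X: "simplicial_set X" and Y: "simplicial_set Y" and H: "sset_map (prism X) Y H"
    and deg: "degenerate X n x"
  shows "prism_sum X Y H (n, x) = 0"
proof -
  obtain m j y where j: "n = Suc m" "j \<le> m" "y \<in> simplices X m" "x = act X m n (codegen m j) y"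
    using deg unfolding degenerate_def by blast
  have "degenerate Y (Suc n) (H (Suc n) (act X n (Suc n) (codegen n i) x, step_map (Suc n) i))" if "i \<le> n" for i
  proof -
    have "act X n (Suc n) (codegen n i) x = act X m (Suc n) (compose {..Suc n} (codegen m j) (codegen n i)) y"
      using simplicial_setD(3)[OF X j(3)] j that by simp
    moreover have "compose {..Suc n} (codegen m j) (codegen n i) \<in> Delta (Suc n) m"
      using j that by (intro Delta_compose[of _ n]) auto
    ultimately show ?thesis
      using that j degenerate_prism_map[OF X j(3) Y H, of _ "Suc n" "step_map (Suc n) i" "if j < i then j else Suc j"]
      by auto
  qed
  then show ?thesis
    unfolding prism_sum_def by (auto intro!: sum.neutral)
qed

lemma lin_prism_sum_nchain:
  assumes X: "simplicial_set X" and Y: "simplicial_set Y" and H: "sset_map (prism X) Y H"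
  shows "lin (prism_sum X Y H) (nchain X n x) = prism_sum X Y H (n, x)"
  by (simp add: nchain_def prism_sum_degenerate[OF X Y H])

text \<open>\<open>F i j\<close> stands for the j-th face of the i-th simplex of a prism and \<open>G\<close> for the simplices
  of the prism over the boundary. The faces over the boundary cancel against \<open>G\<close>, the walls between
  consecutive simplices cancel in pairs, and the two ends of the prism remain.\<close>

lemma alternating_prism_sum:
  fixes F G :: "nat \<Rightarrow> nat \<Rightarrow> ('b \<Rightarrow>\<^sub>0 'k::comm_ring_1)"
  assumes 1: "\<And>i j. i \<le> n \<Longrightarrow> j < i \<Longrightarrow> F i j = G (i - 1) j"
    and 2: "\<And>i j. Suc i < j \<Longrightarrow> j \<le> Suc n \<Longrightarrow> F i j = G i (j - 1)"
    and 3: "\<And>i. i < n \<Longrightarrow> F (Suc i) (Suc i) = F i (Suc i)"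
  shows "(\<Sum>i\<le>n. \<Sum>j\<le>Suc n. smul ((-1) ^ (i + j)) (F i j)) + (\<Sum>i<n. \<Sum>j\<le>n. smul ((-1) ^ (i + j)) (G i j)) =
    F 0 0 - F n (Suc n)"
proof -
  let ?f = "\<lambda>i j. smul ((-1) ^ (i + j)) (F i j)" and ?g = "\<lambda>i j. smul ((-1) ^ (i + j)) (G i j)"
  have split_row: "(\<Sum>j\<le>Suc n. ?f i j) = (\<Sum>j<i. ?f i j) + (\<Sum>j\<in>{Suc (Suc i)..Suc n}. ?f i j) + (F i i - F i (Suc i))"
    if "i \<le> n" for i
  proof -
    have "{..Suc n} = {..<i} \<union> ({Suc (Suc i)..Suc n} \<union> {i, Suc i})" using that by auto
    moreover have "sum (?f i) ({..<i} \<union> ({Suc (Suc i)..Suc n} \<union> {i, Suc i})) =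
        (\<Sum>j<i. ?f i j) + ((\<Sum>j\<in>{Suc (Suc i)..Suc n}. ?f i j) + (\<Sum>j\<in>{i, Suc i}. ?f i j))"
      by (subst sum.union_disjoint; (force | subst sum.union_disjoint)?)+
    ultimately show ?thesis by (simp add: add.assoc del: sum.atMost_Suc)
  qed
  have a: "(\<Sum>i\<le>n. \<Sum>j<i. ?f i j) = - (\<Sum>i<n. \<Sum>j\<le>i. ?g i j)"
  proof -
    have "(\<Sum>i\<le>n. \<Sum>j<i. ?f i j) = (\<Sum>i<n. \<Sum>j<Suc i. ?f (Suc i) j)"
      using sum.atMost_shift[of "\<lambda>i. \<Sum>j<i. ?f i j" n] by simp
    also have "\<dots> = (\<Sum>i<n. \<Sum>j\<le>i. - ?g i j)"
      by (intro sum.cong) (auto simp: 1 lessThan_Suc_atMost)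
    finally show ?thesis by (simp add: sum_negf)
  qed
  have b: "(\<Sum>i\<le>n. \<Sum>j\<in>{Suc (Suc i)..Suc n}. ?f i j) = - (\<Sum>i<n. \<Sum>j\<in>{Suc i..n}. ?g i j)"
  proof -
    have "(\<Sum>i\<le>n. \<Sum>j\<in>{Suc (Suc i)..Suc n}. ?f i j) = (\<Sum>i<n. \<Sum>j\<in>{Suc (Suc i)..Suc n}. ?f i j)"
      by (simp add: lessThan_Suc_atMost[symmetric])
    also have "\<dots> = (\<Sum>i<n. \<Sum>j\<in>{Suc i..n}. - ?g i j)"
      unfolding sum.shift_bounds_cl_Suc_ivl by (intro sum.cong refl) (simp add: 2)
    finally show ?thesis by (simp add: sum_negf)
  qed
  have c: "(\<Sum>i\<le>n. F i i - F i (Suc i)) = F 0 0 - F n (Suc n)"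
  proof -
    have "(\<Sum>i\<le>n. F i i) = F 0 0 + (\<Sum>i<n. F (Suc i) (Suc i))"
      by (rule sum.atMost_shift)
    also have "(\<Sum>i<n. F (Suc i) (Suc i)) = (\<Sum>i<n. F i (Suc i))"
      using 3 by (intro sum.cong) auto
    finally show ?thesis
      by (simp add: sum_subtractf lessThan_Suc_atMost[symmetric])
  qed
  have d: "(\<Sum>j\<le>n. ?g i j) = (\<Sum>j\<le>i. ?g i j) + (\<Sum>j\<in>{Suc i..n}. ?g i j)" if "i < n" for i
  proof -
    have "{..n} = {..i} \<union> {Suc i..n}" using that by auto
    then show ?thesis by (simp only:) (rule sum.union_disjoint; auto)
  qed
  have "(\<Sum>i\<le>n. \<Sum>j\<le>Suc n. ?f i j) = (\<Sum>i\<le>n. (\<Sum>j<i. ?f i j) + (\<Sum>j\<in>{Suc (Suc i)..Suc n}. ?f i j) + (F i i - F i (Suc i)))"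
    by (intro sum.cong refl split_row) auto
  also have "\<dots> = - (\<Sum>i<n. \<Sum>j\<le>i. ?g i j) - (\<Sum>i<n. \<Sum>j\<in>{Suc i..n}. ?g i j) + (F 0 0 - F n (Suc n))"
    unfolding sum.distrib a b c by simp
  finally have "(\<Sum>i\<le>n. \<Sum>j\<le>Suc n. ?f i j) = - (\<Sum>i<n. \<Sum>j\<le>i. ?g i j) - (\<Sum>i<n. \<Sum>j\<in>{Suc i..n}. ?g i j) + (F 0 0 - F n (Suc n))" .
  moreover have "(\<Sum>i<n. \<Sum>j\<le>n. ?g i j) = (\<Sum>i<n. \<Sum>j\<le>i. ?g i j) + (\<Sum>i<n. \<Sum>j\<in>{Suc i..n}. ?g i j)"
    by (simp add: d flip: sum.distrib)
  ultimately show ?thesis by simp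
qed

text \<open>After writing all terms as values of the homotopy on simplices of the prism over the given simplex, the
  conditions on the summands are identities between operators.\<close>

lemma prism_sum_boundary:
  assumes X: "simplicial_set X" and Y: "simplicial_set Y" and H: "simplicial_homotopy X Y u v H"
    and x: "x \<in> simplices X n"
  shows "lin (bd (Q_Delta Y)) (prism_sum X Y H (n, x)) + lin (prism_sum X Y H) (bd (Q_Delta X) (n, x)) =
    (nchain Y n (v n x) - nchain Y n (u n x) :: _ \<Rightarrow>\<^sub>0 'k::comm_ring_1)"
proof -
  have H': "sset_map (prism X) Y H" using H by (simp add: simplicial_homotopy_def)
  define k :: "nat \<Rightarrow> nat \<Rightarrow> (nat \<times> 'b \<Rightarrow>\<^sub>0 'k)" where "k i j = nchain Y n (act Y (Suc n) n (coface (Suc n) j)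
      (H (Suc n) (act X n (Suc n) (codegen n i) x, step_map (Suc n) i)))" for i j
  define l :: "nat \<Rightarrow> nat \<Rightarrow> (nat \<times> 'b \<Rightarrow>\<^sub>0 'k)" where "l i j = nchain Y n (H n (act X (n - 1) n (codegen (n - 1) i) (act X n (n - 1) (coface n j) x), step_map n i))" for i j
  have bd: "lin (bd (Q_Delta Y)) (prism_sum X Y H (n, x)) = (\<Sum>i\<le>n. \<Sum>j\<le>Suc n. smul ((-1) ^ (i + j)) (k i j))"
    unfolding prism_sum_def
    by (simp add: lin_bd_nchain[OF Y] face_sum_def smul_sum power_add k_def del: sum.atMost_Suc)
  have db: "lin (prism_sum X Y H) (bd (Q_Delta X) (n, x)) = (\<Sum>i<n. \<Sum>j\<le>n. smul ((-1) ^ (i + j)) (l i j))"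
  proof (cases n)
    case (Suc m)
    have "lin (prism_sum X Y H) (bd (Q_Delta X) (n, x)) = (\<Sum>j\<le>n. \<Sum>i\<le>m. smul ((-1) ^ (i + j)) (l i j))"
      unfolding Suc bd_Q_Delta face_sum_def lin_sum lin_smul lin_prism_sum_nchain[OF X Y H']
      by (simp add: prism_sum_def smul_sum power_add l_def Suc mult.commute del: sum.atMost_Suc)
    also have "\<dots> = (\<Sum>i\<le>m. \<Sum>j\<le>n. smul ((-1) ^ (i + j)) (l i j))" by (rule sum.swap)
    finally show ?thesis by (simp add: Suc lessThan_Suc_atMost del: sum.atMost_Suc)
  qed (simp add: bd_Q_Delta)
  have k: "k i j = nchain Y n (H n (act X n n (compose {..n} (codegen n i) (coface (Suc n) j)) x,
      compose {..n} (step_map (Suc n) i) (coface (Suc n) j)))" if "i \<le> n" "j \<le> Suc n" for i j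
    unfolding k_def using that by (subst prism_map_act[OF X x H', of _ _ _ _ _ "compose {..n} (codegen n i) (coface (Suc n) j)"
      "compose {..n} (step_map (Suc n) i) (coface (Suc n) j)"]) (auto intro!: Delta_compose[of _ "Suc n"])
  have l: "l i j = nchain Y n (H n (act X n n (compose {..n} (coface n j) (codegen (n - 1) i)) x, step_map n i))"
    if "i < n" "j \<le> n" for i j
    unfolding l_def using that x by (cases n) (auto simp: simplicial_setD(3)[OF X])
  have eqI: "nchain Y n (H n (act X n n \<theta> x, \<alpha>)) = nchain Y n (H n (act X n n \<theta>' x, \<alpha>'))"
    if "\<theta> \<in> Delta n n" "\<theta>' \<in> Delta n n" "\<alpha> \<in> Delta n 1" "\<alpha>' \<in> Delta n 1"
      "\<And>i. i \<le> n \<Longrightarrow> \<theta> i = \<theta>' i" "\<And>i. i \<le> n \<Longrightarrow> \<alpha> i = \<alpha>' i" for \<theta> \<theta>' \<alpha> \<alpha>' :: "nat \<Rightarrow> nat"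
    using Delta_eqI[OF that(1,2,5)] Delta_eqI[OF that(3,4,6)] by simp
  have cc: "compose {..n} (codegen n i) (coface (Suc n) j) \<in> Delta n n"
    "compose {..n} (step_map (Suc n) i) (coface (Suc n) j) \<in> Delta n 1" if "i \<le> n" "j \<le> Suc n" for i j
    using that by (auto intro!: Delta_compose[of _ "Suc n"])
  have cc': "compose {..n} (coface n j) (codegen (n - 1) i) \<in> Delta n n" if "i < n" "j \<le> n" for i j
    using that by (cases n) (auto intro!: Delta_compose[of _ "n - 1"])
  have "(\<Sum>i\<le>n. \<Sum>j\<le>Suc n. smul ((-1) ^ (i + j)) (k i j)) + (\<Sum>i<n. \<Sum>j\<le>n. smul ((-1) ^ (i + j)) (l i j)) = k 0 0 - k n (Suc n)"
  proof (rule alternating_prism_sum)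
    fix i j assume ij: "i \<le> n" "j < i"
    then obtain m where m: "n = Suc m" by (cases n) auto
    show "k i j = l (i - 1) j"
      using ij m by (subst k, simp, simp, subst l, simp, simp, intro eqI cc cc') auto
  next
    fix i j assume ij: "Suc i < j" "j \<le> Suc n"
    then obtain m where m: "n = Suc m" by (cases n) auto
    show "k i j = l i (j - 1)"
      using ij m by (subst k, simp, simp, subst l, simp, simp, intro eqI cc cc') auto
  next
    fix i assume "i < n"
    then show "k (Suc i) (Suc i) = k i (Suc i)"
      by (subst k, simp, simp, subst k, simp, simp, intro eqI cc) auto
  qed
  moreover have "k 0 0 = nchain Y n (v n x)"
  proof -
    have "k 0 0 = nchain Y n (H n (act X n n (\<lambda>i\<in>{..n}. i) x, const_map n 1))"
      by (subst k, simp, simp, intro eqI cc) auto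
    then show ?thesis
      using H x simplicial_setD(2)[OF X x] by (simp add: simplicial_homotopy_def)
  qed
  moreover have "k n (Suc n) = nchain Y n (u n x)"
  proof -
    have "k n (Suc n) = nchain Y n (H n (act X n n (\<lambda>i\<in>{..n}. i) x, const_map n 0))"
      by (subst k, simp, simp, intro eqI cc) auto
    then show ?thesis
      using H x simplicial_setD(2)[OF X x] by (simp add: simplicial_homotopy_def)
  qed
  ultimately show ?thesis
    unfolding bd db by simp
qed

text \<open>A vertex sequence of a prism over an n-simplex first runs through vertices in the bottom and then through
  vertices in the top. Cutting it before the jump yields a bottom simplex and a prism simplex, cutting it
  after the jump a prism simplex and a top simplex.\<close>

lemma prism_sum_coproduct:
  assumes X: "simplicial_set X" and Y: "simplicial_set Y" and H: "simplicial_homotopy X Y u v H"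
    and uv: "sset_map X Y u" "sset_map X Y v" and x: "x \<in> simplices X n"
  shows "lin (cop (Q_Delta Y)) (prism_sum X Y H (n, x)) =
    lin (\<lambda>(x, y). tensor (prism_sum X Y H x) (Q_Delta_map Y v y) +
        smul ((-1) ^ fst x) (tensor (Q_Delta_map Y u x) (prism_sum X Y H y))) (AW_sum X n x :: _ \<Rightarrow>\<^sub>0 'k::comm_ring_1)"
proof -
  have H': "sset_map (prism X) Y H" using H by (simp add: simplicial_homotopy_def)
  note H'' = H[unfolded simplicial_homotopy_def]
  let ?f = "\<lambda>p. act X n p (front_inc p) x" and ?l = "\<lambda>p. act X n (n - p) (last_inc p (n - p)) x"
  let ?F = "\<lambda>p. (nchain X p (?f p) :: _ \<Rightarrow>\<^sub>0 'k)" and ?L = "\<lambda>p. (nchain X (n - p) (?l p) :: _ \<Rightarrow>\<^sub>0 'k)"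
  let ?P = "prism_sum X Y H :: _ \<Rightarrow> _ \<Rightarrow>\<^sub>0 'k"
  let ?k = "\<lambda>i. H (Suc n) (act X n (Suc n) (codegen n i) x, step_map (Suc n) i)"
  define U :: "nat \<Rightarrow> (nat \<times> 'b \<Rightarrow>\<^sub>0 'k)" where "U p = nchain Y p (u p (?f p))" for p
  define V :: "nat \<Rightarrow> (nat \<times> 'b \<Rightarrow>\<^sub>0 'k)" where "V p = nchain Y (n - p) (v (n - p) (?l p))" for p
  define PF :: "nat \<Rightarrow> nat \<Rightarrow> (nat \<times> 'b \<Rightarrow>\<^sub>0 'k)"
    where "PF p i = nchain Y (Suc p) (H (Suc p) (act X p (Suc p) (codegen p i) (?f p), step_map (Suc p) i))" for p i
  define PL :: "nat \<Rightarrow> nat \<Rightarrow> (nat \<times> 'b \<Rightarrow>\<^sub>0 'k)"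
    where "PL p j = nchain Y (Suc (n - p)) (H (Suc (n - p)) (act X (n - p) (Suc (n - p)) (codegen (n - p) j) (?l p), step_map (Suc (n - p)) j))" for p j
  have f: "?f p \<in> simplices X p" "?l p \<in> simplices X (n - p)" if "p \<le> n" for p
    using that by (auto intro: simplicial_setD(1)[OF X x])
  have bottom: "nchain Y p (act Y (Suc n) p (front_inc p) (?k i)) = U p" if "p \<le> i" "i \<le> n" for p i
  proof -
    have "act Y (Suc n) p (front_inc p) (?k i) = H p (?f p, const_map p 0)"
      using that by (intro prism_map_act[OF X x H']) auto
    then show ?thesis using H'' f[of p] that by (simp add: U_def)
  qed
  have upper: "nchain Y (Suc n - p) (act Y (Suc n) (Suc n - p) (last_inc p (Suc n - p)) (?k i)) = PL p (i - p)"
    if "p \<le> i" "i \<le> n" for p i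
  proof -
    define \<zeta> where "\<zeta> = compose {..Suc (n - p)} (last_inc p (n - p)) (codegen (n - p) (i - p))"
    have \<zeta>: "\<zeta> \<in> Delta (Suc (n - p)) n"
      unfolding \<zeta>_def using that by (intro Delta_compose[of _ "n - p"]) auto
    have "act X (n - p) (Suc (n - p)) (codegen (n - p) (i - p)) (?l p) = act X n (Suc (n - p)) \<zeta> x"
      unfolding \<zeta>_def using that by (intro simplicial_setD(3)[OF X x]) auto
    moreover have "act Y (Suc n) (Suc (n - p)) (last_inc p (Suc (n - p))) (?k i) =
        H (Suc (n - p)) (act X n (Suc (n - p)) \<zeta> x, step_map (Suc (n - p)) (i - p))"
      using that \<zeta> by (intro prism_map_act[OF X x H']) (auto simp: \<zeta>_def)
    ultimately show ?thesis
      using that by (simp add: PL_def Suc_diff_le)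
  qed
  have lower: "nchain Y (Suc p) (act Y (Suc n) (Suc p) (front_inc (Suc p)) (?k i)) = PF p i"
    if "i \<le> p" "p \<le> n" for p i
  proof -
    define \<zeta> where "\<zeta> = compose {..Suc p} (front_inc p) (codegen p i)"
    have \<zeta>: "\<zeta> \<in> Delta (Suc p) n"
      unfolding \<zeta>_def using that by (intro Delta_compose[of _ p]) auto
    have "act X p (Suc p) (codegen p i) (?f p) = act X n (Suc p) \<zeta> x"
      unfolding \<zeta>_def using that by (intro simplicial_setD(3)[OF X x]) auto
    moreover have "act Y (Suc n) (Suc p) (front_inc (Suc p)) (?k i) = H (Suc p) (act X n (Suc p) \<zeta> x, step_map (Suc p) i)"
      using that \<zeta> by (intro prism_map_act[OF X x H']) (auto simp: \<zeta>_def)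
    ultimately show ?thesis
      by (simp add: PF_def)
  qed
  have top: "nchain Y (n - p) (act Y (Suc n) (n - p) (last_inc (Suc p) (n - p)) (?k i)) = V p" if "i \<le> p" "p \<le> n" for p i
  proof -
    have "act Y (Suc n) (n - p) (last_inc (Suc p) (n - p)) (?k i) = H (n - p) (?l p, const_map (n - p) 1)"
      using that by (intro prism_map_act[OF X x H']) auto
    then show ?thesis using H'' f[of p] that by (simp add: V_def)
  qed
  have AW: "AW_sum Y (Suc n) (?k i) = (\<Sum>p\<le>i. tensor (U p) (PL p (i - p))) + (\<Sum>p\<in>{i..n}. tensor (PF p i) (V p))"
    if "i \<le> n" for i
  proof -
    let ?t = "\<lambda>p. tensor (nchain Y p (act Y (Suc n) p (front_inc p) (?k i)) :: _ \<Rightarrow>\<^sub>0 'k)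
      (nchain Y (Suc n - p) (act Y (Suc n) (Suc n - p) (last_inc p (Suc n - p)) (?k i)))"
    have "{..Suc n} = {..i} \<union> {Suc i..Suc n}" using that by auto
    then have "AW_sum Y (Suc n) (?k i) = sum ?t {..i} + sum ?t {Suc i..Suc n}"
      unfolding AW_sum_def by (simp only:) (rule sum.union_disjoint; auto)
    moreover have "sum ?t {..i} = (\<Sum>p\<le>i. tensor (U p) (PL p (i - p)))"
      using that by (intro sum.cong refl) (simp add: bottom upper del: diff_Suc_Suc)
    moreover have "sum ?t {Suc i..Suc n} = (\<Sum>p\<in>{i..n}. tensor (PF p i) (V p))"
      unfolding sum.shift_bounds_cl_Suc_ivl by (intro sum.cong refl) (simp add: lower top)
    ultimately show ?thesis by simp
  qed
  have PFs: "lin ?P (?F p) = (\<Sum>i\<le>p. smul ((-1) ^ i) (PF p i))" for p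
    unfolding lin_prism_sum_nchain[OF X Y H'] by (simp add: prism_sum_def PF_def)
  have PLs: "lin ?P (?L p) = (\<Sum>j\<le>n - p. smul ((-1) ^ j) (PL p j))" for p
    unfolding lin_prism_sum_nchain[OF X Y H'] by (simp add: prism_sum_def PL_def)
  have "lin (cop (Q_Delta Y)) (?P (n, x)) = (\<Sum>i\<le>n. smul ((-1) ^ i) (AW_sum Y (Suc n) (?k i)))"
    unfolding prism_sum_def by (simp only: prod.case lin_sum lin_smul lin_cop_nchain[OF Y])
  also have "\<dots> = (\<Sum>i\<le>n. (\<Sum>p\<le>i. smul ((-1) ^ i) (tensor (U p) (PL p (i - p)))) + (\<Sum>p\<in>{i..n}. smul ((-1) ^ i) (tensor (PF p i) (V p))))"
    by (intro sum.cong refl) (simp add: AW smul_distribs smul_sum)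
  also have "\<dots> = (\<Sum>i\<le>n. \<Sum>p\<le>i. smul ((-1) ^ i) (tensor (U p) (PL p (i - p)))) + (\<Sum>i\<le>n. \<Sum>p\<in>{i..n}. smul ((-1) ^ i) (tensor (PF p i) (V p)))"
    by (rule sum.distrib)
  also have "(\<Sum>i\<le>n. \<Sum>p\<le>i. smul ((-1) ^ i) (tensor (U p) (PL p (i - p)))) = (\<Sum>p\<le>n. smul ((-1) ^ p) (tensor (U p) (lin ?P (?L p))))"
    unfolding triangle_sum PLs by (simp add: bilin_sum smul_sum power_add)
  also have "(\<Sum>i\<le>n. \<Sum>p\<in>{i..n}. smul ((-1) ^ i) (tensor (PF p i) (V p))) = (\<Sum>p\<le>n. tensor (lin ?P (?F p)) (V p))"
  proof -
    have "(\<Sum>i\<le>n. \<Sum>p\<in>{i..n}. smul ((-1) ^ i) (tensor (PF p i) (V p))) = (\<Sum>p\<le>n. \<Sum>i\<le>p. smul ((-1) ^ i) (tensor (PF p i) (V p)))"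
      by (subst (1 2) sum.Sigma; (simp; fail)?)
         (rule sum.reindex_bij_witness[of _ "\<lambda>(p, i). (i, p)" "\<lambda>(i, p). (p, i)"]; auto)
    then show ?thesis unfolding PFs by (simp add: bilin_sum)
  qed
  also have "(\<Sum>p\<le>n. smul ((-1) ^ p) (tensor (U p) (lin ?P (?L p)))) + (\<Sum>p\<le>n. tensor (lin ?P (?F p)) (V p)) =
      (\<Sum>p\<le>n. tensor (lin ?P (?F p)) (lin (Q_Delta_map Y v) (?L p)) + smul ((-1) ^ p) (tensor (lin (Q_Delta_map Y u) (?F p)) (lin ?P (?L p))))"
    by (simp add: lin_Q_Delta_map_nchain[OF uv(1)] lin_Q_Delta_map_nchain[OF uv(2)] U_def V_def sum.distrib)
  also have "\<dots> = lin (\<lambda>(x, y). tensor (?P x) (Q_Delta_map Y v y) + smul ((-1) ^ fst x) (tensor (Q_Delta_map Y u x) (?P y))) (AW_sum X n x)"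
  proof -
    have "lin (\<lambda>(x, y). tensor (?P x) (Q_Delta_map Y v y) + smul ((-1) ^ fst x) (tensor (Q_Delta_map Y u x) (?P y))) (tensor a c) =
      tensor (lin ?P a) (lin (Q_Delta_map Y v) c) + smul ((-1) ^ p) (tensor (lin (Q_Delta_map Y u) a) (lin ?P c))"
      if "\<And>w. w \<in> Poly_Mapping.keys a \<Longrightarrow> fst w = p" for a c p
    proof -
      have "lin (\<lambda>(x, y). tensor (?P x) (Q_Delta_map Y v y) + smul ((-1) ^ fst x) (tensor (Q_Delta_map Y u x) (?P y))) (tensor a c) =
        lin (\<lambda>x. tensor (?P x) (lin (Q_Delta_map Y v) c) + smul ((-1) ^ p) (tensor (Q_Delta_map Y u x) (lin ?P c))) a"
        unfolding lin_bilin using that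
        by (intro lin_cong) (simp add: lin_fun_add lin_fun_smul bilin_lin_right)
      then show ?thesis
        by (simp add: lin_fun_add lin_fun_smul bilin_lin_left)
    qed
    note tens = this
    have "fst w = p" if "w \<in> Poly_Mapping.keys (?F p)" for w p
      using that by (auto simp: nchain_def split: if_splits)
    then show ?thesis
      unfolding AW_sum_def lin_sum by (intro sum.cong refl tens[symmetric]) blast
  qed
  finally show ?thesis .
qed

text \<open>The prism operator runs from the bottom to the top, so its boundary is the top minus the bottom, whereas
  a coderivation homotopy bounds the first map minus the second; hence the sign.\<close>

theorem coderivation_homotopy_prism:
  assumes X: "reduced_sset X" and Y: "simplicial_set Y" and H: "simplicial_homotopy X Y u v H"
    and uv: "sset_map X Y u" "sset_map X Y v"
  shows "coderivation_homotopy (Q_Delta X :: (_, 'k::comm_ring_1) dgc) (Q_Delta Y) (Q_Delta_map Y u) (Q_Delta_map Y v)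
    (\<lambda>b. - prism_sum X Y H b)"
proof -
  note X' = reduced_ssetD(1)[OF X]
  have H': "sset_map (prism X) Y H" using H by (simp add: simplicial_homotopy_def)
  let ?P = "prism_sum X Y H :: _ \<Rightarrow> _ \<Rightarrow>\<^sub>0 'k"
  have "Poly_Mapping.keys (?P b) \<subseteq> {c \<in> basis (Q_Delta Y :: (_, 'k) dgc). fst c = fst b + 1}"
    if "b \<in> basis (Q_Delta X :: (_, 'k) dgc)" for b
  proof -
    obtain n x where nx: "b = (n, x)" "x \<in> simplices X n" using \<open>b \<in> _\<close> by (cases b) auto
    have "H (Suc n) (act X n (Suc n) (codegen n i) x, step_map (Suc n) i) \<in> simplices Y (Suc n)" if "i \<le> n" for i
      using sset_mapD(1)[OF H'] simplicial_setD(1)[OF X' nx(2)] that by simp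
    from keys_nchain_subset[OF this] show ?thesis
      unfolding prism_sum_def nx by (simp, intro keys_sum_subset order_trans[OF keys_smul]) fastforce
  qed
  moreover have "lin (bd (Q_Delta Y)) (- ?P b) + lin (\<lambda>b. - ?P b) (bd (Q_Delta X) b) = Q_Delta_map Y u b - Q_Delta_map Y v b"
    if "b \<in> basis (Q_Delta X :: (_, 'k) dgc)" for b
  proof -
    obtain n x where nx: "b = (n, x)" "x \<in> simplices X n" using \<open>b \<in> _\<close> by (cases b) auto
    have "lin (bd (Q_Delta Y)) (?P (n, x)) + lin ?P (bd (Q_Delta X) (n, x)) = nchain Y n (v n x) - nchain Y n (u n x)"
      by (rule prism_sum_boundary[OF X' Y H nx(2)])
    from arg_cong[OF this, of uminus] show ?thesis
      by (simp add: nx Q_Delta_map_def lin_fun_uminus)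
  qed
  moreover have "lin (cop (Q_Delta Y)) (- ?P b) = lin (\<lambda>(x, y). tensor (- ?P x) (Q_Delta_map Y v y) +
      smul ((-1) ^ fst x) (tensor (Q_Delta_map Y u x) (- ?P y))) (cop (Q_Delta X) b)"
    if "b \<in> basis (Q_Delta X :: (_, 'k) dgc)" for b
  proof -
    obtain n x where nx: "b = (n, x)" "x \<in> simplices X n" using \<open>b \<in> _\<close> by (cases b) auto
    have "lin (\<lambda>(x, y). tensor (- ?P x) (Q_Delta_map Y v y) + smul ((-1) ^ fst x) (tensor (Q_Delta_map Y u x) (- ?P y))) (AW_sum X n x) =
      lin (\<lambda>b. - (case b of (x, y) \<Rightarrow> tensor (?P x) (Q_Delta_map Y v y) + smul ((-1) ^ fst x) (tensor (Q_Delta_map Y u x) (?P y)))) (AW_sum X n x)"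
      by (intro lin_cong) auto
    then show ?thesis
      using prism_sum_coproduct[OF X' Y H uv nx(2), where 'k = 'k] by (simp add: nx cop_Q_Delta lin_fun_uminus)
  qed
  moreover have "?P (0, x) = 0" if "x \<in> simplices X 0" for x
    using H that by (simp add: prism_sum_def simplicial_homotopy_def)
  then have "- ?P (unit_elt (Q_Delta X :: (_, 'k) dgc)) = 0"
    using reduced_ssetD(2)[OF X] by (simp, metis insertI1)
  ultimately show ?thesis
    unfolding coderivation_homotopy_def by simp
qed

lemma lin_Q_Delta_map_comp:
  assumes "sset_map Y Z v"
  shows "lin (Q_Delta_map Z v) (Q_Delta_map Y u b) = Q_Delta_map Z (\<lambda>n x. v n (u n x)) b"
  by (cases b) (simp add: Q_Delta_map_def[of Y] Q_Delta_map_def[of Z "\<lambda>n x. v n (u n x)"] lin_Q_Delta_map_nchain[OF assms])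

text \<open>The prism operators of the two simplicial homotopies are coderivation homotopies, so the map is
  invertible up to homotopy in the sense that the cobar construction preserves.\<close>

theorem omega_quasi_iso_homotopy_equivalence:
  assumes X: "reduced_sset X" and Y: "reduced_sset Y"
    and f: "sset_map X Y f" and r: "sset_map Y X r"
    and H: "simplicial_homotopy X X (\<lambda>n x. r n (f n x)) (\<lambda>n x. x) H"
    and H': "simplicial_homotopy Y Y (\<lambda>n y. f n (r n y)) (\<lambda>n y. y) H'"
  shows "omega_quasi_iso (Q_Delta X :: (_, 'k::comm_ring_1) dgc) (Q_Delta Y) (Q_Delta_map Y f)"
proof -
  note X' = reduced_ssetD(1)[OF X] and Y' = reduced_ssetD(1)[OF Y]
  have maps: "sset_map X X (\<lambda>n x. r n (f n x))" "sset_map Y Y (\<lambda>n y. f n (r n y))"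
    "sset_map X X (\<lambda>n x. x)" "sset_map Y Y (\<lambda>n y. y)"
    using f r unfolding sset_map_def by auto
  have "dga_quasi_iso (cobar (Q_Delta X :: (_, 'k) dgc)) (cobar (Q_Delta Y)) (cobar_map (Q_Delta Y) (Q_Delta_map Y f))"
  proof (rule dga_quasi_iso_cobar_map)
    show "connected_dg_coalgebra (Q_Delta X :: (_, 'k) dgc)" "connected_dg_coalgebra (Q_Delta Y :: (_, 'k) dgc)"
      by (rule connected_dg_coalgebra_Q_Delta X Y)+
    show "dg_coalgebra_map (Q_Delta X :: (_, 'k) dgc) (Q_Delta Y) (Q_Delta_map Y f)"
      "dg_coalgebra_map (Q_Delta Y :: (_, 'k) dgc) (Q_Delta X) (Q_Delta_map X r)"
      "dg_coalgebra_map (Q_Delta X :: (_, 'k) dgc) (Q_Delta X) (Q_Delta_map X (\<lambda>n x. r n (f n x)))"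
      "dg_coalgebra_map (Q_Delta Y :: (_, 'k) dgc) (Q_Delta Y) (Q_Delta_map Y (\<lambda>n y. f n (r n y)))"
      "dg_coalgebra_map (Q_Delta X :: (_, 'k) dgc) (Q_Delta X) (Q_Delta_map X (\<lambda>n x. x))"
      "dg_coalgebra_map (Q_Delta Y :: (_, 'k) dgc) (Q_Delta Y) (Q_Delta_map Y (\<lambda>n y. y))"
      by (rule dg_coalgebra_map_Q_Delta_map X' Y' f r maps)+
    show "coderivation_homotopy (Q_Delta X :: (_, 'k) dgc) (Q_Delta X) (Q_Delta_map X (\<lambda>n x. r n (f n x)))
        (Q_Delta_map X (\<lambda>n x. x)) (\<lambda>b. - prism_sum X X H b)"
      "coderivation_homotopy (Q_Delta Y :: (_, 'k) dgc) (Q_Delta Y) (Q_Delta_map Y (\<lambda>n y. f n (r n y)))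
        (Q_Delta_map Y (\<lambda>n y. y)) (\<lambda>b. - prism_sum Y Y H' b)"
      by (rule coderivation_homotopy_prism X Y X' Y' H H' maps)+
    show "Q_Delta_map X (\<lambda>n x. x) b = (gen b :: _ \<Rightarrow>\<^sub>0 'k)" if "b \<in> basis (Q_Delta X :: (_, 'k) dgc)" for b
      using that by (auto simp: Q_Delta_map_def nchain_def)
    show "Q_Delta_map Y (\<lambda>n y. y) b = (gen b :: _ \<Rightarrow>\<^sub>0 'k)" if "b \<in> basis (Q_Delta Y :: (_, 'k) dgc)" for b
      using that by (auto simp: Q_Delta_map_def nchain_def)
  qed (simp_all only: lin_Q_Delta_map_comp[OF f] lin_Q_Delta_map_comp[OF r])
  then show ?thesis
    unfolding omega_quasi_iso_def
    using connected_dg_coalgebra_Q_Delta[OF X] connected_dg_coalgebra_Q_Delta[OF Y] dg_coalgebra_map_Q_Delta_map[OF X' Y' f]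
    by blast
qed

section \<open>Trivial fibrations\<close>

lemma strict_operator_le:
  assumes "\<And>i. i < m \<Longrightarrow> (\<theta> :: nat \<Rightarrow> nat) i < \<theta> (Suc i)" "i + k \<le> m"
  shows "\<theta> i + k \<le> \<theta> (i + k)"
  using assms(2)
proof (induction k)
  case (Suc k)
  then show ?case using assms(1)[of "i + k"] by simp
qed simp

text \<open>Every operator is a composite of faces and degeneracies: an operator that repeats a value factors
  through a degeneracy, one that misses a value through a face, and otherwise it is an identity.\<close>

lemma sset_mapI_generators:
  assumes X: "simplicial_set X" and Y: "simplicial_set Y"
    and f: "\<And>n x. x \<in> simplices X n \<Longrightarrow> f n x \<in> simplices Y n"
    and faces: "\<And>n i x. x \<in> simplices X (Suc n) \<Longrightarrow> i \<le> Suc n \<Longrightarrow>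
      f n (act X (Suc n) n (coface (Suc n) i) x) = act Y (Suc n) n (coface (Suc n) i) (f (Suc n) x)"
    and degens: "\<And>n i x. x \<in> simplices X n \<Longrightarrow> i \<le> n \<Longrightarrow>
      f (Suc n) (act X n (Suc n) (codegen n i) x) = act Y n (Suc n) (codegen n i) (f n x)"
  shows "sset_map X Y f"
proof -
  have "f m (act X n m \<theta> x) = act Y n m \<theta> (f n x)" if "\<theta> \<in> Delta m n" "x \<in> simplices X n" for n m \<theta> x
    using that
  proof (induction "n + m" arbitrary: n m \<theta> x rule: less_induct)
    case less
    note \<theta> = less.prems(1) and x = less.prems(2)
    consider i where "i < m" "\<theta> i = \<theta> (Suc i)"
      | j where "j \<le> n" "j \<notin> \<theta> ` {..m}"
      | "\<And>i. i < m \<Longrightarrow> \<theta> i < \<theta> (Suc i)" "{..n} \<subseteq> \<theta> ` {..m}"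
      using DeltaD(3)[OF \<theta>] by (metis Suc_leI atMost_iff le_neq_implies_less le_add2 plus_1_eq_Suc subsetI)
    then show ?case
    proof cases
      case (1 i)
      then obtain k where k: "m = Suc k" by (cases m) auto
      define \<eta> where "\<eta> = compose {..k} \<theta> (coface (Suc k) (Suc i))"
      have \<eta>: "\<eta> \<in> Delta k n"
        unfolding \<eta>_def using 1 k \<theta> by (intro Delta_compose[of _ m]) auto
      have "act X k m (codegen k i) (act X n k \<eta> x) = act X n m \<theta> x"
        using 1 k \<theta> \<eta> by (intro act_act_eq1[OF X x]) (auto simp: \<eta>_def le_Suc_eq not_le le_less_Suc_eq)
      moreover have "act Y k m (codegen k i) (act Y n k \<eta> (f n x)) = act Y n m \<theta> (f n x)"
        using 1 k \<theta> \<eta> by (intro act_act_eq1[OF Y f[OF x]]) (auto simp: \<eta>_def le_Suc_eq not_le le_less_Suc_eq)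
      moreover have "f k (act X n k \<eta> x) = act Y n k \<eta> (f n x)"
        using k by (intro less.hyps \<eta> x) simp
      moreover have "act X n k \<eta> x \<in> simplices X k"
        by (rule simplicial_setD(1)[OF X x \<eta>])
      ultimately show ?thesis
        using degens[of "act X n k \<eta> x" k i] 1 k by simp
    next
      case (2 j)
      then have "n \<noteq> 0"
        using DeltaD(2)[OF \<theta>, of 0] by (metis atMost_iff image_eqI le_zero_eq zero_le)
      then obtain l where l: "n = Suc l" by (cases n) auto
      have ne: "\<theta> i \<noteq> j" if "i \<le> m" for i using 2 that by auto
      define \<eta> where "\<eta> = compose {..m} (codegen l (j - 1)) \<theta>"
      have \<eta>: "\<eta> \<in> Delta m l"
        unfolding \<eta>_def using 2 l \<theta> by (intro Delta_compose[of _ n]) auto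
      have eq: "coface (Suc l) j (\<eta> i) = \<theta> i" if "i \<le> m" for i
        using ne[OF that] DeltaD(2)[OF \<theta> that] that l 2(1) by (auto simp: \<eta>_def)
      have "act X l m \<eta> (act X n l (coface n j) x) = act X n m \<theta> x"
        using 2 l \<theta> \<eta> eq by (intro act_act_eq1[OF X x]) auto
      moreover have "act Y l m \<eta> (act Y n l (coface n j) (f n x)) = act Y n m \<theta> (f n x)"
        using 2 l \<theta> \<eta> eq by (intro act_act_eq1[OF Y f[OF x]]) auto
      moreover have d: "act X n l (coface n j) x \<in> simplices X l"
        using 2 l by (intro simplicial_setD(1)[OF X x]) auto
      moreover have "f m (act X l m \<eta> (act X n l (coface n j) x)) = act Y l m \<eta> (f l (act X n l (coface n j) x))"
        using l by (intro less.hyps \<eta> d) simp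
      ultimately show ?thesis
        using faces[of x l j] 2 l x by simp
    next
      case 3
      have "inj_on \<theta> {..m}"
      proof (rule linorder_inj_onI)
        fix i j assume "i < j" "j \<in> {..m}"
        then show "\<theta> i \<noteq> \<theta> j"
          using strict_operator_le[of m \<theta> i "j - i"] 3(1) by simp
      qed auto
      then have "card {..m} = card (\<theta> ` {..m})" by (simp add: card_image)
      also have "\<theta> ` {..m} = {..n}" using 3(2) DeltaD(2)[OF \<theta>] by auto
      finally have mn: "m = n" by simp
      have "\<theta> i = i" if "i \<le> m" for i
        using strict_operator_le[of m \<theta> 0 i] strict_operator_le[of m \<theta> i "m - i"] 3(1) DeltaD(2)[OF \<theta>, of m] mn that by fastforce
      then have "\<theta> = (\<lambda>i\<in>{..n}. i)"
        using mn \<theta> by (intro Delta_eqI[of \<theta> n n _ n]) auto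
      then show ?thesis
        using mn simplicial_setD(2)[OF X x] simplicial_setD(2)[OF Y f[OF x]] by simp
    qed
  qed
  with f show ?thesis unfolding sset_map_def by blast
qed

abbreviation face :: "'a sset \<Rightarrow> nat \<Rightarrow> nat \<Rightarrow> 'a \<Rightarrow> 'a" where
  "face X n i x \<equiv> act X (Suc n) n (coface (Suc n) i) x"

abbreviation degen :: "'a sset \<Rightarrow> nat \<Rightarrow> nat \<Rightarrow> 'a \<Rightarrow> 'a" where
  "degen X n i x \<equiv> act X n (Suc n) (codegen n i) x"

text \<open>The right lifting property against the inclusions of the boundaries of the standard simplices. A
  map from the boundary of a simplex is a family of faces that agree on their common faces.\<close>

definition trivial_fibration :: "'a sset \<Rightarrow> 'b sset \<Rightarrow> (nat \<Rightarrow> 'a \<Rightarrow> 'b) \<Rightarrow> bool" where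
  "trivial_fibration P L e \<longleftrightarrow> sset_map P L e \<and>
     (\<forall>v\<in>simplices L 0. \<exists>y\<in>simplices P 0. e 0 y = v) \<and>
     (\<forall>n z. \<forall>v\<in>simplices L (Suc n).
        (\<forall>i\<le>Suc n. z i \<in> simplices P n \<and> e n (z i) = face L n i v) \<and>
        (\<forall>i j m. i < j \<and> j \<le> Suc n \<and> n = Suc m \<longrightarrow>
           act P n m (coface n i) (z j) = act P n m (coface n (j - 1)) (z i)) \<longrightarrow>
        (\<exists>y\<in>simplices P (Suc n). e (Suc n) y = v \<and> (\<forall>i\<le>Suc n. face P n i y = z i)))"

lemma simplicial_identities:
  assumes X: "simplicial_set X"
  shows "x \<in> simplices X n \<Longrightarrow> j \<le> n \<Longrightarrow> face X n j (degen X n j x) = x"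
    and "x \<in> simplices X n \<Longrightarrow> j \<le> n \<Longrightarrow> face X n (Suc j) (degen X n j x) = x"
    and "x \<in> simplices X (Suc n) \<Longrightarrow> i < j \<Longrightarrow> j \<le> Suc n \<Longrightarrow>
      face X (Suc n) i (degen X (Suc n) j x) = degen X n (j - 1) (face X n i x)"
    and "x \<in> simplices X (Suc n) \<Longrightarrow> Suc j < i \<Longrightarrow> i \<le> Suc (Suc n) \<Longrightarrow>
      face X (Suc n) i (degen X (Suc n) j x) = degen X n j (face X n (i - 1) x)"
    and "x \<in> simplices X (Suc (Suc n)) \<Longrightarrow> i < j \<Longrightarrow> j \<le> Suc (Suc n) \<Longrightarrow>
      face X n i (face X (Suc n) j x) = face X n (j - 1) (face X (Suc n) i x)"
    and "x \<in> simplices X n \<Longrightarrow> i \<le> j \<Longrightarrow> j \<le> n \<Longrightarrow>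
      degen X (Suc n) i (degen X n j x) = degen X (Suc n) (Suc j) (degen X n i x)"
proof -
  show "face X n j (degen X n j x) = x" "face X n (Suc j) (degen X n j x) = x"
    if x: "x \<in> simplices X n" and j: "j \<le> n"
  proof -
    have "face X n j (degen X n j x) = act X n n (\<lambda>i\<in>{..n}. i) x"
      "face X n (Suc j) (degen X n j x) = act X n n (\<lambda>i\<in>{..n}. i) x"
      using j by (auto intro!: act_act_eq1[OF X x])
    then show "face X n j (degen X n j x) = x" "face X n (Suc j) (degen X n j x) = x"
      using simplicial_setD(2)[OF X x] by simp_all
  qed
qed (auto intro!: act_act_eq[OF X])

lemma trivial_fibration_filler:
  assumes "trivial_fibration P L e" "v \<in> simplices L (Suc n)"
    and "\<forall>i\<le>Suc n. z i \<in> simplices P n \<and> e n (z i) = face L n i v"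
    and "\<And>i j m. i < j \<Longrightarrow> j \<le> Suc n \<Longrightarrow> n = Suc m \<Longrightarrow>
      act P n m (coface n i) (z j) = act P n m (coface n (j - 1)) (z i)"
  shows "\<exists>y\<in>simplices P (Suc n). e (Suc n) y = v \<and> (\<forall>i\<le>Suc n. face P n i y = z i)"
  using assms unfolding trivial_fibration_def by blast

text \<open>The lift is constructed by induction on the dimension. On degenerate simplices it is forced by the
  lower dimensions; the simplicial identities show that two representations of a simplex as a degeneracy
  force the same value. On the other simplices outside the given subset it is a choice of a filler.\<close>

lemma trivial_fibration_lift:
  assumes B: "simplicial_set B" and P: "simplicial_set P" and e: "trivial_fibration P L e"
    and v: "sset_map B L v"
    and A: "\<And>n x. x \<in> A n \<Longrightarrow> x \<in> simplices B n"
      "\<And>n m \<theta> x. x \<in> A n \<Longrightarrow> \<theta> \<in> Delta m n \<Longrightarrow> act B n m \<theta> x \<in> A m"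
    and u: "\<And>n x. x \<in> A n \<Longrightarrow> u n x \<in> simplices P n \<and> e n (u n x) = v n x"
      "\<And>n m \<theta> x. x \<in> A n \<Longrightarrow> \<theta> \<in> Delta m n \<Longrightarrow> u m (act B n m \<theta> x) = act P n m \<theta> (u n x)"
  shows "\<exists>F. sset_map B P F \<and> (\<forall>n. \<forall>x\<in>simplices B n. e n (F n x) = v n x) \<and> (\<forall>n. \<forall>x\<in>A n. F n x = u n x)"
proof -
  have e_map: "sset_map P L e" using e by (simp add: trivial_fibration_def)
  define good where "good N F \<longleftrightarrow>
     (\<forall>n\<le>N. \<forall>x\<in>simplices B n. F n x \<in> simplices P n \<and> e n (F n x) = v n x \<and> (x \<in> A n \<longrightarrow> F n x = u n x)) \<and>
     (\<forall>n<N. \<forall>x\<in>simplices B (Suc n). \<forall>i\<le>Suc n. F n (face B n i x) = face P n i (F (Suc n) x)) \<and>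
     (\<forall>n<N. \<forall>x\<in>simplices B n. \<forall>i\<le>n. F (Suc n) (degen B n i x) = degen P n i (F n x))" for N F
  have base: "\<exists>F. good 0 F"
  proof -
    have "\<forall>x\<in>simplices B 0. \<exists>y. y \<in> simplices P 0 \<and> e 0 y = v 0 x \<and> (x \<in> A 0 \<longrightarrow> y = u 0 x)"
    proof
      fix x assume x: "x \<in> simplices B 0"
      show "\<exists>y. y \<in> simplices P 0 \<and> e 0 y = v 0 x \<and> (x \<in> A 0 \<longrightarrow> y = u 0 x)"
      proof (cases "x \<in> A 0")
        case True
        then show ?thesis using u(1) by blast
      next
        case False
        then show ?thesis
          using e sset_mapD(1)[OF v x] unfolding trivial_fibration_def by blast
      qed
    qed
    then obtain F0 where "\<forall>x\<in>simplices B 0. F0 x \<in> simplices P 0 \<and> e 0 (F0 x) = v 0 x \<and> (x \<in> A 0 \<longrightarrow> F0 x = u 0 x)"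
      by metis
    then have "good 0 (\<lambda>_. F0)" unfolding good_def by simp
    then show ?thesis by blast
  qed
  have step: "\<exists>G. good (Suc N) G \<and> (\<forall>n\<le>N. G n = F n)" if good: "good N F" for N F
  proof -
    have F: "F n x \<in> simplices P n" "e n (F n x) = v n x" "x \<in> A n \<Longrightarrow> F n x = u n x"
      if "n \<le> N" "x \<in> simplices B n" for n x
      using good that unfolding good_def by blast+
    have F_face: "F n (face B n i x) = face P n i (F (Suc n) x)"
      if "n < N" "x \<in> simplices B (Suc n)" "i \<le> Suc n" for n x i
      using good that unfolding good_def by blast
    have F_degen: "F (Suc n) (degen B n i x) = degen P n i (F n x)"
      if "n < N" "x \<in> simplices B n" "i \<le> n" for n x i
      using good that unfolding good_def by blast
    have dB: "face B n i x \<in> simplices B n" if "x \<in> simplices B (Suc n)" "i \<le> Suc n" for n x i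
      using simplicial_setD(1)[OF B that(1)] that by simp
    have sB: "degen B n i x \<in> simplices B (Suc n)" if "x \<in> simplices B n" "i \<le> n" for n x i
      using simplicial_setD(1)[OF B that(1)] that by simp
    have consistent: "degen P N i (F N y) = degen P N j (F N z)"
      if "degen B N i y = degen B N j z" "i < j" "j \<le> N" and y: "y \<in> simplices B N" and z: "z \<in> simplices B N" for i j y z
    proof -
      from that obtain m where m: "N = Suc m" by (cases N) auto
      define w where "w = face B m i z"
      have w: "w \<in> simplices B m" unfolding w_def using z m that by (intro dB) auto
      have yw: "y = degen B m (j - 1) w"
        using simplicial_identities(1)[OF B y, of i] simplicial_identities(3)[OF B, of z m i j] that z m
        by (simp add: w_def)
      have "z = face B N (Suc j) (degen B N i y)"
        using simplicial_identities(2)[OF B z, of j] that by simp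
      also have "\<dots> = degen B m i (face B m j y)"
        using simplicial_identities(4)[OF B, of y m i "Suc j"] y m that by simp
      also have "face B m j y = w"
        using simplicial_identities(2)[OF B w, of "j - 1"] that m unfolding yw by simp
      finally have zw: "z = degen B m i w" .
      have "F N y = degen P m (j - 1) (F m w)" "F N z = degen P m i (F m w)"
        unfolding yw zw unfolding m using that m w by (intro F_degen; simp)+
      moreover have "degen P N i (degen P m (j - 1) (F m w)) = degen P N j (degen P m i (F m w))"
        using simplicial_identities(6)[OF P F(1)[OF _ w], of i "j - 1"] that m by simp
      ultimately show ?thesis by simp
    qed
    have "\<exists>y. y \<in> simplices P (Suc N) \<and> e (Suc N) y = v (Suc N) x \<and> (x \<in> A (Suc N) \<longrightarrow> y = u (Suc N) x) \<and>
        (\<forall>i\<le>Suc N. F N (face B N i x) = face P N i y) \<and>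
        (\<forall>z\<in>simplices B N. \<forall>i\<le>N. x = degen B N i z \<longrightarrow> y = degen P N i (F N z))"
      if x: "x \<in> simplices B (Suc N)" for x
    proof (cases "\<exists>z\<in>simplices B N. \<exists>j\<le>N. x = degen B N j z")
      case True
      then obtain z j where z: "z \<in> simplices B N" and j: "j \<le> N" and xz: "x = degen B N j z" by blast
      have Fz: "F N z \<in> simplices P N" "e N (F N z) = v N z" using F[OF _ z] by auto
      have zd: "z = face B N j x" using simplicial_identities(1)[OF B z j] xz by simp
      have "degen P N j (F N z) \<in> simplices P (Suc N)"
        using simplicial_setD(1)[OF P Fz(1)] j by simp
      moreover have "e (Suc N) (degen P N j (F N z)) = v (Suc N) x"
        unfolding xz using sset_mapD(2)[OF e_map Fz(1)] sset_mapD(2)[OF v z] Fz(2) j by simp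
      moreover have "degen P N j (F N z) = u (Suc N) x" if "x \<in> A (Suc N)"
      proof -
        have "z \<in> A N" unfolding zd using A(2)[OF that] j by simp
        then show ?thesis using F(3)[OF _ z] u(2)[of z N "codegen N j" "Suc N"] j xz by simp
      qed
      moreover have "F N (face B N i x) = face P N i (degen P N j (F N z))" if i: "i \<le> Suc N" for i
      proof -
        consider "i = j" | "i = Suc j" | "i < j" | "Suc j < i" by linarith
        then show ?thesis
        proof cases
          case 3
          then obtain m where m: "N = Suc m" using j by (cases N) auto
          have "face B N i x = degen B m (j - 1) (face B m i z)"
            unfolding xz using simplicial_identities(3)[OF B, of z m i j] 3 j z m by simp
          then have "F N (face B N i x) = degen P m (j - 1) (face P m i (F N z))"
            using F_degen[of m "face B m i z" "j - 1"] F_face[of m z i] dB[of z m i] 3 j z m by simp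
          then show ?thesis
            using simplicial_identities(3)[OF P, of "F N z" m i j] 3 j Fz m by simp
        next
          case 4
          then have "N \<noteq> 0" using i by auto
          then obtain m where m: "N = Suc m" by (cases N) auto
          have "face B N i x = degen B m j (face B m (i - 1) z)"
            unfolding xz using simplicial_identities(4)[OF B, of z m j i] 4 i z m by simp
          then have "F N (face B N i x) = degen P m j (face P m (i - 1) (F N z))"
            using F_degen[of m "face B m (i - 1) z" j] F_face[of m z "i - 1"] dB[of z m "i - 1"] 4 i z m by simp
          then show ?thesis
            using simplicial_identities(4)[OF P, of "F N z" m j i] 4 i Fz m by simp
        qed (use simplicial_identities(1,2)[OF B z j] simplicial_identities(1,2)[OF P Fz(1) j] xz in simp_all)
      qed
      moreover have "degen P N j (F N z) = degen P N j' (F N z')" if "z' \<in> simplices B N" "j' \<le> N" "x = degen B N j' z'" for z' j'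
      proof -
        consider "j = j'" | "j < j'" | "j' < j" by linarith
        then show ?thesis
        proof cases
          case 1
          then have "z = z'" using simplicial_identities(1)[OF B that(1,2)] zd that by simp
          with 1 show ?thesis by simp
        next
          case 2
          show ?thesis by (rule consistent) (use 2 xz that z j in simp_all)
        next
          case 3
          show ?thesis by (rule consistent[symmetric]) (use 3 xz that z j in simp_all)
        qed
      qed
      ultimately show ?thesis by blast
    next
      case nondeg: False
      show ?thesis
      proof (cases "x \<in> A (Suc N)")
        case True
        have "F N (face B N i x) = face P N i (u (Suc N) x)" if "i \<le> Suc N" for i
          using F(3)[OF _ dB[OF x that]] u(2)[OF True coface_Delta[OF that]] A(2)[OF True coface_Delta[OF that]] by simp
        then show ?thesis using u(1)[OF True] nondeg by blast
      next
        case False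
        have "\<forall>i\<le>Suc N. F N (face B N i x) \<in> simplices P N \<and> e N (F N (face B N i x)) = act L (Suc N) N (coface (Suc N) i) (v (Suc N) x)"
          using F dB[OF x] sset_mapD(2)[OF v x] by simp
        moreover have "act P N m (coface N i) (F N (face B N j x)) = act P N m (coface N (j - 1)) (F N (face B N i x))"
          if "i < j" "j \<le> Suc N" and m: "N = Suc m" for i j m
          using F_face[of m "face B N j x" i] F_face[of m "face B N i x" "j - 1"] dB[of x N] simplicial_identities(5)[OF B, of x m i j] x that
          by simp
        ultimately obtain y where "y \<in> simplices P (Suc N)" "e (Suc N) y = v (Suc N) x"
          "\<forall>i\<le>Suc N. face P N i y = F N (face B N i x)"
          using trivial_fibration_filler[OF e sset_mapD(1)[OF v x], of "\<lambda>i. F N (face B N i x)"] by blast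
        with nondeg False show ?thesis by (intro exI[of _ y]) auto
      qed
    qed
    then obtain g where g: "\<And>x. x \<in> simplices B (Suc N) \<Longrightarrow> g x \<in> simplices P (Suc N) \<and> e (Suc N) (g x) = v (Suc N) x \<and>
        (x \<in> A (Suc N) \<longrightarrow> g x = u (Suc N) x) \<and> (\<forall>i\<le>Suc N. F N (face B N i x) = face P N i (g x)) \<and>
        (\<forall>z\<in>simplices B N. \<forall>i\<le>N. x = degen B N i z \<longrightarrow> g x = degen P N i (F N z))"
      by metis
    define G where "G = F(Suc N := g)"
    have "good (Suc N) G"
      unfolding good_def
    proof (intro conjI allI impI ballI)
      fix n x assume nx: "n \<le> Suc N" "x \<in> simplices B n"
      show "G n x \<in> simplices P n" "e n (G n x) = v n x"
        using nx g F[of n x] by (auto simp: G_def le_Suc_eq)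
      show "G n x = u n x" if "x \<in> A n"
        using nx that g F[of n x] by (auto simp: G_def le_Suc_eq)
    next
      fix n x i assume nx: "n < Suc N" "x \<in> simplices B (Suc n)" "i \<le> Suc n"
      show "G n (face B n i x) = face P n i (G (Suc n) x)"
        using nx g[of x] F_face[of n x i] by (cases "n = N") (auto simp: G_def)
    next
      fix n x i assume nx: "n < Suc N" "x \<in> simplices B n" "i \<le> n"
      show "G (Suc n) (degen B n i x) = degen P n i (G n x)"
        using nx g[of "degen B N i x"] sB[OF nx(2,3)] F_degen[of n x i] by (cases "n = N") (auto simp: G_def)
    qed
    moreover have "\<forall>n\<le>N. G n = F n" by (simp add: G_def)
    ultimately show ?thesis by blast
  qed
  obtain \<F> where \<F>: "\<And>N. good N (\<F> N)" "\<And>N n. n \<le> N \<Longrightarrow> \<F> (Suc N) n = \<F> N n"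
    using dependent_nat_choice[of good "\<lambda>N F G. \<forall>n\<le>N. G n = F n"] base step by metis
  define F where "F n = \<F> n n" for n
  have stable: "\<F> N n = F n" if "n \<le> N" for N n
    using that by (induction N rule: dec_induct) (simp_all add: F_def \<F>(2))
  have F: "good N F" for N
    using \<F>(1)[of N] unfolding good_def by (simp add: stable)
  have "sset_map B P F"
    using F unfolding good_def by (intro sset_mapI_generators[OF B P]) (meson lessI order_refl)+
  moreover have "e n (F n x) = v n x" "x \<in> A n \<Longrightarrow> F n x = u n x" if "x \<in> simplices B n" for n x
    using F[of n] that unfolding good_def by blast+
  ultimately show ?thesis
    using A(1) by blast
qed

text \<open>A section is a lift of the identity. The homotopy to the identity is a lift of the constant homotopy of
  the projection, prescribed on both ends of the prism and over the base point.\<close>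

lemma trivial_fibration_homotopy_inverse:
  assumes P: "reduced_sset P" and L: "simplicial_set L" and e: "trivial_fibration P L e"
  shows "\<exists>s H. sset_map L P s \<and> (\<forall>n. \<forall>y\<in>simplices L n. e n (s n y) = y) \<and>
    simplicial_homotopy P P (\<lambda>n x. s n (e n x)) (\<lambda>n x. x) H"
proof -
  note P' = reduced_ssetD(1)[OF P]
  have e_map: "sset_map P L e" using e by (simp add: trivial_fibration_def)
  have "sset_map L L (\<lambda>n y. y)" by (simp add: sset_map_def)
  from trivial_fibration_lift[OF L P' e this, of "\<lambda>_. {}" "\<lambda>_. undefined"]
  obtain s where s: "sset_map L P s" "\<And>n y. y \<in> simplices L n \<Longrightarrow> e n (s n y) = y" by auto
  obtain b where b: "simplices P 0 = {b}" using P unfolding reduced_sset_def by blast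
  define pt where "pt n = act P 0 n (const_map n 0)  b" for n
  have c0: "const_map n 0 \<in> Delta n 0" for n by (rule DeltaI) auto
  have bP: "b \<in> simplices P 0" using b by simp
  have pt: "pt n \<in> simplices P n" for n
    unfolding pt_def using simplicial_setD(1)[OF P' bP c0] .
  have act_pt: "act P n m \<theta> (pt n) = pt m" if "\<theta> \<in> Delta m n" for n m \<theta>
    unfolding pt_def using that DeltaD(2)[OF that] c0 by (intro act_act_eq1[OF P' bP]) auto
  have se: "sset_map P P (\<lambda>n x. s n (e n x))"
    using s(1) e_map unfolding sset_map_def by auto
  have se_pt: "s n (e n (pt n)) = pt n" for n
    unfolding pt_def using sset_mapD(1)[OF se bP] sset_mapD(2)[OF se bP, where \<theta> = "const_map n 0"] c0 b by simp
  \<comment> \<open>The two ends of the prism together with the prism over the base point.\<close>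
  define A where "A n = {(x, \<alpha>). x \<in> simplices P n \<and> \<alpha> \<in> Delta n 1 \<and> (\<alpha> = const_map n 0 \<or> \<alpha> = const_map n 1 \<or> x = pt n)}" for n
  define u where "u n = (\<lambda>(x, \<alpha>). if \<alpha> = const_map n 0 then s n (e n x) else x)" for n
  have comp_const: "compose {..m} (const_map n c) \<theta> = const_map m c" if "\<theta> \<in> Delta m n" for m n \<theta> and c :: nat
    using DeltaD(2)[OF that] by (auto simp: compose_def restrict_def)
  have const01: "const_map n 0 \<noteq> const_map n 1" for n
  proof
    assume "const_map n 0 = const_map n (1 :: nat)"
    from fun_cong[OF this, of 0] show False by simp
  qed
  have v: "sset_map (prism P) L (\<lambda>n (x, \<alpha>). e n x)"
    using e_map unfolding sset_map_def by auto
  have "\<exists>H. sset_map (prism P) P H \<and> (\<forall>n. \<forall>x\<in>simplices (prism P) n. e n (H n x) = (case x of (x, \<alpha>) \<Rightarrow> e n x)) \<and>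
      (\<forall>n. \<forall>x\<in>A n. H n x = u n x)"
  proof (rule trivial_fibration_lift[OF simplicial_set_prism[OF P'] P' e v])
    fix n x assume x: "x \<in> A n"
    then show "x \<in> simplices (prism P) n" by (auto simp: A_def)
    show "u n x \<in> simplices P n \<and> e n (u n x) = (case x of (x, \<alpha>) \<Rightarrow> e n x)"
      using x sset_mapD(1)[OF se] sset_mapD(1)[OF e_map] s(2) by (auto simp: A_def u_def)
    fix m \<theta> assume \<theta>: "\<theta> \<in> Delta m n"
    show "act (prism P) n m \<theta> x \<in> A m"
      using x \<theta> by (auto simp: A_def simplicial_setD(1)[OF P'] Delta_compose comp_const act_pt pt)
    show "u m (act (prism P) n m \<theta> x) = act P n m \<theta> (u n x)"
    proof (cases x)
      case (Pair y \<alpha>)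
      then consider "\<alpha> = const_map n 0" | "\<alpha> = const_map n 1" | "y = pt n" using x by (auto simp: A_def)
      then show ?thesis
      proof cases
        case 1
        then show ?thesis
          using x Pair \<theta> sset_mapD(2)[OF se] by (auto simp: A_def u_def comp_const)
      next
        case 2
        then show ?thesis
          using x Pair \<theta> const01[of n] const01[of m] by (auto simp: A_def u_def comp_const)
      next
        case 3
        then show ?thesis
          using Pair \<theta> by (auto simp: u_def act_pt se_pt)
      qed
    qed
  qed
  then obtain H where H: "sset_map (prism P) P H" "\<And>n x. x \<in> A n \<Longrightarrow> H n x = u n x" by blast
  have "simplicial_homotopy P P (\<lambda>n x. s n (e n x)) (\<lambda>n x. x) H"
    unfolding simplicial_homotopy_def
  proof (intro conjI allI ballI H(1))
    fix n x assume "x \<in> simplices P n"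
    then show "H n (x, const_map n 0) = s n (e n x)" "H n (x, const_map n 1) = x"
      using const01[of n] by (simp_all add: H(2) A_def u_def)
  next
    fix x assume "x \<in> simplices P 0"
    then have xb: "x = b" using b by simp
    have cg: "codegen 0 0 = const_map 1 0" by (auto simp: codegen_def)
    have "step_map 1 0 \<noteq> const_map 1 0"
    proof
      assume "step_map 1 0 = const_map 1 0"
      from fun_cong[OF this, of 1] show False by simp
    qed
    then have "H 1 (act P 0 1 (codegen 0 0) x, step_map 1 0) = act P 0 1 (codegen 0 0) x"
      using pt[of 1] unfolding cg xb pt_def[symmetric] by (simp add: H(2) A_def u_def)
    then show "degenerate P 1 (H 1 (act P 0 1 (codegen 0 0) x, step_map 1 0))"
      unfolding degenerate_def using \<open>x \<in> simplices P 0\<close> by auto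
  qed
  with s show ?thesis by blast
qed

section \<open>Lifting problems for a simplex and its boundary\<close>

lemma continuous_map_compose_on:
  assumes "continuous_map (top_of_set S) Y f" "continuous_on T \<phi>" "\<And>x. x \<in> T \<Longrightarrow> \<phi> x \<in> S"
  shows "continuous_map (top_of_set T) Y (\<lambda>x. f (\<phi> x))"
proof -
  have "continuous_map (top_of_set T) (top_of_set S) \<phi>"
    using assms by (auto simp: continuous_map_in_subtopology)
  from continuous_map_compose[OF this assms(1)] show ?thesis
    by (simp add: o_def)
qed

lemma continuous_map_top_of_set_cong:
  assumes "continuous_map (top_of_set S) Y f" "\<And>x. x \<in> S \<Longrightarrow> f x = h x"
  shows "continuous_map (top_of_set S) Y h"
  using continuous_map_eq[OF assms(1)] assms(2) by simp

lemma continuous_map_paste_le: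
  fixes p :: "'x::topological_space \<Rightarrow> real"
  assumes "continuous_on S p"
    and "continuous_map (top_of_set {x \<in> S. p x \<le> c}) Y f" "continuous_map (top_of_set {x \<in> S. c \<le> p x}) Y h"
    and "\<And>x. x \<in> S \<Longrightarrow> p x = c \<Longrightarrow> f x = h x"
  shows "continuous_map (top_of_set S) Y (\<lambda>x. if p x \<le> c then f x else h x)"
proof (rule continuous_map_cases_le)
  have "S \<inter> {x. x \<in> topspace (top_of_set S) \<and> p x \<le> c} = {x \<in> S. p x \<le> c}"
    "S \<inter> {x. x \<in> topspace (top_of_set S) \<and> c \<le> p x} = {x \<in> S. c \<le> p x}" by auto
  then show "continuous_map (subtopology (top_of_set S) {x \<in> topspace (top_of_set S). p x \<le> c}) Y f"
    "continuous_map (subtopology (top_of_set S) {x \<in> topspace (top_of_set S). c \<le> p x}) Y h"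
    using assms by (simp_all add: subtopology_subtopology)
qed (use assms in \<open>auto simp: continuous_map_in_subtopology\<close>)

definition simplex_boundary :: "nat \<Rightarrow> (nat \<Rightarrow> real) set" where
  "simplex_boundary n = {x \<in> standard_simplex n. \<exists>i\<le>n. x i = 0}"

primrec min_coord :: "nat \<Rightarrow> (nat \<Rightarrow> real) \<Rightarrow> real" where
  "min_coord 0 x = x 0"
| "min_coord (Suc n) x = min (min_coord n x) (x (Suc n))"

lemma min_coord_le: "i \<le> n \<Longrightarrow> min_coord n x \<le> x i"
  by (induction n) (auto simp: le_Suc_eq min_le_iff_disj)

lemma min_coord_attained: "\<exists>i\<le>n. min_coord n x = x i"
proof (induction n)
  case (Suc n)
  then show ?case
    by (metis le_SucI le_refl min_coord.simps(2) min_def)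
qed simp

lemma min_coord_affine:
  assumes "a \<ge> 0" "\<And>i. i \<le> n \<Longrightarrow> y i = a * x i + c"
  shows "min_coord n y = a * min_coord n x + c"
  using assms(2)
proof (induction n)
  case (Suc n)
  then have "min_coord n y = a * min_coord n x + c" by simp
  moreover have "min (a * u + c) (a * v + c) = a * min u v + c" for u v
    using mult_left_mono[of u v a] mult_left_mono[of v u a] assms(1) by (auto simp: min_def)
  ultimately show ?case using Suc by simp
qed simp

lemma continuous_on_min_coord [continuous_intros]:
  assumes "continuous_on S f"
  shows "continuous_on S (\<lambda>x. min_coord n (f x))"
proof (induction n)
  case 0
  then show ?case using continuous_on_product_then_coordinatewise[OF assms] by simp
next
  case (Suc n)
  then show ?case using continuous_on_product_then_coordinatewise[OF assms]
    by (simp add: continuous_on_min)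
qed

text \<open>The depth of a point is its height over the boundary in the cone with the barycentre as apex.\<close>

definition depth :: "nat \<Rightarrow> (nat \<Rightarrow> real) \<Rightarrow> real" where
  "depth n x = real (Suc n) * min_coord n x"

definition collar :: "nat \<Rightarrow> (nat \<Rightarrow> real) \<Rightarrow> real" where
  "collar n x = min (depth n x) (1 / 2)"

text \<open>The outer half of the simplex is projected radially to the boundary and the inner half is blown up to the
  whole simplex.\<close>

definition collapse :: "nat \<Rightarrow> (nat \<Rightarrow> real) \<Rightarrow> nat \<Rightarrow> real" where
  "collapse n x = (\<lambda>i. if i \<le> n then (x i - collar n x / real (Suc n)) / (1 - collar n x) else 0)"

text \<open>The homothety with the barycentre as centre and ratio \<open>1 - c\<close>.\<close>

definition shrink :: "nat \<Rightarrow> real \<Rightarrow> (nat \<Rightarrow> real) \<Rightarrow> nat \<Rightarrow> real" where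
  "shrink n c x = (\<lambda>i. if i \<le> n then (1 - c) * x i + c / real (Suc n) else 0)"

lemma standard_simplexD:
  assumes "x \<in> standard_simplex n"
  shows "0 \<le> x i" "x i \<le> 1" "i > n \<Longrightarrow> x i = 0" "(\<Sum>i\<le>n. x i) = 1"
  using assms by (auto simp: standard_simplex_def)

lemma standard_simplexI:
  assumes "\<And>i. i \<le> n \<Longrightarrow> 0 \<le> x i" "\<And>i. i > n \<Longrightarrow> x i = 0" "(\<Sum>i\<le>n. x i) = 1"
  shows "x \<in> standard_simplex n"
proof -
  have "0 \<le> x i" for i using assms(1,2) by (cases "i \<le> n") auto
  moreover have "x i \<le> 1" for i
  proof (cases "i \<le> n")
    case True
    then have "x i \<le> (\<Sum>i\<le>n. x i)" using assms(1) by (intro member_le_sum) auto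
    then show ?thesis using assms(3) by simp
  qed (simp add: assms(2))
  ultimately show ?thesis using assms by (auto simp: standard_simplex_def)
qed

lemma depth_bounds:
  assumes "x \<in> standard_simplex n"
  shows "0 \<le> depth n x" "depth n x \<le> 1"
proof -
  obtain i where "min_coord n x = x i" using min_coord_attained by blast
  then show "0 \<le> depth n x" using standard_simplexD(1)[OF assms] by (simp add: depth_def)
  have "real (Suc n) * min_coord n x = (\<Sum>i\<le>n. min_coord n x)" by simp
  also have "\<dots> \<le> (\<Sum>i\<le>n. x i)" by (intro sum_mono min_coord_le) simp
  finally show "depth n x \<le> 1" using standard_simplexD(4)[OF assms] by (simp add: depth_def)
qed

lemma depth_boundary: "x \<in> simplex_boundary n \<Longrightarrow> depth n x = 0"
proof -
  assume x: "x \<in> simplex_boundary n"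
  then obtain i where "i \<le> n" "x i = 0" by (auto simp: simplex_boundary_def)
  then have "depth n x \<le> 0" using min_coord_le[of i n x] by (simp add: depth_def mult_le_0_iff)
  with x depth_bounds(1)[of x n] show ?thesis by (auto simp: simplex_boundary_def)
qed

lemma collar_bounds:
  assumes "x \<in> standard_simplex n"
  shows "0 \<le> collar n x" "collar n x \<le> 1 / 2" "2 * collar n x \<le> 1"
  using depth_bounds[OF assms] by (auto simp: collar_def)

lemma collar_boundary: "x \<in> simplex_boundary n \<Longrightarrow> collar n x = 0"
  by (simp add: collar_def depth_boundary)

lemma collapse_in_simplex:
  assumes x: "x \<in> standard_simplex n"
  shows "collapse n x \<in> standard_simplex n"
proof (rule standard_simplexI)
  note b = collar_bounds[OF x]
  fix i assume "i \<le> n"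
  then have "collar n x / real (Suc n) \<le> x i"
    using min_coord_le[of i n x] by (simp add: collar_def depth_def divide_le_eq mult.commute min_le_iff_disj mult_right_mono)
  then show "0 \<le> collapse n x i" using b by (simp add: collapse_def)
next
  note b = collar_bounds[OF x]
  have "(\<Sum>i\<le>n. collapse n x i) = (\<Sum>i\<le>n. x i - collar n x / real (Suc n)) / (1 - collar n x)"
    by (simp add: collapse_def sum_divide_distrib)
  also have "(\<Sum>i\<le>n. x i - collar n x / real (Suc n)) = 1 - collar n x"
    using standard_simplexD(4)[OF x] by (simp add: sum_subtractf)
  finally show "(\<Sum>i\<le>n. collapse n x i) = 1" using b by simp
qed (simp add: collapse_def)

lemma collapse_in_boundary:
  assumes x: "x \<in> standard_simplex n" and d: "depth n x \<le> 1 / 2"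
  shows "collapse n x \<in> simplex_boundary n"
proof -
  obtain i where i: "i \<le> n" "min_coord n x = x i" using min_coord_attained by blast
  then have "collapse n x i = 0"
    using d by (simp add: collapse_def collar_def depth_def)
  with collapse_in_simplex[OF x] i show ?thesis by (auto simp: simplex_boundary_def)
qed

lemma collapse_boundary:
  assumes x: "x \<in> simplex_boundary n"
  shows "collapse n x = x"
  using x standard_simplexD(3)[of x n] by (auto simp: collapse_def collar_boundary simplex_boundary_def fun_eq_iff)

lemma shrink_in_simplex:
  assumes x: "x \<in> standard_simplex n" and c: "0 \<le> c" "c \<le> 1"
  shows "shrink n c x \<in> standard_simplex n"
proof (rule standard_simplexI)
  fix i assume "i \<le> n"
  then show "0 \<le> shrink n c x i"
    using c standard_simplexD(1)[OF x] by (simp add: shrink_def)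
next
  have "(\<Sum>i\<le>n. shrink n c x i) = (1 - c) * (\<Sum>i\<le>n. x i) + c"
    by (simp add: shrink_def sum.distrib sum_distrib_left)
  then show "(\<Sum>i\<le>n. shrink n c x i) = 1" by (simp add: standard_simplexD(4)[OF x])
qed (simp add: shrink_def)

lemma depth_shrink:
  assumes "c \<le> 1"
  shows "depth n (shrink n c x) = (1 - c) * depth n x + c"
proof -
  have "min_coord n (shrink n c x) = (1 - c) * min_coord n x + c / real (Suc n)"
    using assms by (intro min_coord_affine) (auto simp: shrink_def)
  then show ?thesis by (simp add: depth_def field_simps)
qed

lemma collapse_shrink:
  assumes x: "x \<in> standard_simplex n" and c: "c \<le> 1 / 2" "collar n (shrink n c x) = c"
  shows "collapse n (shrink n c x) = x"
  unfolding collapse_def c(2)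
  using standard_simplexD(3)[OF x] c(1) by (auto simp: shrink_def fun_eq_iff)

lemma collapse_shrink_half:
  assumes x: "x \<in> standard_simplex n"
  shows "collar n (shrink n (1 / 2) x) = 1 / 2" "collapse n (shrink n (1 / 2) x) = x"
proof -
  show c: "collar n (shrink n (1 / 2) x) = 1 / 2"
    using depth_bounds[OF x] by (simp add: collar_def depth_shrink)
  then show "collapse n (shrink n (1 / 2) x) = x"
    using x by (intro collapse_shrink) auto
qed

lemma collapse_shrink_boundary:
  assumes x: "x \<in> simplex_boundary n" and c: "0 \<le> c" "c \<le> 1 / 2"
  shows "collar n (shrink n c x) = c" "collapse n (shrink n c x) = x"
proof -
  show e: "collar n (shrink n c x) = c"
    using c by (simp add: collar_def depth_shrink depth_boundary[OF x])
  then show "collapse n (shrink n c x) = x"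
    using x c by (intro collapse_shrink) (auto simp: simplex_boundary_def)
qed

lemma continuous_on_coord [continuous_intros]:
  "continuous_on S (\<lambda>x. x (i :: nat) :: real)" "continuous_on T (\<lambda>p. fst p (i :: nat) :: real)"
  "continuous_on T' (\<lambda>p. snd p (i :: nat) :: real)"
  by (rule continuous_on_product_then_coordinatewise, intro continuous_intros)+

lemma continuous_on_depth [continuous_intros]: "continuous_on S f \<Longrightarrow> continuous_on S (\<lambda>x. depth n (f x))"
  unfolding depth_def by (intro continuous_on_mult continuous_on_const continuous_on_min_coord)

lemma continuous_on_collar [continuous_intros]: "continuous_on S f \<Longrightarrow> continuous_on S (\<lambda>x. collar n (f x))"
  unfolding collar_def by (intro continuous_on_min continuous_on_const continuous_on_depth)

lemma continuous_on_collapse [continuous_intros]: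
  assumes "continuous_on S f" "\<And>x. x \<in> S \<Longrightarrow> f x \<in> standard_simplex n"
  shows "continuous_on S (\<lambda>x. collapse n (f x) i)" "continuous_on S (\<lambda>x. collapse n (f x))"
proof -
  have ne: "1 - collar n (f x) \<noteq> 0" if "x \<in> S" for x
    using collar_bounds[OF assms(2)[OF that]] by simp
  show *: "continuous_on S (\<lambda>x. collapse n (f x) i)" for i
    unfolding collapse_def using ne
    by (cases "i \<le> n") (auto intro!: continuous_intros assms(1) continuous_on_product_then_coordinatewise[OF assms(1)])
  then show "continuous_on S (\<lambda>x. collapse n (f x))"
    by (rule continuous_on_coordinatewise_then_product)
qed

lemma continuous_on_shrink [continuous_intros]:
  assumes "continuous_on S f"
  shows "continuous_on S (\<lambda>x. shrink n c (f x) i)" "continuous_on S (\<lambda>x. shrink n c (f x))"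
proof -
  show *: "continuous_on S (\<lambda>x. shrink n c (f x) i)" for i
    unfolding shrink_def
    by (cases "i \<le> n") (auto intro!: continuous_intros continuous_on_product_then_coordinatewise[OF assms])
  then show "continuous_on S (\<lambda>x. shrink n c (f x))"
    by (rule continuous_on_coordinatewise_then_product)
qed

definition lid :: "nat \<Rightarrow> ((nat \<Rightarrow> real) \<times> real) set" where
  "lid n = {(x, s). x \<in> standard_simplex n \<and> 0 \<le> s \<and> s \<le> 1 \<and> (s = 1 \<or> x \<in> simplex_boundary n)}"

abbreviation cyl :: "nat \<Rightarrow> ((nat \<Rightarrow> real) \<times> real) set" where
  "cyl n \<equiv> standard_simplex n \<times> {0..1}"

text \<open>The filling problem for the end point map of the path fibration of \<open>g\<close>: the map \<open>w\<close> on the lid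
  consists of a simplex of the target and of paths over its boundary from the image of \<open>\<alpha>\<close> to it. A solution is a
  simplex of the source together with paths from its image to the given simplex.\<close>

definition solvable :: "nat \<Rightarrow> 'a topology \<Rightarrow> 'b topology \<Rightarrow> ('a \<Rightarrow> 'b) \<Rightarrow> ((nat \<Rightarrow> real) \<Rightarrow> 'a) \<Rightarrow> bool" where
  "solvable n X Y g \<alpha> \<longleftrightarrow>
     (\<forall>w. continuous_map (top_of_set (lid n)) Y w \<and> (\<forall>x\<in>simplex_boundary n. w (x, 0) = g (\<alpha> x)) \<longrightarrow>
       (\<exists>\<alpha>' W. continuous_map (top_of_set (standard_simplex n)) X \<alpha>' \<and> (\<forall>x\<in>simplex_boundary n. \<alpha>' x = \<alpha> x) \<and>
          continuous_map (top_of_set (cyl n)) Y W \<and> (\<forall>p\<in>lid n. W p = w p) \<and>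
          (\<forall>x\<in>standard_simplex n. W (x, 0) = g (\<alpha>' x))))"

text \<open>The filling problem with constant paths over the boundary, with a solution that keeps them constant.\<close>

definition strictly_solvable :: "nat \<Rightarrow> 'a topology \<Rightarrow> 'b topology \<Rightarrow> ('a \<Rightarrow> 'b) \<Rightarrow> ((nat \<Rightarrow> real) \<Rightarrow> 'a) \<Rightarrow> bool" where
  "strictly_solvable n X Y g \<alpha> \<longleftrightarrow>
     (\<forall>v. continuous_map (top_of_set (standard_simplex n)) Y v \<and> (\<forall>x\<in>simplex_boundary n. v x = g (\<alpha> x)) \<longrightarrow>
       (\<exists>\<alpha>' K. continuous_map (top_of_set (standard_simplex n)) X \<alpha>' \<and> (\<forall>x\<in>simplex_boundary n. \<alpha>' x = \<alpha> x) \<and>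
          continuous_map (top_of_set (cyl n)) Y K \<and>
          (\<forall>x\<in>standard_simplex n. K (x, 0) = g (\<alpha>' x) \<and> K (x, 1) = v x) \<and>
          (\<forall>x\<in>simplex_boundary n. \<forall>s\<in>{0..1}. K (x, s) = g (\<alpha> x))))"

lemma boundary_subset: "x \<in> simplex_boundary n \<Longrightarrow> x \<in> standard_simplex n"
  by (simp add: simplex_boundary_def)

lemma convex_combination_in_simplex:
  assumes "x \<in> standard_simplex n" "y \<in> standard_simplex n" "0 \<le> s" "s \<le> 1"
  shows "(\<lambda>i. (1 - s) * x i + s * y i) \<in> standard_simplex n"
  using convex_standard_simplex[OF assms] .

text \<open>The map on the lid is spread over a single simplex, with the walls in the collar. After a strict
  solution for this simplex the cylinder is sent to itself such that its lid unfolds to the top of the target.\<close>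

lemma solvable_if_strictly_solvable:
  assumes "strictly_solvable n X Y g \<alpha>"
  shows "solvable n X Y g \<alpha>"
  unfolding solvable_def
proof (intro allI impI, elim conjE)
  fix w assume w: "continuous_map (top_of_set (lid n)) Y w" "\<forall>x\<in>simplex_boundary n. w (x, 0) = g (\<alpha> x)"
  let ?D = "standard_simplex n" and ?B = "simplex_boundary n"
  define v where "v x = w (collapse n x, 2 * collar n x)" for x
  have in_lid: "(collapse n x, 2 * collar n x) \<in> lid n" if x: "x \<in> ?D" for x
    using collapse_in_simplex[OF x] collapse_in_boundary[OF x] collar_bounds[OF x]
    by (cases "depth n x \<le> 1 / 2") (auto simp: lid_def collar_def)
  have v: "continuous_map (top_of_set ?D) Y v"
    unfolding v_def by (rule continuous_map_compose_on[OF w(1)]) (auto intro!: continuous_intros in_lid)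
  have "\<forall>x\<in>?B. v x = g (\<alpha> x)"
    using w(2) by (simp add: v_def collapse_boundary collar_boundary)
  with v assms obtain \<beta> K where \<beta>: "continuous_map (top_of_set ?D) X \<beta>" "\<forall>x\<in>?B. \<beta> x = \<alpha> x"
    and K: "continuous_map (top_of_set (cyl n)) Y K" "\<forall>x\<in>?D. K (x, 0) = g (\<beta> x) \<and> K (x, 1) = v x"
      "\<forall>x\<in>?B. \<forall>s\<in>{0..1}. K (x, s) = g (\<alpha> x)"
    unfolding strictly_solvable_def by blast
  \<comment> \<open>At height 0 the collar is folded up onto the walls and the rest is stretched over the floor; at
    height 1 the simplex is shrunk onto the inner half of the ceiling. The linear interpolation leads the
    walls over the collar of the ceiling.\<close>
  define \<Theta> where "\<Theta> = (\<lambda>(x, s). (\<lambda>i. (1 - s) * collapse n x i + s * shrink n (1 / 2) x i, (1 - s) * (1 - 2 * collar n x) + s))"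
  have \<Theta>: "\<Theta> p \<in> cyl n" if "p \<in> cyl n" for p
  proof -
    from that obtain x s where p: "p = (x, s)" "x \<in> ?D" "0 \<le> s" "s \<le> 1" by auto
    have "0 \<le> (1 - s) * (1 - 2 * collar n x)" "(1 - s) * (1 - 2 * collar n x) \<le> 1 - s"
      using collar_bounds[OF p(2)] p by (simp_all add: mult_left_le)
    then show ?thesis
      using convex_combination_in_simplex[OF collapse_in_simplex[OF p(2)] shrink_in_simplex[OF p(2), of "1 / 2"] p(3,4)] p
      by (simp add: \<Theta>_def)
  qed
  have \<Theta>_cont: "continuous_on (cyl n) \<Theta>"
    unfolding \<Theta>_def case_prod_unfold
    by (intro continuous_intros continuous_on_coordinatewise_then_product) auto
  have 1: "continuous_map (top_of_set ?D) X (\<lambda>x. \<beta> (collapse n x))"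
    by (rule continuous_map_compose_on[OF \<beta>(1)]) (auto intro!: continuous_intros collapse_in_simplex)
  have 2: "\<forall>x\<in>?B. \<beta> (collapse n x) = \<alpha> x"
    using \<beta>(2) by (simp add: collapse_boundary)
  have 3: "continuous_map (top_of_set (cyl n)) Y (\<lambda>p. K (\<Theta> p))"
    by (rule continuous_map_compose_on[OF K(1) \<Theta>_cont \<Theta>])
  have 4: "K (\<Theta> p) = w p" if "p \<in> lid n" for p
  proof -
    from that obtain x s where p: "p = (x, s)" "x \<in> ?D" "0 \<le> s" "s \<le> 1" "s = 1 \<or> x \<in> ?B"
      by (auto simp: lid_def)
    show ?thesis
    proof (cases "s = 1")
      case True
      have "K (\<Theta> p) = v (shrink n (1 / 2) x)"
        using K(2) shrink_in_simplex[OF p(2), of "1 / 2"] True by (simp add: \<Theta>_def p)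
      then show ?thesis using True by (simp add: v_def collapse_shrink_half[OF p(2)] p)
    next
      case False
      then have x: "x \<in> ?B" using p by simp
      have "(\<lambda>i. (1 - s) * x i + s * shrink n (1 / 2) x i) = shrink n (s / 2) x"
        using standard_simplexD(3)[OF p(2)] by (auto simp: shrink_def fun_eq_iff field_simps)
      then have "K (\<Theta> p) = v (shrink n (s / 2) x)"
        using K(2) shrink_in_simplex[OF p(2), of "s / 2"] p
        by (simp add: \<Theta>_def collapse_boundary[OF x] collar_boundary[OF x])
      then show ?thesis
        using collapse_shrink_boundary[OF x, of "s / 2"] p by (simp add: v_def)
    qed
  qed
  have 5: "K (\<Theta> (x, 0)) = g (\<beta> (collapse n x))" if x: "x \<in> ?D" for x
  proof (cases "depth n x \<le> 1 / 2")
    case True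
    then show ?thesis
      using K(3) \<beta>(2) collapse_in_boundary[OF x] collar_bounds[OF x] by (simp add: \<Theta>_def)
  next
    case False
    then have "2 * collar n x = 1" by (simp add: collar_def)
    then show ?thesis using K(2) collapse_in_simplex[OF x] by (simp add: \<Theta>_def)
  qed
  show "\<exists>\<alpha>' W. continuous_map (top_of_set ?D) X \<alpha>' \<and> (\<forall>x\<in>?B. \<alpha>' x = \<alpha> x) \<and>
      continuous_map (top_of_set (cyl n)) Y W \<and> (\<forall>p\<in>lid n. W p = w p) \<and> (\<forall>x\<in>?D. W (x, 0) = g (\<alpha>' x))"
    using 1 2 3 4 5 by (intro exI[of _ "\<lambda>x. \<beta> (collapse n x)"] exI[of _ "\<lambda>p. K (\<Theta> p)"]) blast
qed

text \<open>A filling problem for one end of the homotopy becomes a problem for the other end when the image of the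
  homotopy is attached below the walls. In the solution the homotopy itself is inserted in the collar.\<close>

lemma solvable_homotopy:
  assumes h: "continuous_map (top_of_set (simplex_boundary n \<times> {0..1})) X h" and g: "continuous_map X Y g"
    and solv: "solvable n X Y g (\<lambda>x. h (x, 1 :: real))"
  shows "solvable n X Y g (\<lambda>x. h (x, 0))"
  unfolding solvable_def
proof (intro allI impI, elim conjE)
  fix w assume w: "continuous_map (top_of_set (lid n)) Y w" "\<forall>x\<in>simplex_boundary n. w (x, 0) = g (h (x, 0))"
  let ?D = "standard_simplex n" and ?B = "simplex_boundary n"
  define w1 where "w1 p = (if snd p \<le> 1 / 2 then g (h (fst p, 1 - 2 * snd p)) else w (fst p, 2 * snd p - 1))" for p
  have gh: "continuous_map (top_of_set (?B \<times> {0..1})) Y (\<lambda>p. g (h p))"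
    using continuous_map_compose[OF h g] by (simp add: o_def)
  have w1: "continuous_map (top_of_set (lid n)) Y w1"
    unfolding w1_def
  proof (rule continuous_map_paste_le)
    show "continuous_map (top_of_set {x \<in> lid n. snd x \<le> 1 / 2}) Y (\<lambda>p. g (h (fst p, 1 - 2 * snd p)))"
      by (rule continuous_map_compose_on[OF gh]) (auto intro!: continuous_intros simp: lid_def)
    show "continuous_map (top_of_set {x \<in> lid n. 1 / 2 \<le> snd x}) Y (\<lambda>p. w (fst p, 2 * snd p - 1))"
      by (rule continuous_map_compose_on[OF w(1)]) (auto intro!: continuous_intros simp: lid_def)
    show "g (h (fst p, 1 - 2 * snd p)) = w (fst p, 2 * snd p - 1)" if "p \<in> lid n" "snd p = 1 / 2" for p
    proof -
      have "1 - 2 * snd p = 0" "2 * snd p - 1 = 0" using that(2) by simp_all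
      moreover have "fst p \<in> ?B" using that by (auto simp: lid_def)
      ultimately show ?thesis using w(2) by simp
    qed
  qed (intro continuous_intros)
  have "\<forall>x\<in>?B. w1 (x, 0) = g (h (x, 1))" by (simp add: w1_def)
  with w1 solv obtain \<beta> W where \<beta>: "continuous_map (top_of_set ?D) X \<beta>" "\<forall>x\<in>?B. \<beta> x = h (x, 1)"
    and W: "continuous_map (top_of_set (cyl n)) Y W" "\<forall>p\<in>lid n. W p = w1 p" "\<forall>x\<in>?D. W (x, 0) = g (\<beta> x)"
    unfolding solvable_def by blast
  define \<alpha>' where "\<alpha>' x = (if depth n x \<le> 1 / 2 then h (collapse n x, 2 * collar n x) else \<beta> (collapse n x))" for x
  \<comment> \<open>At height 0 the collar is folded up onto the lower half of the walls, where the image of the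
    homotopy was attached; the walls are squeezed onto their upper half.\<close>
  define \<Theta> where "\<Theta> = (\<lambda>(x, s). (\<lambda>i. (1 - s) * collapse n x i + s * x i, (1 - s) * ((1 - 2 * collar n x) / 2) + s))"
  have \<alpha>': "continuous_map (top_of_set ?D) X \<alpha>'"
    unfolding \<alpha>'_def
  proof (rule continuous_map_paste_le)
    show "continuous_map (top_of_set {x \<in> ?D. depth n x \<le> 1 / 2}) X (\<lambda>x. h (collapse n x, 2 * collar n x))"
      by (rule continuous_map_compose_on[OF h])
         (use collar_bounds[of _ n] in \<open>auto intro!: continuous_intros collapse_in_boundary\<close>)
    show "continuous_map (top_of_set {x \<in> ?D. 1 / 2 \<le> depth n x}) X (\<lambda>x. \<beta> (collapse n x))"
      by (rule continuous_map_compose_on[OF \<beta>(1)]) (auto intro!: continuous_intros collapse_in_simplex)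
    show "h (collapse n x, 2 * collar n x) = \<beta> (collapse n x)" if "x \<in> ?D" "depth n x = 1 / 2" for x
    proof -
      have "2 * collar n x = 1" using that(2) by (simp add: collar_def)
      then show ?thesis using that \<beta>(2) collapse_in_boundary[of x n] by simp
    qed
  qed (intro continuous_intros)
  have \<Theta>: "\<Theta> p \<in> cyl n" if "p \<in> cyl n" for p
  proof -
    from that obtain x s where p: "p = (x, s)" "x \<in> ?D" "0 \<le> s" "s \<le> 1" by auto
    have "(1 - s) * ((1 - 2 * collar n x) / 2) \<le> (1 - s) * 1"
      using collar_bounds[OF p(2)] p by (intro mult_left_mono) auto
    moreover have "0 \<le> (1 - s) * ((1 - 2 * collar n x) / 2)"
      using collar_bounds[OF p(2)] p by simp
    ultimately show ?thesis
      using convex_combination_in_simplex[OF collapse_in_simplex[OF p(2)] p(2) p(3,4)] p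
      by (simp add: \<Theta>_def)
  qed
  have \<Theta>_cont: "continuous_on (cyl n) \<Theta>"
    unfolding \<Theta>_def case_prod_unfold
    by (intro continuous_intros continuous_on_coordinatewise_then_product) auto
  have 2: "\<forall>x\<in>?B. \<alpha>' x = h (x, 0)"
    by (simp add: \<alpha>'_def collapse_boundary collar_boundary depth_boundary)
  have 3: "continuous_map (top_of_set (cyl n)) Y (\<lambda>p. W (\<Theta> p))"
    by (rule continuous_map_compose_on[OF W(1) \<Theta>_cont \<Theta>])
  have 4: "W (\<Theta> p) = w p" if "p \<in> lid n" for p
  proof -
    from that obtain x s where p: "p = (x, s)" "x \<in> ?D" "0 \<le> s" "s \<le> 1" "s = 1 \<or> x \<in> ?B"
      by (auto simp: lid_def)
    have "\<Theta> p = (x, (1 + s) / 2)"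
      using p(5)
    proof
      assume x: "x \<in> ?B"
      have "(\<lambda>i. (1 - s) * x i + s * x i) = x" by (simp add: fun_eq_iff algebra_simps)
      then show ?thesis by (simp add: \<Theta>_def p collapse_boundary[OF x] collar_boundary[OF x] field_simps)
    qed (simp add: \<Theta>_def p)
    moreover have "(x, (1 + s) / 2) \<in> lid n" using p by (auto simp: lid_def)
    ultimately have "W (\<Theta> p) = w1 (x, (1 + s) / 2)" using W(2) by simp
    also have "\<dots> = w p"
    proof (cases "s = 0")
      case False
      have "2 * ((1 + s) / 2) - 1 = s" "\<not> (1 + s) / 2 \<le> 1 / 2" using False p(3) by (auto simp: field_simps)
      then show ?thesis unfolding w1_def p(1) fst_conv snd_conv by simp
    qed (use w(2) p in \<open>auto simp: w1_def\<close>)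
    finally show ?thesis .
  qed
  have 5: "W (\<Theta> (x, 0)) = g (\<alpha>' x)" if x: "x \<in> ?D" for x
  proof (cases "depth n x \<le> 1 / 2")
    case True
    have cB: "collapse n x \<in> ?B" by (rule collapse_in_boundary[OF x True])
    then have "(collapse n x, (1 - 2 * collar n x) / 2) \<in> lid n"
      using collar_bounds[OF x] boundary_subset[OF cB] by (simp add: lid_def)
    then have "W (\<Theta> (x, 0)) = w1 (collapse n x, (1 - 2 * collar n x) / 2)"
      using W(2) by (simp add: \<Theta>_def)
    also have "\<dots> = g (h (collapse n x, 2 * collar n x))"
    proof -
      have "1 - 2 * ((1 - 2 * collar n x) / 2) = 2 * collar n x" "(1 - 2 * collar n x) / 2 \<le> 1 / 2"
        using collar_bounds[OF x] by (auto simp: field_simps)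
      then show ?thesis unfolding w1_def fst_conv snd_conv by simp
    qed
    finally show ?thesis using True by (simp add: \<alpha>'_def)
  next
    case False
    then have "2 * collar n x = 1" by (simp add: collar_def)
    then show ?thesis using W(3) collapse_in_simplex[OF x] False by (simp add: \<Theta>_def \<alpha>'_def)
  qed
  show "\<exists>\<alpha>' W. continuous_map (top_of_set ?D) X \<alpha>' \<and> (\<forall>x\<in>?B. \<alpha>' x = h (x, 0)) \<and>
      continuous_map (top_of_set (cyl n)) Y W \<and> (\<forall>p\<in>lid n. W p = w p) \<and> (\<forall>x\<in>?D. W (x, 0) = g (\<alpha>' x))"
    using \<alpha>' 2 3 4 5 by (intro exI[of _ \<alpha>'] exI[of _ "\<lambda>p. W (\<Theta> p)"]) blast
qed

section \<open>Pushing all faces but one to a vertex\<close>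

text \<open>A deformation of the boundary. The faces that contain the last vertex are contracted linearly to it:
  there \<open>m = 0\<close> and \<open>c = 1 - \<tau>\<close>. In the opposite face the points whose coordinates exceed
  \<open>\<tau> / (2 n)\<close> form a smaller simplex that is blown up from the barycentre to the whole face: there
  \<open>m = \<tau> / (2 n)\<close> and \<open>c = 1 / (1 - n m)\<close>. The remaining collar of this face is pushed over the
  other faces; its points have \<open>m\<close> as smallest coordinate and the factor \<open>c\<close> interpolates between
  the two regions.\<close>

definition push :: "nat \<Rightarrow> real \<Rightarrow> (nat \<Rightarrow> real) \<Rightarrow> nat \<Rightarrow> real" where
  "push n \<tau> x = (let m = min (min_coord (n - 1) x) (\<tau> / (2 * real n));
      c = (1 - 2 * real n * (\<tau> / (2 * real n) - m)) / (1 - real n * m)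
    in (\<lambda>i. if i < n then (x i - m) * c else if i = n then 1 - (1 - x n - n * m) * c else 0))"

lemma push_props:
  assumes n: "0 < n" and x: "x \<in> simplex_boundary n" and \<tau>: "0 \<le> \<tau>" "\<tau> \<le> 1"
  shows "push n \<tau> x \<in> simplex_boundary n" "push n 0 x = x"
    "\<exists>i<n. x i = 0 \<Longrightarrow> push n 1 x = std_vertex n"
proof -
  define m where "m t = min (min_coord (n - 1) x) (t / (2 * real n))" for t
  define c where "c t = (1 - 2 * real n * (t / (2 * real n) - m t)) / (1 - n * m t)" for t
  have push: "push n t x = (\<lambda>i. if i < n then (x i - m t) * c t else if i = n then 1 - (1 - x n - n * m t) * c t else 0)" for t
    unfolding push_def m_def c_def Let_def by simp
  have x': "x \<in> standard_simplex n" using x by (rule boundary_subset)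
  note D = standard_simplexD[OF x']
  have split: "{..n} = insert n {..<n}" by auto
  have sum: "(\<Sum>i<n. x i) = 1 - x n"
    using D(4) unfolding split by simp
  obtain k where "k \<le> n - 1" and k2: "min_coord (n - 1) x = x k"
    using min_coord_attained by blast
  then have "k < n" using n by simp
  note k = this k2
  have min0: "0 \<le> min_coord (n - 1) x" using k D(1) by simp
  have ml: "m t \<le> x i" if "i < n" for i t
    using min_coord_le[of i "n - 1" x] that by (simp add: m_def min_le_iff_disj)
  have m0: "0 \<le> m t" if "0 \<le> t" for t using min0 that by (simp add: m_def)
  have nm: "n * m t \<le> t / 2" if "0 \<le> t" for t
  proof -
    have "n * m t \<le> n * (t / (2 * real n))" by (intro mult_left_mono) (simp_all add: m_def)
    then show ?thesis using n by simp
  qed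
  have num: "1 - 2 * real n * (t / (2 * real n) - m t) = 1 - t + 2 * (n * m t)" for t
    using n by (simp add: field_simps)
  have c0: "0 \<le> c t" if "0 \<le> t" "t \<le> 1" for t
    unfolding c_def num using nm[of t] m0[of t] that by (intro divide_nonneg_nonneg) auto
  have c1: "c t * (1 - n * m t) \<le> 1" if "0 \<le> t" "t \<le> 1" for t
    unfolding c_def num using nm[of t] that by simp
  have "(\<Sum>i<n. m \<tau>) \<le> (\<Sum>i<n. x i)" using ml by (intro sum_mono) simp
  then have nonneg: "0 \<le> 1 - x n - n * m \<tau>" using sum by simp
  have mem: "push n \<tau> x \<in> standard_simplex n"
  proof (rule standard_simplexI)
    have "(1 - x n - n * m \<tau>) * c \<tau> \<le> (1 - n * m \<tau>) * c \<tau>"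
      using c0[OF \<tau>] D(1)[of n] by (intro mult_right_mono) auto
    then have "(1 - x n - n * m \<tau>) * c \<tau> \<le> 1" using c1[OF \<tau>] by (simp add: mult.commute)
    then show "0 \<le> push n \<tau> x i" if "i \<le> n" for i
      using that ml[of i \<tau>] c0[OF \<tau>] by (simp add: push)
    have "(\<Sum>i<n. (x i - m \<tau>) * c \<tau>) = (1 - x n - n * m \<tau>) * c \<tau>"
      by (simp add: sum_subtractf sum flip: sum_distrib_right)
    then show "(\<Sum>i\<le>n. push n \<tau> x i) = 1"
      unfolding split by (simp add: push)
  qed (simp add: push)
  have "\<exists>i\<le>n. push n \<tau> x i = 0"
  proof (cases "x k \<le> \<tau> / (2 * real n)")
    case True
    then have "push n \<tau> x k = 0" using k by (simp add: push m_def)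
    then show ?thesis using k by (intro exI[of _ k]) simp
  next
    case False
    have "x i \<noteq> 0" if "i < n" for i
    proof -
      have "min_coord (n - 1) x \<le> x i" using that by (intro min_coord_le) simp
      moreover have "0 \<le> \<tau> / (2 * real n)" using \<tau> by simp
      ultimately show ?thesis using False k by simp
    qed
    then have "x n = 0" using x by (auto simp: simplex_boundary_def le_less)
    moreover have "m \<tau> = \<tau> / (2 * real n)" using False k by (simp add: m_def)
    then have "c \<tau> = 1 / (1 - n * m \<tau>)" unfolding c_def by simp
    moreover have "1 - n * m \<tau> \<noteq> 0" using nm[OF \<tau>(1)] \<tau> by simp
    ultimately have "push n \<tau> x n = 0" by (simp add: push)
    then show ?thesis by blast
  qed
  with mem show "push n \<tau> x \<in> simplex_boundary n" by (simp add: simplex_boundary_def)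
  have "m 0 = 0" using min0 by (simp add: m_def)
  then have "c 0 = 1" by (simp add: c_def)
  with \<open>m 0 = 0\<close> show "push n 0 x = x" using D(3) by (auto simp: push fun_eq_iff not_less le_less)
  show "push n 1 x = std_vertex n" if "\<exists>i<n. x i = 0"
  proof -
    from that obtain i where i: "i < n" "x i = 0" by blast
    have "m 1 = 0"
      using min_coord_le[of i "n - 1" x] min0 i by (simp add: m_def)
    then have "c 1 = 0" using n by (simp add: c_def)
    then show ?thesis by (auto simp: push fun_eq_iff)
  qed
qed

lemma continuous_on_push:
  assumes n: "0 < n"
  shows "continuous_on (simplex_boundary n \<times> {0..1}) (\<lambda>(x, \<tau>). push n \<tau> x)"
proof (rule continuous_on_coordinatewise_then_product)
  fix i
  let ?m = "\<lambda>p :: (nat \<Rightarrow> real) \<times> real. min (min_coord (n - 1) (fst p)) (snd p / (2 * real n))"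
  have nz: "1 - n * ?m p \<noteq> 0" if "p \<in> simplex_boundary n \<times> {0..1}" for p
  proof -
    have "n * ?m p \<le> n * (snd p / (2 * real n))" by (intro mult_left_mono) simp_all
    also have "\<dots> \<le> 1 / 2" using n that by auto
    finally show ?thesis by simp
  qed
  have "continuous_on (simplex_boundary n \<times> {0..1}) (\<lambda>p. (if i < n then (fst p i - ?m p) * ((1 - 2 * real n * (snd p / (2 * real n) - ?m p)) / (1 - n * ?m p))
      else if i = n then 1 - (1 - fst p n - n * ?m p) * ((1 - 2 * real n * (snd p / (2 * real n) - ?m p)) / (1 - n * ?m p)) else 0))"
    using nz n by (cases "i < n"; cases "i = n") (auto intro!: continuous_intros)
  then show "continuous_on (simplex_boundary n \<times> {0..1}) (\<lambda>p. (case p of (x, \<tau>) \<Rightarrow> push n \<tau> x) i)"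
    by (rule continuous_on_eq) (auto simp: push_def Let_def)
qed

section \<open>Simplices as quotients of cubes\<close>

abbreviation unit_box :: "nat \<Rightarrow> (nat \<Rightarrow> real) set" where
  "unit_box n \<equiv> (\<Pi>\<^sub>E i\<in>{..<n}. {0..1})"

lemma topspace_cube [simp]: "topspace (cube n) = unit_box n"
  by (simp add: cube_def)

text \<open>A point of the cube has a fixed value outside the first n coordinates, so the product topology on
  the cube is that of a subspace of the space of all functions.\<close>

lemma cube_eq: "cube n = top_of_set (unit_box n)"
proof -
  have "continuous_map (cube n) (top_of_set (unit_box n)) id"
    unfolding continuous_map_in_subtopology
  proof
    have "continuous_map (cube n) (powertop_real UNIV) id"
      unfolding continuous_map_componentwise_UNIV
    proof
      fix i
      show "continuous_map (cube n) euclideanreal (\<lambda>x. id x i)"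
      proof (cases "i < n")
        case True
        then have "continuous_map (cube n) (top_of_set {0..1}) (\<lambda>x. x i)"
          unfolding cube_def by (intro continuous_map_product_projection) simp
        then show ?thesis by (simp add: continuous_map_in_subtopology)
      next
        case False
        have "continuous_map (cube n) euclideanreal (\<lambda>x. undefined)" by simp
        then show ?thesis
          by (rule continuous_map_eq) (use False in \<open>auto simp: PiE_def extensional_def\<close>)
      qed
    qed
    then show "continuous_map (cube n) euclidean id" by (simp add: euclidean_product_topology)
  qed auto
  moreover have "continuous_map (top_of_set (unit_box n)) (cube n) id"
    unfolding cube_def continuous_map_componentwise
    by (auto simp: continuous_map_in_subtopology PiE_def intro!: continuous_intros)
  ultimately have "homeomorphic_map (cube n) (top_of_set (unit_box n)) id"
    unfolding homeomorphic_map_maps homeomorphic_maps_def by (intro exI[of _ id]) simp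
  then show ?thesis by simp
qed

lemma box_boundary_iff: "t \<in> cube_boundary n \<longleftrightarrow> t \<in> unit_box n \<and> (\<exists>i<n. t i = 0 \<or> t i = 1)"
  by (simp add: cube_boundary_def)

definition head_prod :: "(nat \<Rightarrow> real) \<Rightarrow> nat \<Rightarrow> real" where
  "head_prod t k = (\<Prod>i<k. t i)"

text \<open>Coordinate \<open>t i\<close> is the fraction of the mass left after \<open>x 0, \<dots>, x (i - 1)\<close> that is passed on to the
  later coordinates. The map is injective where all fractions are strictly between 0 and 1, that is, off the
  boundary.\<close>

definition unfold_box :: "nat \<Rightarrow> (nat \<Rightarrow> real) \<Rightarrow> nat \<Rightarrow> real" where
  "unfold_box n t = (\<lambda>i. if i < n then head_prod t i * (1 - t i) else if i = n then head_prod t n else 0)"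

lemma boxD: "t \<in> unit_box n \<Longrightarrow> i < n \<Longrightarrow> 0 \<le> t i \<and> t i \<le> 1"
  by (auto simp: PiE_def Pi_def)

lemma sum_unfold_box: "k \<le> n \<Longrightarrow> (\<Sum>i<k. unfold_box n t i) = 1 - head_prod t k"
  by (induction k) (simp_all add: unfold_box_def head_prod_def algebra_simps)

lemma unfold_box_in_simplex:
  assumes t: "t \<in> unit_box n"
  shows "unfold_box n t \<in> standard_simplex n"
proof (rule standard_simplexI)
  have hp: "0 \<le> head_prod t k" if "k \<le> n" for k
    unfolding head_prod_def using boxD[OF t] that by (intro prod_nonneg) auto
  then show "0 \<le> unfold_box n t i" if "i \<le> n" for i
    using boxD[OF t, of i] that by (auto simp: unfold_box_def)
  have "{..n} = insert n {..<n}" by auto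
  then show "(\<Sum>i\<le>n. unfold_box n t i) = 1"
    using sum_unfold_box[of n n t] by (simp add: unfold_box_def)
qed (simp add: unfold_box_def)

lemma unfold_box_eq_0_iff:
  "(\<exists>i\<le>n. unfold_box n t i = 0) \<longleftrightarrow> (\<exists>i<n. t i = 0 \<or> t i = 1)"
proof
  assume "\<exists>i\<le>n. unfold_box n t i = 0"
  then obtain i where "i \<le> n" "unfold_box n t i = 0" by blast
  then have "(\<exists>j<i. t j = 0) \<or> (i < n \<and> t i = 1)"
    by (auto simp: unfold_box_def head_prod_def split: if_splits)
  then show "\<exists>i<n. t i = 0 \<or> t i = 1" using \<open>i \<le> n\<close> by (meson less_le_trans)
next
  assume "\<exists>i<n. t i = 0 \<or> t i = 1"
  then obtain i where i: "i < n" "t i = 0 \<or> t i = 1" by blast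
  then have "unfold_box n t n = 0 \<or> unfold_box n t i = 0"
    by (auto simp: unfold_box_def head_prod_def)
  then show "\<exists>i\<le>n. unfold_box n t i = 0" using i by (meson less_imp_le order_refl)
qed

lemma unfold_box_boundary:
  "t \<in> unit_box n \<Longrightarrow> unfold_box n t \<in> simplex_boundary n \<longleftrightarrow> t \<in> cube_boundary n"
  using unfold_box_in_simplex[of t n] by (simp add: simplex_boundary_def box_boundary_iff unfold_box_eq_0_iff)

text \<open>Only the face of the cube on which the last coordinate vanishes meets the interior of the face opposite
  the last vertex; all other faces go to faces that contain this vertex, which the push contracts.\<close>

lemma unfold_box_star:
  assumes "(\<exists>i<n. t i = 1) \<or> (\<exists>i<n - 1. t i = 0)"
  shows "\<exists>i<n. unfold_box n t i = 0"
  using assms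
proof
  assume "\<exists>i<n - 1. t i = 0"
  then obtain i where "i < n - 1" "t i = 0" by blast
  then have "unfold_box n t (n - 1) = 0" "n - 1 < n" by (auto simp: unfold_box_def head_prod_def)
  then show ?thesis by blast
qed (auto simp: unfold_box_def)

lemma unfold_box_inj:
  assumes t: "t \<in> unit_box n" and t': "t' \<in> unit_box n" and eq: "unfold_box n t = unfold_box n t'"
    and nb: "t \<notin> cube_boundary n"
  shows "t = t'"
proof -
  have hp: "head_prod t k = head_prod t' k" if "k \<le> n" for k
    using sum_unfold_box[OF that, of t] sum_unfold_box[OF that, of t'] eq by simp
  have pos: "t i \<noteq> 0" if "i < n" for i
    using nb t that by (auto simp: box_boundary_iff)
  have "t i = t' i" if "i < n" for i
  proof -
    have "head_prod t i \<noteq> 0" using pos that by (simp add: head_prod_def)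
    moreover have "head_prod t i * t i = head_prod t i * t' i"
      using hp[of "Suc i"] hp[of i] that by (simp add: head_prod_def)
    ultimately show ?thesis by simp
  qed
  with t t' show ?thesis by (intro PiE_ext) auto
qed

lemma unfold_box_eqD:
  assumes "t \<in> unit_box n" "t' \<in> unit_box n" "unfold_box n t = unfold_box n t'"
  shows "t = t' \<or> (t \<in> cube_boundary n \<and> t' \<in> cube_boundary n)"
  using unfold_box_inj[OF assms] unfold_box_inj[OF assms(2,1) assms(3)[symmetric]] by auto

lemma unfold_box_surj:
  assumes x: "x \<in> standard_simplex n"
  shows "\<exists>t\<in>unit_box n. unfold_box n t = x"
proof -
  note D = standard_simplexD[OF x]
  define T where "T k = 1 - (\<Sum>i<k. x i)" for k
  define t where "t = (\<lambda>i\<in>{..<n}. if T i = 0 then 0 else T (Suc i) / T i)"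
  have TS: "T (Suc k) = T k - x k" for k by (simp add: T_def)
  have T0: "0 \<le> T k" if "k \<le> Suc n" for k
  proof -
    have "(\<Sum>i<k. x i) \<le> (\<Sum>i\<le>n. x i)" using D(1) that by (intro sum_mono2) auto
    then show ?thesis using D(4) by (simp add: T_def)
  qed
  have tb: "t \<in> unit_box n"
  proof -
    have "0 \<le> T (Suc i) / T i \<and> T (Suc i) / T i \<le> 1" if "i < n" "T i \<noteq> 0" for i
      using T0[of i] T0[of "Suc i"] that D(1)[of i] TS[of i] by (simp add: divide_le_eq_1)
    then show ?thesis by (auto simp: t_def)
  qed
  have hp: "head_prod t k = T k" if "k \<le> n" for k
    using that
  proof (induction k)
    case (Suc k)
    have "T (Suc k) = 0" if "T k = 0"
      using T0[of "Suc k"] D(1)[of k] Suc.prems that by (simp add: TS)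
    then show ?case using Suc by (auto simp: head_prod_def t_def)
  qed (simp add: head_prod_def T_def)
  have "unfold_box n t i = x i" for i
  proof -
    consider "i < n" | "i = n" | "n < i" by linarith
    then show ?thesis
    proof cases
      case 1
      then have "unfold_box n t i = head_prod t i - head_prod t (Suc i)"
        by (simp add: unfold_box_def head_prod_def algebra_simps)
      then show ?thesis using hp[of i] hp[of "Suc i"] 1 by (simp add: TS)
    next
      case 2
      have "{..n} = insert n {..<n}" by auto
      then show ?thesis using hp[of n] D(4) 2 by (simp add: unfold_box_def T_def)
    qed (simp add: unfold_box_def D(3))
  qed
  with tb show ?thesis by (auto simp: fun_eq_iff)
qed

lemma continuous_on_unfold_box [continuous_intros]:
  assumes "continuous_on S f"
  shows "continuous_on S (\<lambda>x. unfold_box n (f x))"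
proof (rule continuous_on_coordinatewise_then_product)
  fix i
  note c = continuous_on_product_then_coordinatewise[OF assms]
  show "continuous_on S (\<lambda>x. unfold_box n (f x) i)"
    unfolding unfold_box_def head_prod_def by (cases "i < n"; cases "i = n") (auto intro!: continuous_intros c)
qed

lemma compact_box: "compact_space (top_of_set (unit_box n))"
  unfolding cube_eq[symmetric] cube_def compact_space_product_topology
  by (simp add: compact_space_subtopology)

lemma Hausdorff_fun: "Hausdorff_space (top_of_set (S :: (nat \<Rightarrow> real) set))"
  unfolding euclidean_product_topology[symmetric]
  by (intro Hausdorff_space_subtopology) (simp add: Hausdorff_space_product_topology)

text \<open>A continuous surjection from a compact space to a Hausdorff space.\<close>

lemma quotient_unfold_box:
  "quotient_map (top_of_set (unit_box n)) (top_of_set (standard_simplex n)) (unfold_box n)"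
proof (rule continuous_imp_quotient_map)
  show "continuous_map (top_of_set (unit_box n)) (top_of_set (standard_simplex n)) (unfold_box n)"
    using unfold_box_in_simplex by (auto simp: continuous_map_in_subtopology intro!: continuous_intros)
  show "unfold_box n ` topspace (top_of_set (unit_box n)) = topspace (top_of_set (standard_simplex n))"
    using unfold_box_in_simplex unfold_box_surj[of _ n] by (auto simp: image_iff) metis
qed (simp_all add: compact_box Hausdorff_fun)

lemma quotient_unfold_box_cyl:
  "quotient_map (top_of_set (unit_box n \<times> {0..1::real})) (top_of_set (cyl n)) (\<lambda>(t, s). (unfold_box n t, s))"
proof (rule continuous_imp_quotient_map)
  show "continuous_map (top_of_set (unit_box n \<times> {0..1})) (top_of_set (cyl n)) (\<lambda>(t, s). (unfold_box n t, s))"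
    using unfold_box_in_simplex
    by (auto simp: continuous_map_in_subtopology case_prod_unfold intro!: continuous_intros)
  have "top_of_set (unit_box n \<times> {0..1}) = prod_topology (top_of_set (unit_box n)) (top_of_set {0..1::real})" by simp
  then show "compact_space (top_of_set (unit_box n \<times> {0..1::real}))"
    using compact_box by (simp only: compact_space_prod_topology) (simp add: compact_space_subtopology)
  have "top_of_set (cyl n) = prod_topology (top_of_set (standard_simplex n)) (top_of_set {0..1::real})" by simp
  then show "Hausdorff_space (top_of_set (cyl n))"
    by (simp only: Hausdorff_space_prod_topology) (simp add: Hausdorff_fun Hausdorff_space_subtopology)
  show "(\<lambda>(t, s). (unfold_box n t, s)) ` topspace (top_of_set (unit_box n \<times> {0..1::real})) = topspace (top_of_set (cyl n))"
    using unfold_box_in_simplex unfold_box_surj[of _ n] by (auto simp: image_iff) metis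
qed

definition box_solvable :: "nat \<Rightarrow> 'a topology \<Rightarrow> 'b topology \<Rightarrow> ('a \<Rightarrow> 'b) \<Rightarrow> ((nat \<Rightarrow> real) \<Rightarrow> 'a) \<Rightarrow> bool" where
  "box_solvable n X Y g a \<longleftrightarrow>
     (\<forall>v. continuous_map (top_of_set (unit_box n)) Y v \<and> (\<forall>t\<in>cube_boundary n. v t = g (a t)) \<longrightarrow>
       (\<exists>a' K. continuous_map (top_of_set (unit_box n)) X a' \<and> (\<forall>t\<in>cube_boundary n. a' t = a t) \<and>
          continuous_map (top_of_set (unit_box n \<times> {0..1::real})) Y K \<and>
          (\<forall>t\<in>unit_box n. K (t, 0) = g (a' t) \<and> K (t, 1) = v t) \<and>
          (\<forall>t\<in>cube_boundary n. \<forall>s\<in>{0..1}. K (t, s) = g (a t))))"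

lemma cube_boundary_subset: "t \<in> cube_boundary n \<Longrightarrow> t \<in> unit_box n"
  by (simp add: box_boundary_iff)

text \<open>A solution on the cube descends to the simplex, because points with equal image are equal or lie in the
  boundary, where the solution is determined by their image.\<close>

lemma strictly_solvable_if_box_solvable:
  assumes "box_solvable n X Y g (\<lambda>t. \<alpha> (unfold_box n t))"
  shows "strictly_solvable n X Y g \<alpha>"
  unfolding strictly_solvable_def
proof (intro allI impI, elim conjE)
  let ?D = "standard_simplex n" and ?q = "unfold_box n"
  fix v assume v: "continuous_map (top_of_set ?D) Y v" "\<forall>x\<in>simplex_boundary n. v x = g (\<alpha> x)"
  have "continuous_map (top_of_set (unit_box n)) Y (\<lambda>t. v (?q t))"
    by (rule continuous_map_compose_on[OF v(1)]) (auto intro!: continuous_intros unfold_box_in_simplex)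
  moreover have "\<forall>t\<in>cube_boundary n. v (?q t) = g (\<alpha> (?q t))"
    using v(2) unfold_box_boundary[of _ n] cube_boundary_subset by blast
  ultimately obtain a' K where a': "continuous_map (top_of_set (unit_box n)) X a'" "\<forall>t\<in>cube_boundary n. a' t = \<alpha> (?q t)"
    and K: "continuous_map (top_of_set (unit_box n \<times> {0..1::real})) Y K" "\<forall>t\<in>unit_box n. K (t, 0) = g (a' t) \<and> K (t, 1) = v (?q t)"
      "\<forall>t\<in>cube_boundary n. \<forall>s\<in>{0..1}. K (t, s) = g (\<alpha> (?q t))"
    using assms unfolding box_solvable_def by blast
  obtain \<alpha>' where \<alpha>': "continuous_map (top_of_set ?D) X \<alpha>'" "\<And>t. t \<in> unit_box n \<Longrightarrow> \<alpha>' (?q t) = a' t"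
  proof (rule quotient_map_lift_exists[OF quotient_unfold_box a'(1)])
    fix t t' assume "t \<in> topspace (top_of_set (unit_box n))" "t' \<in> topspace (top_of_set (unit_box n))" "?q t = ?q t'"
    then show "a' t = a' t'" using unfold_box_eqD[of t n t'] a'(2) by auto
  qed auto
  obtain K' where K': "continuous_map (top_of_set (cyl n)) Y K'"
    "\<And>p. p \<in> unit_box n \<times> {0..1::real} \<Longrightarrow> K' (case p of (t, s) \<Rightarrow> (?q t, s)) = K p"
  proof (rule quotient_map_lift_exists[OF quotient_unfold_box_cyl K(1)])
    fix p p' assume "p \<in> topspace (top_of_set (unit_box n \<times> {0..1::real}))" "p' \<in> topspace (top_of_set (unit_box n \<times> {0..1::real}))"
      "(case p of (t, s) \<Rightarrow> (?q t, s)) = (case p' of (t, s) \<Rightarrow> (?q t, s))"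
    then show "K p = K p'" using unfold_box_eqD[of "fst p" n "fst p'"] K(3) by auto
  qed auto
  have 1: "\<alpha>' x = \<alpha> x" if x: "x \<in> simplex_boundary n" for x
  proof -
    obtain t where "t \<in> unit_box n" "?q t = x" using unfold_box_surj[OF boundary_subset[OF x]] by blast
    then show ?thesis using \<alpha>'(2)[of t] a'(2) unfold_box_boundary[of t n] x by auto
  qed
  have 2: "K' (x, 0) = g (\<alpha>' x) \<and> K' (x, 1) = v x" if x: "x \<in> ?D" for x
  proof -
    obtain t where t: "t \<in> unit_box n" "?q t = x" using unfold_box_surj[OF x] by blast
    then show ?thesis using \<alpha>'(2)[of t] K(2) K'(2)[of "(t, 0)"] K'(2)[of "(t, 1)"] by auto
  qed
  have 3: "K' (x, s) = g (\<alpha> x)" if x: "x \<in> simplex_boundary n" and s: "s \<in> {0..1}" for x s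
  proof -
    obtain t where t: "t \<in> unit_box n" "?q t = x" using unfold_box_surj[OF boundary_subset[OF x]] by blast
    then show ?thesis using K(3) K'(2)[of "(t, s)"] unfold_box_boundary[of t n] x s by auto
  qed
  show "\<exists>\<alpha>' K. continuous_map (top_of_set ?D) X \<alpha>' \<and> (\<forall>x\<in>simplex_boundary n. \<alpha>' x = \<alpha> x) \<and>
      continuous_map (top_of_set (cyl n)) Y K \<and> (\<forall>x\<in>?D. K (x, 0) = g (\<alpha>' x) \<and> K (x, 1) = v x) \<and>
      (\<forall>x\<in>simplex_boundary n. \<forall>s\<in>{0..1}. K (x, s) = g (\<alpha> x))"
    using \<alpha>'(1) K'(1) 1 2 3 by blast
qed

section \<open>Solving lifting problems on cubes\<close>

lemma homotopic_with_box:
  "homotopic_with (\<lambda>k. \<forall>t\<in>cube_boundary n. k t = f t) (cube n) Y p q \<longleftrightarrow>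
    (\<exists>H. continuous_map (top_of_set ({0..1::real} \<times> unit_box n)) Y H \<and> (\<forall>t\<in>unit_box n. H (0, t) = p t \<and> H (1, t) = q t) \<and>
      (\<forall>s\<in>{0..1}. \<forall>t\<in>cube_boundary n. H (s, t) = f t))"
proof -
  have "homotopic_with (\<lambda>k. \<forall>t\<in>cube_boundary n. k t = f t) (cube n) Y p q \<longleftrightarrow>
    (\<exists>H. continuous_map (prod_topology (top_of_set {0..1::real}) (cube n)) Y H \<and> (\<forall>t\<in>topspace (cube n). H (0, t) = p t) \<and>
      (\<forall>t\<in>topspace (cube n). H (1, t) = q t) \<and> (\<forall>s\<in>{0..1}. \<forall>t\<in>cube_boundary n. H (s, t) = f t))"
    by (rule homotopic_with) (simp add: cube_boundary_subset)
  moreover have "prod_topology (top_of_set {0..1::real}) (cube n) = top_of_set ({0..1} \<times> unit_box n)"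
    unfolding cube_eq by simp
  ultimately show ?thesis by auto
qed

lemma homotopy_rel_iff:
  "(p, q) \<in> homotopy_rel n Y b \<longleftrightarrow> p \<in> spheroids n Y b \<and> q \<in> spheroids n Y b \<and>
    (\<exists>H. continuous_map (top_of_set ({0..1::real} \<times> unit_box n)) Y H \<and> (\<forall>t\<in>unit_box n. H (0, t) = p t \<and> H (1, t) = q t) \<and>
      (\<forall>s\<in>{0..1}. \<forall>t\<in>cube_boundary n. H (s, t) = b))"
  by (simp add: homotopy_rel_def homotopic_with_box[where f = "\<lambda>_. b"])

lemma spheroids_iff:
  "p \<in> spheroids n Y b \<longleftrightarrow> continuous_map (top_of_set (unit_box n)) Y p \<and> p \<in> extensional (unit_box n) \<and> (\<forall>t\<in>cube_boundary n. p t = b)"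
  by (simp add: spheroids_def flip: cube_eq)

lemma equiv_homotopy_rel: "equiv (spheroids n X b) (homotopy_rel n X b)"
proof (rule equivI)
  show "refl_on (spheroids n X b) (homotopy_rel n X b)"
    by (auto simp: refl_on_def homotopy_rel_def spheroids_def)
  show "sym (homotopy_rel n X b)"
    by (auto simp: sym_def homotopy_rel_def intro: homotopic_with_symD)
  show "trans (homotopy_rel n X b)"
    by (auto simp: trans_def homotopy_rel_def intro: homotopic_with_trans)
qed (auto simp: homotopy_rel_def)

lemma spheroids_compose:
  assumes "continuous_map X Y g" "\<phi> \<in> spheroids n X b"
  shows "restrict (g \<circ> \<phi>) (unit_box n) \<in> spheroids n Y (g b)"
proof -
  have "continuous_map (top_of_set (unit_box n)) Y (g \<circ> \<phi>)"
    using assms continuous_map_compose by (auto simp: spheroids_iff)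
  then have "continuous_map (top_of_set (unit_box n)) Y (restrict (g \<circ> \<phi>) (unit_box n))"
    by (rule continuous_map_top_of_set_cong) simp
  then show ?thesis using assms(2) by (auto simp: spheroids_iff dest: cube_boundary_subset)
qed

lemma homotopy_rel_compose:
  assumes g: "continuous_map X Y g" and "(\<phi>, \<psi>) \<in> homotopy_rel n X b"
  shows "(restrict (g \<circ> \<phi>) (unit_box n), restrict (g \<circ> \<psi>) (unit_box n)) \<in> homotopy_rel n Y (g b)"
proof -
  obtain H where H: "continuous_map (top_of_set ({0..1::real} \<times> unit_box n)) X H" "\<forall>t\<in>unit_box n. H (0, t) = \<phi> t \<and> H (1, t) = \<psi> t"
      "\<forall>s\<in>{0..1}. \<forall>t\<in>cube_boundary n. H (s, t) = b" and s: "\<phi> \<in> spheroids n X b" "\<psi> \<in> spheroids n X b"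
    using assms(2) by (auto simp: homotopy_rel_iff)
  have "continuous_map (top_of_set ({0..1::real} \<times> unit_box n)) Y (g \<circ> H)"
    by (rule continuous_map_compose[OF H(1) g])
  then show ?thesis
    unfolding homotopy_rel_iff using H(2,3) spheroids_compose[OF g] s by (intro conjI exI[of _ "g \<circ> H"]) auto
qed

lemma homotopy_induced_class:
  assumes g: "continuous_map X Y g" and \<phi>: "\<phi> \<in> spheroids n X b"
  shows "homotopy_induced n X Y g b (homotopy_rel n X b `` {\<phi>}) = homotopy_rel n Y (g b) `` {restrict (g \<circ> \<phi>) (unit_box n)}"
proof -
  let ?R = "homotopy_rel n Y (g b)" and ?F = "\<lambda>\<psi>. restrict (g \<circ> \<psi>) (unit_box n)"
  have "?R `` {?F \<psi>} = ?R `` {?F \<phi>}" if "\<psi> \<in> homotopy_rel n X b `` {\<phi>}" for \<psi>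
    using equiv_class_eq[OF equiv_homotopy_rel homotopy_rel_compose[OF g, of \<phi> \<psi> n b]] that by simp
  moreover have "\<phi> \<in> homotopy_rel n X b `` {\<phi>}"
    using equiv_class_self[OF equiv_homotopy_rel \<phi>] .
  moreover have "?R `` (?F ` A) = (\<Union>\<psi>\<in>A. ?R `` {?F \<psi>})" for A by blast
  ultimately show ?thesis unfolding homotopy_induced_def topspace_cube by blast
qed

lemma weak_homotopy_equivalenceD:
  assumes g: "weak_homotopy_equivalence X Y g" and b: "b \<in> topspace X" and n: "1 \<le> n"
  shows "\<phi> \<in> spheroids n X b \<Longrightarrow> \<psi> \<in> spheroids n X b \<Longrightarrow>
      (restrict (g \<circ> \<phi>) (unit_box n), restrict (g \<circ> \<psi>) (unit_box n)) \<in> homotopy_rel n Y (g b) \<Longrightarrow> (\<phi>, \<psi>) \<in> homotopy_rel n X b"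
    and "\<omega> \<in> spheroids n Y (g b) \<Longrightarrow> \<exists>\<phi>\<in>spheroids n X b. (restrict (g \<circ> \<phi>) (unit_box n), \<omega>) \<in> homotopy_rel n Y (g b)"
proof -
  have cont: "continuous_map X Y g"
    and bij: "bij_betw (homotopy_induced n X Y g b) (homotopy_classes n X b) (homotopy_classes n Y (g b))"
    using g b n unfolding weak_homotopy_equivalence_def by blast+
  note eq = equiv_homotopy_rel
  show "(\<phi>, \<psi>) \<in> homotopy_rel n X b" if \<phi>: "\<phi> \<in> spheroids n X b" and \<psi>: "\<psi> \<in> spheroids n X b"
    and rel: "(restrict (g \<circ> \<phi>) (unit_box n), restrict (g \<circ> \<psi>) (unit_box n)) \<in> homotopy_rel n Y (g b)"
  proof -
    have "homotopy_induced n X Y g b (homotopy_rel n X b `` {\<phi>}) = homotopy_induced n X Y g b (homotopy_rel n X b `` {\<psi>})"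
      using equiv_class_eq[OF eq rel] by (simp add: homotopy_induced_class[OF cont] \<phi> \<psi>)
    moreover have "homotopy_rel n X b `` {\<phi>} \<in> homotopy_classes n X b" "homotopy_rel n X b `` {\<psi>} \<in> homotopy_classes n X b"
      using \<phi> \<psi> by (auto simp: homotopy_classes_def intro: quotientI)
    ultimately have "homotopy_rel n X b `` {\<phi>} = homotopy_rel n X b `` {\<psi>}"
      by (rule inj_onD[OF bij_betw_imp_inj_on[OF bij]])
    then show ?thesis using eq_equiv_class[OF _ eq \<psi>] by blast
  qed
  show "\<exists>\<phi>\<in>spheroids n X b. (restrict (g \<circ> \<phi>) (unit_box n), \<omega>) \<in> homotopy_rel n Y (g b)" if \<omega>: "\<omega> \<in> spheroids n Y (g b)"
  proof -
    have "homotopy_rel n Y (g b) `` {\<omega>} \<in> homotopy_classes n Y (g b)"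
      using \<omega> by (auto simp: homotopy_classes_def intro: quotientI)
    then obtain c where c: "c \<in> homotopy_classes n X b" "homotopy_induced n X Y g b c = homotopy_rel n Y (g b) `` {\<omega>}"
      using bij unfolding bij_betw_def by (metis imageE)
    then obtain \<phi> where \<phi>: "\<phi> \<in> spheroids n X b" "c = homotopy_rel n X b `` {\<phi>}"
      unfolding homotopy_classes_def by (auto elim: quotientE)
    then show ?thesis
      using c eq_equiv_class[OF _ eq \<omega>] by (auto simp: homotopy_induced_class[OF cont])
  qed
qed

lemma box_upd: "t \<in> unit_box (Suc m) \<Longrightarrow> 0 \<le> s \<Longrightarrow> s \<le> 1 \<Longrightarrow> t(m := s) \<in> unit_box (Suc m)"
  by (auto simp: PiE_def Pi_def extensional_def)

lemma box_extend: "u \<in> unit_box m \<Longrightarrow> 0 \<le> s \<Longrightarrow> s \<le> 1 \<Longrightarrow> u(m := s) \<in> unit_box (Suc m)"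
  by (auto simp: PiE_def Pi_def extensional_def)

lemma box_restrict: "t \<in> unit_box (Suc m) \<Longrightarrow> restrict t {..<m} \<in> unit_box m"
  by (auto simp: PiE_def Pi_def)

lemma continuous_on_upd [continuous_intros]:
  fixes e :: "'x::topological_space \<Rightarrow> real"
  assumes "continuous_on S f" "continuous_on S e"
  shows "continuous_on S (\<lambda>x. (f x)(m := e x))"
proof (rule continuous_on_coordinatewise_then_product)
  fix i
  show "continuous_on S (\<lambda>x. ((f x)(m := e x)) i)"
    using assms(2) continuous_on_product_then_coordinatewise[OF assms(1)] by (cases "i = m") simp_all
qed

lemma continuous_on_restrict_fun [continuous_intros]:
  assumes "continuous_on S f"
  shows "continuous_on S (\<lambda>x. restrict (f x) (A :: nat set) :: nat \<Rightarrow> real)"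
proof (rule continuous_on_coordinatewise_then_product)
  fix i
  show "continuous_on S (\<lambda>x. restrict (f x) A i)"
    using continuous_on_product_then_coordinatewise[OF assms] by (cases "i \<in> A") simp_all
qed

lemma cube_boundaryI: "t \<in> unit_box n \<Longrightarrow> i < n \<Longrightarrow> t i = 0 \<or> t i = 1 \<Longrightarrow> t \<in> cube_boundary n"
  unfolding box_boundary_iff by blast

lemma continuous_map_upd:
  fixes e :: "'x::topological_space \<Rightarrow> real"
  assumes "continuous_map (top_of_set (unit_box (Suc m))) Y f" "continuous_on T \<phi>" "continuous_on T e"
    and "\<And>p. p \<in> T \<Longrightarrow> \<phi> p \<in> unit_box (Suc m)" "\<And>p. p \<in> T \<Longrightarrow> 0 \<le> e p \<and> e p \<le> 1"
  shows "continuous_map (top_of_set T) Y (\<lambda>p. f ((\<phi> p)(m := e p)))"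
proof (rule continuous_map_compose_on[OF assms(1) continuous_on_upd[OF assms(2,3)]])
  fix p assume "p \<in> T"
  then show "(\<phi> p)(m := e p) \<in> unit_box (Suc m)" using box_upd[OF assms(4)] assms(5) by blast
qed

text \<open>A map on the boundary that is constant off the bottom face is a spheroid on the bottom face; the second map
  is a nullhomotopy of its image, so injectivity on homotopy groups provides an extension.\<close>

lemma extend_over_box:
  assumes g: "weak_homotopy_equivalence X Y g" and b: "b \<in> topspace X"
    and a: "continuous_map (top_of_set (cube_boundary (Suc m))) X a"
    and a_b: "\<And>t. t \<in> cube_boundary (Suc m) \<Longrightarrow> t m = 1 \<or> (\<exists>i<m. t i = 0 \<or> t i = 1) \<or> m = 0 \<Longrightarrow> a t = b"
    and v: "continuous_map (top_of_set (unit_box (Suc m))) Y v" "\<And>t. t \<in> cube_boundary (Suc m) \<Longrightarrow> v t = g (a t)"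
  shows "\<exists>a0. continuous_map (top_of_set (unit_box (Suc m))) X a0 \<and> (\<forall>t\<in>cube_boundary (Suc m). a0 t = a t)"
proof (cases "m = 0")
  \<comment> \<open>An interval with both ends at the base point; homotopy groups start in dimension 1.\<close>
  case True
  have "continuous_map (top_of_set (unit_box (Suc m))) X (\<lambda>_. b)" using b by simp
  then show ?thesis using a_b True by metis
next
  case False
  define \<phi> where "\<phi> = (\<lambda>u\<in>unit_box m. a (u(m := 0)))"
  define k where "k = (\<lambda>u\<in>unit_box m. b)"
  have lateral: "u(m := s) \<in> cube_boundary (Suc m)" "\<exists>i<m. (u(m := s)) i = 0 \<or> (u(m := s)) i = 1"
    if "u \<in> cube_boundary m" "0 \<le> s" "s \<le> 1" for u s
  proof -
    from that obtain i where i: "i < m" "u i = 0 \<or> u i = 1" by (auto simp: box_boundary_iff)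
    then show "\<exists>i<m. (u(m := s)) i = 0 \<or> (u(m := s)) i = 1" by (intro exI[of _ i]) simp
    have "u(m := s) \<in> unit_box (Suc m)" by (rule box_extend[OF cube_boundary_subset[OF that(1)] that(2,3)])
    then show "u(m := s) \<in> cube_boundary (Suc m)"
      by (rule cube_boundaryI[of _ _ i]) (use i in simp_all)
  qed
  have bottom: "u(m := s) \<in> cube_boundary (Suc m)" if "u \<in> unit_box m" "s = 0 \<or> s = 1" for u and s :: real
    by (rule cube_boundaryI[OF box_extend[OF that(1)], of _ m]) (use that(2) in auto)
  have "continuous_map (top_of_set (unit_box m)) X (\<lambda>u. a (u(m := 0)))"
    by (rule continuous_map_compose_on[OF a continuous_on_upd[OF continuous_on_id continuous_on_const]])
       (rule bottom, simp_all)
  then have "continuous_map (top_of_set (unit_box m)) X \<phi>"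
    unfolding \<phi>_def by (rule continuous_map_top_of_set_cong) simp
  then have \<phi>: "\<phi> \<in> spheroids m X b"
    using lateral[of _ 0] a_b by (auto simp: spheroids_iff \<phi>_def dest: cube_boundary_subset)
  have "continuous_map (top_of_set (unit_box m)) X (\<lambda>_. b)" using b by simp
  then have "continuous_map (top_of_set (unit_box m)) X k"
    unfolding k_def by (rule continuous_map_top_of_set_cong) simp
  then have k: "k \<in> spheroids m X b"
    by (auto simp: spheroids_iff k_def dest: cube_boundary_subset)
  have cont: "continuous_map X Y g" using g by (simp add: weak_homotopy_equivalence_def)
  have "(restrict (g \<circ> \<phi>) (unit_box m), restrict (g \<circ> k) (unit_box m)) \<in> homotopy_rel m Y (g b)"
    unfolding homotopy_rel_iff
  proof (intro conjI exI[of _ "\<lambda>p. v ((snd p)(m := fst p))"] spheroids_compose[OF cont] \<phi> k)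
    show "continuous_map (top_of_set ({0..1} \<times> unit_box m)) Y (\<lambda>p. v ((snd p)(m := fst p)))"
      by (rule continuous_map_compose_on[OF v(1) continuous_on_upd[OF continuous_on_snd[OF continuous_on_id] continuous_on_fst[OF continuous_on_id]]])
         (use box_extend in \<open>simp add: mem_Times_iff\<close>)
    show "\<forall>t\<in>unit_box m. v ((snd (0, t))(m := fst (0, t))) = restrict (g \<circ> \<phi>) (unit_box m) t \<and>
        v ((snd (1, t))(m := fst (1, t))) = restrict (g \<circ> k) (unit_box m) t"
      using bottom by (simp add: v(2) \<phi>_def k_def a_b)
    show "\<forall>s\<in>{0..1}. \<forall>t\<in>cube_boundary m. v ((snd (s, t))(m := fst (s, t))) = g b"
    proof (intro ballI)
      fix s t assume "s \<in> {0..1::real}" "t \<in> cube_boundary m"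
      then show "v ((snd (s, t))(m := fst (s, t))) = g b"
        using lateral[of t s] v(2)[of "t(m := s)"] a_b[of "t(m := s)"] by simp
    qed
  qed
  then have "(\<phi>, k) \<in> homotopy_rel m X b"
    using weak_homotopy_equivalenceD(1)[OF g b _ \<phi> k] False by simp
  then obtain H where H: "continuous_map (top_of_set ({0..1::real} \<times> unit_box m)) X H"
    "\<And>t. t \<in> unit_box m \<Longrightarrow> H (0, t) = \<phi> t \<and> H (1, t) = k t" "\<And>s t. s \<in> {0..1} \<Longrightarrow> t \<in> cube_boundary m \<Longrightarrow> H (s, t) = b"
    by (auto simp: homotopy_rel_iff)
  define a0 where "a0 t = H (t m, restrict t {..<m})" for t
  have "continuous_map (top_of_set (unit_box (Suc m))) X a0"
    unfolding a0_def
  proof (rule continuous_map_compose_on[OF H(1)])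
    fix t :: "nat \<Rightarrow> real" assume t: "t \<in> unit_box (Suc m)"
    show "(t m, restrict t {..<m}) \<in> {0..1} \<times> unit_box m"
      using boxD[OF t, of m] box_restrict[OF t] by simp
  qed (rule continuous_on_Pair continuous_on_restrict_fun; intro continuous_intros)+
  moreover have "a0 t = a t" if t: "t \<in> cube_boundary (Suc m)" for t
  proof -
    let ?u = "restrict t {..<m}"
    have tb: "t \<in> unit_box (Suc m)" by (rule cube_boundary_subset[OF t])
    then have u: "?u \<in> unit_box m" by (rule box_restrict)
    have tu: "?u(m := t m) = t"
      using tb by (auto simp: fun_eq_iff PiE_def extensional_def)
    from t have "t m = 0 \<or> t m = 1 \<or> (\<exists>i<m. t i = 0 \<or> t i = 1)"
      by (auto simp: box_boundary_iff less_Suc_eq)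
    then consider "\<exists>i<m. t i = 0 \<or> t i = 1" | "t m = 0" | "t m = 1" by blast
    then show ?thesis
    proof cases
      case 1
      then have "?u \<in> cube_boundary m" using u by (auto simp: box_boundary_iff)
      then have "a0 t = b" using H(3)[of "t m"] boxD[OF tb, of m] by (simp add: a0_def)
      then show ?thesis using a_b[OF t] 1 by simp
    next
      case 2
      then show ?thesis using H(2)[OF u] tu u by (simp add: a0_def \<phi>_def)
    next
      case 3
      then show ?thesis using H(2)[OF u] u a_b[OF t] by (simp add: a0_def k_def)
    qed
  qed
  ultimately show ?thesis by blast
qed

text \<open>The extension need not map to the given map on the cube. Running back along the image of the extension and then
  along the given map is a spheroid, and the extension is corrected by a preimage of it.\<close>

lemma box_solvable_if_based:
  assumes g: "weak_homotopy_equivalence X Y g" and b: "b \<in> topspace X"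
    and a: "continuous_map (top_of_set (cube_boundary (Suc m))) X a"
    and a_b: "\<And>t. t \<in> cube_boundary (Suc m) \<Longrightarrow> t m = 1 \<or> (\<exists>i<m. t i = 0 \<or> t i = 1) \<or> m = 0 \<Longrightarrow> a t = b"
  shows "box_solvable (Suc m) X Y g a"
  unfolding box_solvable_def
proof (intro allI impI, elim conjE)
  let ?I = "unit_box (Suc m)" and ?bd = "cube_boundary (Suc m)"
  fix v assume v: "continuous_map (top_of_set ?I) Y v" "\<forall>t\<in>?bd. v t = g (a t)"
  have cont: "continuous_map X Y g" using g by (simp add: weak_homotopy_equivalence_def)
  obtain a0 where a0: "continuous_map (top_of_set ?I) X a0" "\<And>t. t \<in> ?bd \<Longrightarrow> a0 t = a t"
    using extend_over_box[OF g b a a_b v(1)] v(2) by blast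
  have ga0: "continuous_map (top_of_set ?I) Y (\<lambda>t. g (a0 t))"
    using continuous_map_compose[OF a0(1) cont] by (simp add: o_def)
  have bd: "t(m := s) \<in> ?bd" if "t \<in> ?I" "s = 0 \<or> s = 1" for t and s :: real
    by (rule cube_boundaryI[OF box_upd[OF that(1)], of _ m]) (use that(2) in auto)
  have lat: "t(m := s) \<in> ?bd \<and> (\<exists>i<m. (t(m := s)) i = 0 \<or> (t(m := s)) i = 1)"
    if "t \<in> ?I" "\<exists>i<m. t i = 0 \<or> t i = 1" "0 \<le> s" "s \<le> 1" for t s
  proof -
    from that(2) obtain i where i: "i < m" "t i = 0 \<or> t i = 1" by blast
    then have "(t(m := s)) i = 0 \<or> (t(m := s)) i = 1" by simp
    then show ?thesis
      using cube_boundaryI[OF box_upd[OF that(1,3,4)], of i] i(1) by (meson less_SucI)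
  qed
  have bd_cases: "t m = 0 \<or> t m = 1 \<or> (\<exists>i<m. t i = 0 \<or> t i = 1)" if "t \<in> ?bd" for t
    using that by (auto simp: box_boundary_iff less_Suc_eq)
  have tm: "0 \<le> t m" "t m \<le> 1" if "t \<in> ?I" for t
    using boxD[OF that, of m] by auto
  have v0: "v (t(m := 0)) = g (a0 (t(m := 0)))" if "t \<in> ?I" for t
    using bd[OF that] v(2) a0(2) by simp
  have v1: "v (t(m := 1)) = g b" "a0 (t(m := 1)) = b" if "t \<in> ?I" for t
    using bd[OF that] v(2) a0(2) a_b by simp_all
  have vl: "v (t(m := s)) = g b" "a0 (t(m := s)) = b" "a t = b" if "t \<in> ?I" "\<exists>i<m. t i = 0 \<or> t i = 1" "0 \<le> s" "s \<le> 1" for t s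
  proof -
    show "v (t(m := s)) = g b" "a0 (t(m := s)) = b"
      using lat[OF that] v(2) a0(2) a_b by simp_all
    have "t \<in> ?bd" using that(1,2) unfolding box_boundary_iff by (meson less_Suc_eq)
    then show "a t = b" using a_b that(2) by blast
  qed
  \<comment> \<open>The first half runs along the image of the extension from top to bottom, the second half along the
    given map from bottom to top.\<close>
  define d where "d t = (if t m \<le> 1 / 2 then g (a0 (t(m := 1 - 2 * t m))) else v (t(m := 2 * t m - 1)))" for t
  define D where "D = restrict d ?I"
  have "continuous_map (top_of_set ?I) Y d"
    unfolding d_def
  proof (rule continuous_map_paste_le)
    show "continuous_map (top_of_set {t \<in> ?I. t m \<le> 1 / 2}) Y (\<lambda>t. g (a0 (t(m := 1 - 2 * t m))))"
      by (rule continuous_map_upd[OF ga0]; (intro continuous_intros)?) (use tm in \<open>auto\<close>)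
    show "continuous_map (top_of_set {t \<in> ?I. 1 / 2 \<le> t m}) Y (\<lambda>t. v (t(m := 2 * t m - 1)))"
      by (rule continuous_map_upd[OF v(1)]; (intro continuous_intros)?) (use tm in \<open>auto\<close>)
    show "g (a0 (t(m := 1 - 2 * t m))) = v (t(m := 2 * t m - 1))" if "t \<in> ?I" "t m = 1 / 2" for t
    proof -
      have "1 - 2 * t m = 0" "2 * t m - 1 = 0" using that(2) by simp_all
      then show ?thesis using v0[OF that(1)] by simp
    qed
  qed (intro continuous_intros)
  then have "continuous_map (top_of_set ?I) Y D"
    unfolding D_def by (rule continuous_map_top_of_set_cong) simp
  moreover have "d t = g b" if t: "t \<in> ?bd" for t
  proof -
    have tI: "t \<in> ?I" by (rule cube_boundary_subset[OF t])
    consider "t m = 0" | "t m = 1" | "\<exists>i<m. t i = 0 \<or> t i = 1" using bd_cases[OF t] by blast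
    then show ?thesis
    proof cases
      case 3
      then show ?thesis using vl[OF tI 3] tm[OF tI] by (simp add: d_def)
    qed (use v1[OF tI] in \<open>simp_all add: d_def\<close>)
  qed
  ultimately have D: "D \<in> spheroids (Suc m) Y (g b)"
    by (auto simp: spheroids_iff D_def dest: cube_boundary_subset)
  obtain c where c: "c \<in> spheroids (Suc m) X b" and cD: "(restrict (g \<circ> c) ?I, D) \<in> homotopy_rel (Suc m) Y (g b)"
    using weak_homotopy_equivalenceD(2)[OF g b _ D] by auto
  obtain \<Psi> where \<Psi>: "continuous_map (top_of_set ({0..1::real} \<times> ?I)) Y \<Psi>"
    "\<And>t. t \<in> ?I \<Longrightarrow> \<Psi> (0, t) = g (c t) \<and> \<Psi> (1, t) = d t" "\<And>s t. 0 \<le> s \<Longrightarrow> s \<le> 1 \<Longrightarrow> t \<in> ?bd \<Longrightarrow> \<Psi> (s, t) = g b"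
    using cD by (auto simp: homotopy_rel_iff D_def)
  have c': "continuous_map (top_of_set ?I) X c" "\<And>t. t \<in> ?bd \<Longrightarrow> c t = b" using c by (auto simp: spheroids_iff)
  \<comment> \<open>The extension is traversed in the lower half and the correction is put on top of it, where both
    have the value at the base point.\<close>
  define a' where "a' t = (if t m \<le> 1 / 2 then a0 (t(m := 2 * t m)) else c (t(m := 2 * t m - 1)))" for t
  have half: "2 * t m = 1" "2 * t m - 1 = 0" if "t m = 1 / 2" for t :: "nat \<Rightarrow> real" using that by simp_all
  have a': "continuous_map (top_of_set ?I) X a'"
    unfolding a'_def
  proof (rule continuous_map_paste_le)
    show "continuous_map (top_of_set {t \<in> ?I. t m \<le> 1 / 2}) X (\<lambda>t. a0 (t(m := 2 * t m)))"
      by (rule continuous_map_upd[OF a0(1)]; (intro continuous_intros)?) (use tm in \<open>auto\<close>)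
    show "continuous_map (top_of_set {t \<in> ?I. 1 / 2 \<le> t m}) X (\<lambda>t. c (t(m := 2 * t m - 1)))"
      by (rule continuous_map_upd[OF c'(1)]; (intro continuous_intros)?) (use tm in \<open>auto\<close>)
    show "a0 (t(m := 2 * t m)) = c (t(m := 2 * t m - 1))" if "t \<in> ?I" "t m = 1 / 2" for t
      using v1[OF that(1)] c'(2)[OF bd[OF that(1)], of 0] half[of t, OF that(2)] by simp
  qed (intro continuous_intros)
  have a'_bd: "a' t = a t" if t: "t \<in> ?bd" for t
  proof -
    have tI: "t \<in> ?I" by (rule cube_boundary_subset[OF t])
    consider "t m = 0" | "t m = 1" | "\<exists>i<m. t i = 0 \<or> t i = 1" using bd_cases[OF t] by blast
    then show ?thesis
    proof cases
      case 1
      then have "t(m := 0) = t" by auto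
      then show ?thesis using a0(2)[OF t] 1 by (simp add: a'_def)
    next
      case 2
      then show ?thesis using c'(2)[OF bd[OF tI]] a_b[OF t] by (simp add: a'_def)
    next
      case 3
      then show ?thesis
        using vl[OF tI 3] c'(2) lat[OF tI 3] tm[OF tI] by (simp add: a'_def)
    qed
  qed
  let ?P = "\<lambda>k. \<forall>t\<in>?bd. k t = g (a t)"
  \<comment> \<open>Three homotopies relative to the boundary lead from the image of the corrected extension to the given
    map: the image of the correction is replaced by the spheroid, the extension is cancelled against its
    reverse, and the resulting quarter is stretched over the whole interval.\<close>
  define E where "E t = (if t m \<le> 1 / 2 then g (a0 (t(m := 2 * t m))) else d (t(m := 2 * t m - 1)))" for t
  have 1: "homotopic_with ?P (cube (Suc m)) Y (\<lambda>t. g (a' t)) E"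
    unfolding homotopic_with_box
  proof (intro exI conjI ballI)
    let ?H = "\<lambda>p. if snd p m \<le> 1 / 2 then g (a0 ((snd p)(m := 2 * snd p m))) else \<Psi> (fst p, (snd p)(m := 2 * snd p m - 1))"
    show "continuous_map (top_of_set ({0..1} \<times> ?I)) Y ?H"
    proof (rule continuous_map_paste_le)
      show "continuous_map (top_of_set {p \<in> {0..1} \<times> ?I. snd p m \<le> 1 / 2}) Y (\<lambda>p. g (a0 ((snd p)(m := 2 * snd p m))))"
        by (rule continuous_map_upd[OF ga0]; (intro continuous_intros)?) (use tm in \<open>auto\<close>)
      show "continuous_map (top_of_set {p \<in> {0..1} \<times> ?I. 1 / 2 \<le> snd p m}) Y (\<lambda>p. \<Psi> (fst p, (snd p)(m := 2 * snd p m - 1)))"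
      proof (rule continuous_map_compose_on[OF \<Psi>(1)])
        fix p assume "p \<in> {p \<in> {0..1} \<times> ?I. 1 / 2 \<le> snd p m}"
        then have "0 \<le> fst p" "fst p \<le> 1" "snd p \<in> ?I" "0 \<le> 2 * snd p m - 1" "2 * snd p m - 1 \<le> 1"
          using tm[of "snd p"] by (simp_all add: mem_Times_iff)
        then show "(fst p, (snd p)(m := 2 * snd p m - 1)) \<in> {0..1} \<times> ?I"
          using box_upd by (simp add: mem_Times_iff)
      qed (rule continuous_on_Pair continuous_on_upd; intro continuous_intros)+
      show "g (a0 ((snd p)(m := 2 * snd p m))) = \<Psi> (fst p, (snd p)(m := 2 * snd p m - 1))"
        if p: "p \<in> {0..1} \<times> ?I" "snd p m = 1 / 2" for p
      proof -
        have "0 \<le> fst p" "fst p \<le> 1" and t: "snd p \<in> ?I" using p(1) by (simp_all add: mem_Times_iff)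
        then show ?thesis
          using v1[OF t] \<Psi>(3)[OF _ _ bd[OF t, of 0], of "fst p"] half[of "snd p", OF p(2)] by simp
      qed
    qed (intro continuous_intros)
    fix t assume t: "t \<in> ?I"
    show "?H (0, t) = g (a' t)" "?H (1, t) = E t"
      using \<Psi>(2)[OF box_upd[OF t], of "2 * t m - 1"] tm[OF t] by (auto simp: a'_def E_def)
  next
    fix s t assume s: "s \<in> {0..1::real}" and t: "t \<in> ?bd"
    have tI: "t \<in> ?I" by (rule cube_boundary_subset[OF t])
    consider "t m = 0" | "t m = 1" | "\<exists>i<m. t i = 0 \<or> t i = 1" using bd_cases[OF t] by blast
    then show "(if snd (s, t) m \<le> 1 / 2 then g (a0 ((snd (s, t))(m := 2 * snd (s, t) m))) else \<Psi> (fst (s, t), (snd (s, t))(m := 2 * snd (s, t) m - 1))) = g (a t)"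
    proof cases
      case 1
      then have "t(m := 0) = t" by auto
      then show ?thesis using a0(2)[OF t] 1 by simp
    next
      case 2
      then show ?thesis using \<Psi>(3)[OF _ _ bd[OF tI, of 1], of s] s a_b[OF t] by simp
    next
      case 3
      then show ?thesis
        using vl[OF tI 3] \<Psi>(3)[of s "t(m := 2 * t m - 1)"] lat[OF tI 3] tm[OF tI] s by simp
    qed
  qed
  define F where "F t = v (t(m := max 0 (4 * t m - 3)))" for t
  have 2: "homotopic_with ?P (cube (Suc m)) Y E F"
    unfolding homotopic_with_box
  proof (intro exI conjI ballI)
    let ?r = "\<lambda>p :: real \<times> (nat \<Rightarrow> real). max 0 (min (min (2 * snd p m) (3 - 4 * snd p m)) (1 - fst p))"
    let ?H = "\<lambda>p. if snd p m \<le> 3 / 4 then g (a0 ((snd p)(m := ?r p))) else v ((snd p)(m := 4 * snd p m - 3))"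
    show "continuous_map (top_of_set ({0..1} \<times> ?I)) Y ?H"
    proof (rule continuous_map_paste_le)
      show "continuous_map (top_of_set {p \<in> {0..1} \<times> ?I. snd p m \<le> 3 / 4}) Y (\<lambda>p. g (a0 ((snd p)(m := ?r p))))"
        by (rule continuous_map_upd[OF ga0]; (intro continuous_intros)?) (use tm in \<open>auto\<close>)
      show "continuous_map (top_of_set {p \<in> {0..1} \<times> ?I. 3 / 4 \<le> snd p m}) Y (\<lambda>p. v ((snd p)(m := 4 * snd p m - 3)))"
        by (rule continuous_map_upd[OF v(1)]; (intro continuous_intros)?) (use tm in \<open>auto\<close>)
      show "g (a0 ((snd p)(m := ?r p))) = v ((snd p)(m := 4 * snd p m - 3))"
        if p: "p \<in> {0..1} \<times> ?I" "snd p m = 3 / 4" for p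
      proof -
        have e: "?r p = 0" "4 * snd p m - 3 = 0" using p by auto
        show ?thesis unfolding e using v0[of "snd p"] p(1) by (simp add: mem_Times_iff)
      qed
    qed (intro continuous_intros)
    fix t assume t: "t \<in> ?I"
    note tm' = tm[OF t]
    show "?H (0, t) = E t"
    proof -
      consider "t m \<le> 1 / 2" | "1 / 2 < t m" "t m \<le> 3 / 4" | "3 / 4 < t m" by linarith
      then show ?thesis
      proof cases
        case 1
        then have "?r (0, t) = 2 * t m" using tm' by auto
        then show ?thesis using 1 by (simp add: E_def)
      next
        case 2
        then have "?r (0, t) = 3 - 4 * t m" using tm' by auto
        moreover have "1 - 2 * (2 * t m - 1) = 3 - 4 * t m" "2 * t m - 1 \<le> 1 / 2" using 2 by auto
        ultimately show ?thesis using 2 by (simp add: E_def d_def)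
      next
        case 3
        moreover have "2 * (2 * t m - 1) - 1 = 4 * t m - 3" by simp
        ultimately show ?thesis by (simp add: E_def d_def)
      qed
    qed
    show "?H (1, t) = F t"
    proof (cases "t m \<le> 3 / 4")
      case True
      then have "?r (1, t) = 0" "max 0 (4 * t m - 3) = 0" by auto
      then show ?thesis using True v0[OF t] by (simp add: F_def)
    next
      case False
      then have "max 0 (4 * t m - 3) = 4 * t m - 3" by simp
      then show ?thesis using False by (simp add: F_def)
    qed
  next
    let ?r = "\<lambda>p :: real \<times> (nat \<Rightarrow> real). max 0 (min (min (2 * snd p m) (3 - 4 * snd p m)) (1 - fst p))"
    fix s t assume s: "s \<in> {0..1::real}" and t: "t \<in> ?bd"
    have tI: "t \<in> ?I" by (rule cube_boundary_subset[OF t])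
    consider "t m = 0" | "t m = 1" | "\<exists>i<m. t i = 0 \<or> t i = 1" using bd_cases[OF t] by blast
    then show "(if snd (s, t) m \<le> 3 / 4 then g (a0 ((snd (s, t))(m := ?r (s, t)))) else v ((snd (s, t))(m := 4 * snd (s, t) m - 3))) = g (a t)"
    proof cases
      case 1
      then have "t(m := 0) = t" "?r (s, t) = 0" using s by auto
      then show ?thesis using a0(2)[OF t] 1 by simp
    next
      case 2
      then show ?thesis using v1[OF tI] a_b[OF t] by simp
    next
      case 3
      have "0 \<le> ?r (s, t)" "?r (s, t) \<le> 1" using s by auto
      then show ?thesis
        using vl[OF tI 3] tm[OF tI] by simp
    qed
  qed
  have 3: "homotopic_with ?P (cube (Suc m)) Y F v"
    unfolding homotopic_with_box
  proof (intro exI conjI ballI)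
    let ?r = "\<lambda>p :: real \<times> (nat \<Rightarrow> real). (1 - fst p) * max 0 (4 * snd p m - 3) + fst p * snd p m"
    let ?H = "\<lambda>p. v ((snd p)(m := ?r p))"
    have r: "0 \<le> ?r p" "?r p \<le> 1" if "p \<in> {0..1} \<times> ?I" for p
    proof -
      have f: "0 \<le> fst p" "fst p \<le> 1" and s: "0 \<le> snd p m" "snd p m \<le> 1" using that tm[of "snd p"] by (simp_all add: mem_Times_iff)
      then show "0 \<le> ?r p" by simp
      have "?r p \<le> (1 - fst p) * 1 + fst p * 1"
        using f s by (intro add_mono mult_left_mono) auto
      then show "?r p \<le> 1" by simp
    qed
    show "continuous_map (top_of_set ({0..1} \<times> ?I)) Y ?H"
      by (rule continuous_map_upd[OF v(1)]; (intro continuous_intros)?) (use r in auto)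
    fix t assume t: "t \<in> ?I"
    show "?H (0, t) = F t" "?H (1, t) = v t" by (simp_all add: F_def)
  next
    let ?r = "\<lambda>p :: real \<times> (nat \<Rightarrow> real). (1 - fst p) * max 0 (4 * snd p m - 3) + fst p * snd p m"
    fix s t assume s: "s \<in> {0..1::real}" and t: "t \<in> ?bd"
    have tI: "t \<in> ?I" by (rule cube_boundary_subset[OF t])
    consider "t m = 0" | "t m = 1" | "\<exists>i<m. t i = 0 \<or> t i = 1" using bd_cases[OF t] by blast
    then show "v ((snd (s, t))(m := ?r (s, t))) = g (a t)"
    proof cases
      case 3
      have "?r (s, t) \<le> (1 - s) * 1 + s * 1"
        using s tm[OF tI] by (simp only: fst_conv snd_conv) (intro add_mono mult_left_mono; auto)
      then have "0 \<le> ?r (s, t)" "?r (s, t) \<le> 1" using s tm[OF tI] by simp_all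
      then show ?thesis using vl[OF tI 3] by simp
    next
      case 1
      then have "?r (s, t) = t m" by simp
      then have "(snd (s, t))(m := ?r (s, t)) = t" by (simp add: fun_eq_iff)
      then show ?thesis using v(2) t by metis
    next
      case 2
      then have "?r (s, t) = t m" by simp
      then have "(snd (s, t))(m := ?r (s, t)) = t" by (simp add: fun_eq_iff)
      then show ?thesis using v(2) t by metis
    qed
  qed
  have "homotopic_with ?P (cube (Suc m)) Y (\<lambda>t. g (a' t)) v"
    by (rule homotopic_with_trans[OF homotopic_with_trans[OF 1 2] 3])
  then obtain H where H: "continuous_map (top_of_set ({0..1::real} \<times> ?I)) Y H"
    "\<forall>t\<in>?I. H (0, t) = g (a' t) \<and> H (1, t) = v t" "\<forall>s\<in>{0..1}. \<forall>t\<in>?bd. H (s, t) = g (a t)"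
    unfolding homotopic_with_box by blast
  have "continuous_map (top_of_set (?I \<times> {0..1::real})) Y (\<lambda>p. H (snd p, fst p))"
    by (rule continuous_map_compose_on[OF H(1) continuous_on_Pair[OF continuous_on_snd[OF continuous_on_id] continuous_on_fst[OF continuous_on_id]]])
       (simp add: mem_Times_iff)
  with H a' a'_bd show "\<exists>a' K. continuous_map (top_of_set ?I) X a' \<and> (\<forall>t\<in>?bd. a' t = a t) \<and>
      continuous_map (top_of_set (?I \<times> {0..1::real})) Y K \<and> (\<forall>t\<in>?I. K (t, 0) = g (a' t) \<and> K (t, 1) = v t) \<and>
      (\<forall>t\<in>?bd. \<forall>s\<in>{0..1}. K (t, s) = g (a t))"
    by (intro exI[of _ a'] exI[of _ "\<lambda>p. H (snd p, fst p)"]) simp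
qed

section \<open>Lifting problems along weak homotopy equivalences\<close>

lemma simplex_boundary_1: "x \<in> simplex_boundary (Suc 0) \<Longrightarrow> x = std_vertex 0 \<or> x = std_vertex 1"
proof -
  assume x: "x \<in> simplex_boundary (Suc 0)"
  then have "x 0 + x 1 = 1" "\<And>i. 1 < i \<Longrightarrow> x i = 0" "x 0 = 0 \<or> x 1 = 0"
    using standard_simplexD(3,4)[OF boundary_subset[OF x]] by (auto simp: simplex_boundary_def le_Suc_eq)
  then consider "x 0 = 1" "x 1 = 0" | "x 0 = 0" "x 1 = 1" by fastforce
  then show ?thesis
  proof cases
    case 1
    have "x i = std_vertex 0 i" for i
      using 1 \<open>\<And>i. 1 < i \<Longrightarrow> x i = 0\<close>[of i] by (cases "i = 0"; cases "i = 1") auto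
    then show ?thesis by blast
  next
    case 2
    have "x i = std_vertex 1 i" for i
      using 2 \<open>\<And>i. 1 < i \<Longrightarrow> x i = 0\<close>[of i] by (cases "i = 0"; cases "i = 1") auto
    then show ?thesis by blast
  qed
qed

text \<open>The push is a homotopy of the boundary map to one that is constant on the faces that contain the last
  vertex. Pulled back to the cube, such a map is constant off the bottom face.\<close>

theorem solvable_weak_homotopy_equivalence:
  assumes g: "weak_homotopy_equivalence X Y g" and b: "b \<in> topspace X"
    and \<alpha>: "continuous_map (top_of_set (simplex_boundary (Suc m))) X \<alpha>"
    and \<alpha>_b: "\<And>i. i \<le> Suc m \<Longrightarrow> \<alpha> (std_vertex i) = b"
  shows "solvable (Suc m) X Y g \<alpha>"
proof -
  let ?n = "Suc m"
  have cont: "continuous_map X Y g" using g by (simp add: weak_homotopy_equivalence_def)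
  define h where "h = (\<lambda>(x, \<tau>). \<alpha> (push ?n \<tau> x))"
  have h: "continuous_map (top_of_set (simplex_boundary ?n \<times> {0..1})) X h"
  proof -
    have "continuous_map (top_of_set (simplex_boundary ?n \<times> {0..1})) X (\<lambda>p. \<alpha> (case p of (x, \<tau>) \<Rightarrow> push ?n \<tau> x))"
      by (rule continuous_map_compose_on[OF \<alpha> continuous_on_push]) (auto intro: push_props)
    then show ?thesis by (rule continuous_map_top_of_set_cong) (auto simp: h_def)
  qed
  let ?a = "\<lambda>t. h (unfold_box ?n t, 1)"
  have "box_solvable ?n X Y g ?a"
  proof (rule box_solvable_if_based[OF g b])
    show "continuous_map (top_of_set (cube_boundary ?n)) X ?a"
      by (rule continuous_map_compose_on[OF h])
         (auto intro!: continuous_intros simp: unfold_box_boundary cube_boundary_subset)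
    fix t assume t: "t \<in> cube_boundary ?n" and star: "t m = 1 \<or> (\<exists>i<m. t i = 0 \<or> t i = 1) \<or> m = 0"
    have x: "unfold_box ?n t \<in> simplex_boundary ?n"
      using t unfold_box_boundary[OF cube_boundary_subset[OF t]] by simp
    show "?a t = b"
    proof (cases "m = 0")
      case True
      have "push ?n 1 (unfold_box ?n t) \<in> simplex_boundary ?n" by (intro push_props x) auto
      then have "push ?n 1 (unfold_box ?n t) = std_vertex 0 \<or> push ?n 1 (unfold_box ?n t) = std_vertex 1"
        using simplex_boundary_1 True by simp
      then show ?thesis using \<alpha>_b[of 0] \<alpha>_b[of 1] unfolding h_def by auto
    next
      case False
      then have "(\<exists>i<?n. t i = 1) \<or> (\<exists>i<?n - 1. t i = 0)" using star by (auto intro: less_SucI)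
      then have "push ?n 1 (unfold_box ?n t) = std_vertex ?n"
        by (intro push_props(3)[OF _ x, of 0] unfold_box_star) auto
      then show ?thesis using \<alpha>_b[of ?n] by (simp add: h_def)
    qed
  qed
  then have "solvable ?n X Y g (\<lambda>x. h (x, 1))"
    by (intro solvable_if_strictly_solvable strictly_solvable_if_box_solvable)
  then have "solvable ?n X Y g (\<lambda>x. h (x, 0))"
    by (rule solvable_homotopy[OF h cont])
  moreover have "h (x, 0) = \<alpha> x" if "x \<in> simplex_boundary ?n" for x
    using push_props(2)[OF _ that, of 0] by (simp add: h_def)
  ultimately show ?thesis
    unfolding solvable_def by simp
qed

section \<open>Singular simplices\<close>

lemma continuous_on_simplex_push [continuous_intros]:
  assumes "continuous_on S f"
  shows "continuous_on S (\<lambda>x. simplex_push m \<theta> (f x) j)" "continuous_on S (\<lambda>x. simplex_push m \<theta> (f x))"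
proof -
  show *: "continuous_on S (\<lambda>x. simplex_push m \<theta> (f x) j)" for j
    unfolding simplex_push_def by (intro continuous_on_sum continuous_on_product_then_coordinatewise[OF assms])
  then show "continuous_on S (\<lambda>x. simplex_push m \<theta> (f x))"
    by (rule continuous_on_coordinatewise_then_product)
qed

lemma simplex_push_compose:
  assumes "\<theta> \<in> Delta m n" "\<eta> \<in> Delta l m"
  shows "simplex_push m \<theta> (simplex_push l \<eta> t) = simplex_push l (compose {..l} \<theta> \<eta>) t"
proof
  fix j
  let ?S = "{k. k \<le> l \<and> \<theta> (\<eta> k) = j}" and ?T = "{i. i \<le> m \<and> \<theta> i = j}"
  have "(\<Sum>i\<in>?T. \<Sum>k\<in>{k \<in> ?S. \<eta> k = i}. t k) = (\<Sum>k\<in>?S. t k)"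
    by (rule sum.group) (use DeltaD(2)[OF assms(2)] in auto)
  moreover have "{k \<in> ?S. \<eta> k = i} = {k. k \<le> l \<and> \<eta> k = i}" if "i \<in> ?T" for i using that by auto
  moreover have "{k. k \<le> l \<and> compose {..l} \<theta> \<eta> k = j} = ?S" by (auto simp: compose_def)
  ultimately show "simplex_push m \<theta> (simplex_push l \<eta> t) j = simplex_push l (compose {..l} \<theta> \<eta>) t j"
    by (simp add: simplex_push_def)
qed

lemma simplex_push_id:
  assumes "t \<in> standard_simplex n"
  shows "simplex_push n (\<lambda>i\<in>{..n}. i) t = t"
proof
  fix j
  have "{i. i \<le> n \<and> (\<lambda>i\<in>{..n}. i) i = j} = (if j \<le> n then {j} else {})" by auto
  then show "simplex_push n (\<lambda>i\<in>{..n}. i) t j = t j"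
    using standard_simplexD(3)[OF assms] by (simp add: simplex_push_def)
qed

lemma simplex_push_vertex:
  assumes "i \<le> m"
  shows "simplex_push m \<theta> (std_vertex i) = std_vertex (\<theta> i)"
  using assms by (auto simp: simplex_push_def fun_eq_iff sum.delta)

lemma simplices_Sing:
  "\<sigma> \<in> simplices (Sing X b) n \<longleftrightarrow> continuous_map (top_of_set (standard_simplex n)) X \<sigma> \<and>
     \<sigma> \<in> extensional (standard_simplex n) \<and> (\<forall>i\<le>n. \<sigma> (std_vertex i) = b)"
  by (simp add: Sing_def singular_simplex_def euclidean_product_topology)

lemma act_Sing: "act (Sing X b) n m \<theta> \<sigma> = (\<lambda>t\<in>standard_simplex m. \<sigma> (simplex_push m \<theta> t))"
  by (simp add: Sing_def o_def)

lemma act_Sing_in: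
  assumes "\<theta> \<in> Delta m n" "\<sigma> \<in> simplices (Sing X b) n"
  shows "act (Sing X b) n m \<theta> \<sigma> \<in> simplices (Sing X b) m"
proof -
  have "continuous_map (top_of_set (standard_simplex m)) X (\<lambda>t. \<sigma> (simplex_push m \<theta> t))"
    using assms(2) simplex_push_in_standard_simplex[OF assms(1)]
    by (intro continuous_map_compose_on[of "standard_simplex n" X \<sigma>, OF _ continuous_on_simplex_push(2)[OF continuous_on_id]])
      (simp_all add: simplices_Sing)
  then have "continuous_map (top_of_set (standard_simplex m)) X (act (Sing X b) n m \<theta> \<sigma>)"
    unfolding act_Sing by (rule continuous_map_top_of_set_cong) simp
  then show ?thesis
    using assms(2) DeltaD(2)[OF assms(1)] by (auto simp: simplices_Sing act_Sing simplex_push_vertex)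
qed

lemma simplicial_set_Sing: "simplicial_set (Sing X b)"
  unfolding simplicial_set_def
proof (intro conjI allI ballI)
  fix n m l \<theta> \<eta> \<sigma> assume "\<theta> \<in> Delta m n" "\<eta> \<in> Delta l m" "\<sigma> \<in> simplices (Sing X b) n"
  then show "act (Sing X b) m l \<eta> (act (Sing X b) n m \<theta> \<sigma>) = act (Sing X b) n l (compose {..l} \<theta> \<eta>) \<sigma>"
    by (auto simp: act_Sing fun_eq_iff simplex_push_compose simplex_push_in_standard_simplex)
next
  fix n \<sigma> assume "\<sigma> \<in> simplices (Sing X b) n"
  then show "act (Sing X b) n n (\<lambda>i\<in>{..n}. i) \<sigma> = \<sigma>"
    by (auto simp: act_Sing simplices_Sing simplex_push_id fun_eq_iff extensional_def)
qed (rule act_Sing_in)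

lemma reduced_Sing:
  assumes "b \<in> topspace X"
  shows "reduced_sset (Sing X b)"
proof -
  let ?c = "\<lambda>x\<in>standard_simplex 0. b"
  have "continuous_map (top_of_set (standard_simplex 0)) X (\<lambda>_. b)" using assms by simp
  then have "continuous_map (top_of_set (standard_simplex 0)) X ?c"
    by (rule continuous_map_top_of_set_cong) simp
  then have "?c \<in> simplices (Sing X b) 0" by (simp add: simplices_Sing)
  moreover have "\<sigma> = ?c" if "\<sigma> \<in> simplices (Sing X b) 0" for \<sigma>
    using that by (intro extensionalityI[of _ "standard_simplex 0"]) (auto simp: simplices_Sing standard_simplex_0)
  ultimately have "simplices (Sing X b) 0 = {?c}" by blast
  then show ?thesis
    unfolding reduced_sset_def by (intro conjI exI[of _ ?c] simplicial_set_Sing)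
qed

section \<open>The path fibration of a map\<close>

text \<open>The singular simplices of the space of pairs of a point in the source and a path in the target that starts
  at its image, with all vertices at the constant path at the base point. Simplices of paths are given as maps on
  cylinders.\<close>

definition path_sset :: "'a topology \<Rightarrow> 'b topology \<Rightarrow> ('a \<Rightarrow> 'b) \<Rightarrow> 'a \<Rightarrow>
    (((nat \<Rightarrow> real) \<Rightarrow> 'a) \<times> ((nat \<Rightarrow> real) \<times> real \<Rightarrow> 'b)) sset" where
  "path_sset X Y g b =
     \<lparr>simplices = (\<lambda>n. {(\<sigma>, H). \<sigma> \<in> simplices (Sing X b) n \<and> continuous_map (top_of_set (cyl n)) Y H \<and>
         H \<in> extensional (cyl n) \<and> (\<forall>x\<in>standard_simplex n. H (x, 0) = g (\<sigma> x)) \<and>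
         (\<forall>i\<le>n. \<forall>s\<in>{0..1}. H (std_vertex i, s) = g b)}),
      act = (\<lambda>n m \<theta> (\<sigma>, H). (act (Sing X b) n m \<theta> \<sigma>, \<lambda>p\<in>cyl m. H (simplex_push m \<theta> (fst p), snd p)))\<rparr>"

lemma simplices_path_sset:
  "(\<sigma>, H) \<in> simplices (path_sset X Y g b) n \<longleftrightarrow> \<sigma> \<in> simplices (Sing X b) n \<and> continuous_map (top_of_set (cyl n)) Y H \<and>
     H \<in> extensional (cyl n) \<and> (\<forall>x\<in>standard_simplex n. H (x, 0) = g (\<sigma> x)) \<and>
     (\<forall>i\<le>n. \<forall>s\<in>{0..1}. H (std_vertex i, s) = g b)"
  by (simp add: path_sset_def)

lemma act_path_sset:
  "act (path_sset X Y g b) n m \<theta> (\<sigma>, H) = (act (Sing X b) n m \<theta> \<sigma>, \<lambda>p\<in>cyl m. H (simplex_push m \<theta> (fst p), snd p))"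
  by (simp add: path_sset_def)

lemma continuous_map_push_cyl:
  assumes "\<theta> \<in> Delta m n" "continuous_map (top_of_set (cyl n)) Y H"
  shows "continuous_map (top_of_set (cyl m)) Y (\<lambda>p. H (simplex_push m \<theta> (fst p), snd p))"
proof (rule continuous_map_compose_on[OF assms(2)])
  show "continuous_on (cyl m) (\<lambda>p. (simplex_push m \<theta> (fst p), snd p))"
    by (rule continuous_on_Pair continuous_on_simplex_push continuous_on_fst continuous_on_snd continuous_on_id)+
qed (use simplex_push_in_standard_simplex[OF assms(1)] in \<open>simp add: mem_Times_iff\<close>)

lemma simplicial_set_path_sset: "simplicial_set (path_sset X Y g b)"
  unfolding simplicial_set_def
proof (intro conjI allI ballI)
  fix n m \<theta> x assume \<theta>: "\<theta> \<in> Delta m n" and x: "x \<in> simplices (path_sset X Y g b) n"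
  obtain \<sigma> H where xx: "x = (\<sigma>, H)" by (cases x)
  have "continuous_map (top_of_set (cyl m)) Y (\<lambda>p\<in>cyl m. H (simplex_push m \<theta> (fst p), snd p))"
    using x by (intro continuous_map_top_of_set_cong[OF continuous_map_push_cyl[OF \<theta>]]) (auto simp: xx simplices_path_sset)
  then show "act (path_sset X Y g b) n m \<theta> x \<in> simplices (path_sset X Y g b) m"
    using x act_Sing_in[OF \<theta>] DeltaD(2)[OF \<theta>] simplex_push_in_standard_simplex[OF \<theta>]
    by (auto simp: xx simplices_path_sset act_path_sset simplex_push_vertex act_Sing)
next
  fix n m l \<theta> \<eta> x assume \<theta>: "\<theta> \<in> Delta m n" and \<eta>: "\<eta> \<in> Delta l m" and x: "x \<in> simplices (path_sset X Y g b) n"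
  obtain \<sigma> H where xx: "x = (\<sigma>, H)" by (cases x)
  then have "\<sigma> \<in> simplices (Sing X b) n" using x by (simp add: simplices_path_sset)
  from simplicial_setD(3)[OF simplicial_set_Sing this \<theta> \<eta>] show "act (path_sset X Y g b) m l \<eta> (act (path_sset X Y g b) n m \<theta> x) =
      act (path_sset X Y g b) n l (compose {..l} \<theta> \<eta>) x"
    using \<theta> \<eta> by (auto simp: xx act_path_sset fun_eq_iff simplex_push_compose simplex_push_in_standard_simplex)
next
  fix n x assume x: "x \<in> simplices (path_sset X Y g b) n"
  obtain \<sigma> H where xx: "x = (\<sigma>, H)" by (cases x)
  then show "act (path_sset X Y g b) n n (\<lambda>i\<in>{..n}. i) x = x"
    using x simplicial_setD(2)[OF simplicial_set_Sing, of \<sigma> X b n]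
    by (auto simp: act_path_sset simplices_path_sset simplex_push_id fun_eq_iff extensional_def)
qed

definition const_path :: "('a \<Rightarrow> 'b) \<Rightarrow> nat \<Rightarrow> ((nat \<Rightarrow> real) \<Rightarrow> 'a) \<Rightarrow> ((nat \<Rightarrow> real) \<Rightarrow> 'a) \<times> ((nat \<Rightarrow> real) \<times> real \<Rightarrow> 'b)" where
  "const_path g n \<sigma> = (\<sigma>, \<lambda>p\<in>cyl n. g (\<sigma> (fst p)))"

definition path_end :: "nat \<Rightarrow> ((nat \<Rightarrow> real) \<Rightarrow> 'a) \<times> ((nat \<Rightarrow> real) \<times> real \<Rightarrow> 'b) \<Rightarrow> (nat \<Rightarrow> real) \<Rightarrow> 'b" where
  "path_end n = (\<lambda>(\<sigma>, H). \<lambda>x\<in>standard_simplex n. H (x, 1))"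

lemma fst_const_path [simp]: "fst (const_path g n \<sigma>) = \<sigma>"
  by (simp add: const_path_def)

lemma sset_map_const_path:
  assumes g: "continuous_map X Y g"
  shows "sset_map (Sing X b) (path_sset X Y g b) (const_path g)"
  unfolding sset_map_def
proof (intro conjI allI ballI)
  fix n \<sigma> assume \<sigma>: "\<sigma> \<in> simplices (Sing X b) n"
  have "continuous_map (top_of_set (cyl n)) X (\<lambda>p. \<sigma> (fst p))"
    using \<sigma> by (intro continuous_map_compose_on[of "standard_simplex n" X \<sigma>, OF _ continuous_on_fst[OF continuous_on_id]])
      (auto simp: simplices_Sing)
  then have "continuous_map (top_of_set (cyl n)) Y (g \<circ> (\<lambda>p. \<sigma> (fst p)))"
    by (rule continuous_map_compose[OF _ g])
  then have "continuous_map (top_of_set (cyl n)) Y (\<lambda>p\<in>cyl n. g (\<sigma> (fst p)))"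
    by (rule continuous_map_top_of_set_cong) simp
  then show "const_path g n \<sigma> \<in> simplices (path_sset X Y g b) n"
    using \<sigma> by (auto simp: const_path_def simplices_path_sset) (auto simp: simplices_Sing)
  fix m \<theta> assume \<theta>: "\<theta> \<in> Delta m n"
  show "const_path g m (act (Sing X b) n m \<theta> \<sigma>) = act (path_sset X Y g b) n m \<theta> (const_path g n \<sigma>)"
    using simplex_push_in_standard_simplex[OF \<theta>]
    by (auto simp: const_path_def act_path_sset act_Sing fun_eq_iff)
qed

lemma sset_map_path_source: "sset_map (path_sset X Y g b) (Sing X b) (\<lambda>n. fst)"
  unfolding sset_map_def by (auto simp: simplices_path_sset act_path_sset)

lemma sset_map_path_end: "sset_map (path_sset X Y g b) (Sing Y (g b)) path_end"
  unfolding sset_map_def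
proof (intro conjI allI ballI)
  fix n x assume x: "x \<in> simplices (path_sset X Y g b) n"
  obtain \<sigma> H where xx: "x = (\<sigma>, H)" by (cases x)
  have "continuous_map (top_of_set (standard_simplex n)) Y (\<lambda>t. H (t, 1))"
    using x by (intro continuous_map_compose_on[of "cyl n" Y H, OF _ continuous_on_Pair[OF continuous_on_id continuous_on_const]])
      (auto simp: xx simplices_path_sset)
  then have "continuous_map (top_of_set (standard_simplex n)) Y (path_end n x)"
    by (rule continuous_map_top_of_set_cong) (simp add: path_end_def xx)
  then show "path_end n x \<in> simplices (Sing Y (g b)) n"
    using x by (auto simp: simplices_Sing) (auto simp: path_end_def xx simplices_path_sset)
  fix m \<theta> assume \<theta>: "\<theta> \<in> Delta m n"
  show "path_end m (act (path_sset X Y g b) n m \<theta> x) = act (Sing Y (g b)) n m \<theta> (path_end n x)"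
    using simplex_push_in_standard_simplex[OF \<theta>] by (auto simp: xx act_path_sset path_end_def act_Sing fun_eq_iff)
qed

lemma path_end_const_path: "path_end n (const_path g n \<sigma>) = simplex_map n g \<sigma>"
  by (auto simp: path_end_def const_path_def simplex_map_def fun_eq_iff)

lemma simplices_path_sset_0:
  assumes "x \<in> simplices (path_sset X Y g b) 0"
  shows "x = const_path g 0 (\<lambda>t\<in>standard_simplex 0. b)"
proof -
  obtain \<sigma> H where xx: "x = (\<sigma>, H)" by (cases x)
  have "\<sigma> = (\<lambda>t\<in>standard_simplex 0. b)"
    using assms by (intro extensionalityI[of _ "standard_simplex 0"])
      (auto simp: xx simplices_path_sset simplices_Sing standard_simplex_0)
  moreover have "H = (\<lambda>p\<in>cyl 0. g b)"
    using assms by (intro extensionalityI[of _ "cyl 0"]) (auto simp: xx simplices_path_sset standard_simplex_0)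
  ultimately show ?thesis
    by (auto simp: xx const_path_def fun_eq_iff)
qed

lemma reduced_path_sset:
  assumes g: "continuous_map X Y g" and b: "b \<in> topspace X"
  shows "reduced_sset (path_sset X Y g b)"
proof -
  obtain c where "simplices (Sing X b) 0 = {c}" using reduced_Sing[OF b] unfolding reduced_sset_def by blast
  then have c: "const_path g 0 c \<in> simplices (path_sset X Y g b) 0"
    using sset_mapD(1)[OF sset_map_const_path[OF g], of c b 0] by simp
  moreover have "x = const_path g 0 c" if "x \<in> simplices (path_sset X Y g b) 0" for x
    using simplices_path_sset_0[OF that] simplices_path_sset_0[OF c] by simp
  ultimately have "simplices (path_sset X Y g b) 0 = {const_path g 0 c}" by blast
  then show ?thesis
    unfolding reduced_sset_def by (intro conjI exI[of _ "const_path g 0 c"] simplicial_set_path_sset)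
qed

section \<open>The end point map is a trivial fibration\<close>

definition drop_coord :: "nat \<Rightarrow> (nat \<Rightarrow> real) \<Rightarrow> nat \<Rightarrow> real" where
  "drop_coord i x = (\<lambda>j. if j < i then x j else x (Suc j))"

lemma continuous_on_drop_coord: "continuous_on S f \<Longrightarrow> continuous_on S (\<lambda>x. drop_coord i (f x))"
proof (rule continuous_on_coordinatewise_then_product)
  fix j assume "continuous_on S f"
  then show "continuous_on S (\<lambda>x. drop_coord i (f x) j)"
    unfolding drop_coord_def by (cases "j < i") (simp_all add: continuous_on_product_then_coordinatewise)
qed

lemma simplex_push_coface:
  "simplex_push n (coface (Suc n) i) y j = (if j < i then (if j \<le> n then y j else 0) else if j = i then 0 else if j \<le> Suc n then y (j - 1) else 0)"
proof -
  have "{k. k \<le> n \<and> coface (Suc n) i k = j} =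
      (if j < i then (if j \<le> n then {j} else {}) else if j = i then {} else if j \<le> Suc n then {j - 1} else {})"
    by (auto simp: coface_def split: if_splits)
  then show ?thesis by (simp add: simplex_push_def)
qed

lemma simplex_push_drop_coord:
  assumes "x \<in> standard_simplex (Suc n)" "i \<le> Suc n" "x i = 0"
  shows "simplex_push n (coface (Suc n) i) (drop_coord i x) = x"
  using standard_simplexD(3)[OF assms(1)] assms(2,3)
  by (auto simp: simplex_push_coface drop_coord_def fun_eq_iff)

lemma drop_coord_push:
  assumes "y \<in> standard_simplex n" "i \<le> Suc n"
  shows "drop_coord i (simplex_push n (coface (Suc n) i) y) = y"
  using standard_simplexD(3)[OF assms(1)] assms(2)
  by (auto simp: simplex_push_coface drop_coord_def fun_eq_iff)

lemma drop_coord_in_simplex: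
  assumes x: "x \<in> standard_simplex (Suc n)" "i \<le> Suc n" "x i = 0"
  shows "drop_coord i x \<in> standard_simplex n"
proof (rule standard_simplexI)
  have "(\<Sum>j\<le>Suc n. x j) = sum x ({..Suc n} - {i})"
    using x by (intro sum.mono_neutral_right) auto
  also have "\<dots> = (\<Sum>j\<le>n. drop_coord i x j)"
    by (rule sum.reindex_bij_witness[of _ "\<lambda>j. if j < i then j else Suc j" "\<lambda>j. if j < i then j else j - 1"])
       (use x(2) in \<open>auto simp: drop_coord_def\<close>)
  finally show "(\<Sum>j\<le>n. drop_coord i x j) = 1" using standard_simplexD(4)[OF x(1)] by simp
qed (use standard_simplexD(1,3)[OF x(1)] x(2) in \<open>auto simp: drop_coord_def\<close>)

text \<open>Two faces of a simplex that contain a common point have a common face that contains it.\<close>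

lemma drop_two_coords:
  assumes x: "x \<in> standard_simplex (Suc n)" and ij: "i < j" "j \<le> Suc n" "x i = 0" "x j = 0"
  obtains m y where "n = Suc m" "y \<in> standard_simplex m"
    "drop_coord j x = simplex_push m (coface n i) y" "drop_coord i x = simplex_push m (coface n (j - 1)) y"
proof -
  have "n \<noteq> 0"
  proof
    assume "n = 0"
    then have "i = 0" "j = Suc 0" using ij by auto
    then have "x 0 = 0" "x (Suc 0) = 0" using ij by simp_all
    then have "(\<Sum>k\<le>Suc n. x k) = 0" using \<open>n = 0\<close> by simp
    then show False using standard_simplexD(4)[OF x] by simp
  qed
  then obtain m where m: "n = Suc m" by (cases n) auto
  have j: "drop_coord j x \<in> standard_simplex (Suc m)" "drop_coord j x i = 0"
    using drop_coord_in_simplex[OF x ij(2,4)] ij m by (auto simp: drop_coord_def)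
  have i: "drop_coord i x \<in> standard_simplex (Suc m)" "drop_coord i x (j - 1) = 0"
    using drop_coord_in_simplex[OF x _ ij(3)] ij m by (auto simp: drop_coord_def)
  have eq: "drop_coord i (drop_coord j x) = drop_coord (j - 1) (drop_coord i x)"
    using ij by (auto simp: drop_coord_def fun_eq_iff)
  show thesis
  proof
    show "n = Suc m" by (rule m)
    show "drop_coord i (drop_coord j x) \<in> standard_simplex m"
      using drop_coord_in_simplex[OF j(1) _ j(2)] ij m by simp
    show "drop_coord j x = simplex_push m (coface n i) (drop_coord i (drop_coord j x))"
      using simplex_push_drop_coord[OF j(1) _ j(2)] ij m by simp
    show "drop_coord i x = simplex_push m (coface n (j - 1)) (drop_coord i (drop_coord j x))"
      unfolding eq using simplex_push_drop_coord[OF i(1) _ i(2)] ij m by simp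
  qed
qed

lemma paste_finite_closed:
  assumes "finite I" "S \<subseteq> (\<Union>i\<in>I. T i)"
    and "\<And>i. i \<in> I \<Longrightarrow> T i \<subseteq> S \<and> closedin (top_of_set S) (T i)"
    and "\<And>i. i \<in> I \<Longrightarrow> continuous_map (top_of_set (T i)) Y (f i)"
    and "\<And>i j x. i \<in> I \<Longrightarrow> j \<in> I \<Longrightarrow> x \<in> T i \<Longrightarrow> x \<in> T j \<Longrightarrow> f i x = f j x"
  shows "\<exists>h. continuous_map (top_of_set S) Y h \<and> (\<forall>i\<in>I. \<forall>x\<in>T i. h x = f i x)"
proof -
  have T: "subtopology (top_of_set S) (T i) = top_of_set (T i)" if "i \<in> I" for i
    using assms(3)[OF that] by (simp add: subtopology_subtopology Int_absorb1)
  obtain h where "continuous_map (top_of_set S) Y h" "\<And>x i. i \<in> I \<Longrightarrow> x \<in> topspace (top_of_set S) \<inter> T i \<Longrightarrow> h x = f i x"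
  proof (rule pasting_lemma_exists_closed[of I "top_of_set S" T Y f])
    show "finite I" "topspace (top_of_set S) \<subseteq> \<Union> (T ` I)" using assms(1,2) by simp_all
    show "closedin (top_of_set S) (T i)" if "i \<in> I" for i using assms(3)[OF that] by simp
    show "continuous_map (subtopology (top_of_set S) (T i)) Y (f i)" if "i \<in> I" for i
      unfolding T[OF that] by (rule assms(4)[OF that])
    show "f i x = f j x" if "i \<in> I" "j \<in> I" "x \<in> topspace (top_of_set S) \<inter> T i \<inter> T j" for i j x
      by (rule assms(5)[OF that(1,2)]) (use that(3) in auto)
  qed blast
  moreover have "x \<in> S" if "i \<in> I" "x \<in> T i" for i x using assms(3) that by blast
  ultimately show ?thesis by (intro exI[of _ h]) simp
qed

lemma closedin_level: "continuous_on S (p :: 'x::topological_space \<Rightarrow> real) \<Longrightarrow> closedin (top_of_set S) {x \<in> S. p x = c}"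
  using continuous_closedin_preimage_constant[of S p c] by simp

text \<open>The faces of a filling problem are pasted to a map on the boundary of a simplex and to a map on the walls
  of a cylinder; together with the simplex of end points this is a filling problem for the lid.\<close>

theorem trivial_fibration_path_end:
  assumes g: "weak_homotopy_equivalence X Y g" and b: "b \<in> topspace X"
  shows "trivial_fibration (path_sset X Y g b) (Sing Y (g b)) path_end"
  unfolding trivial_fibration_def
proof (intro conjI allI impI ballI sset_map_path_end)
  have cont: "continuous_map X Y g" using g by (simp add: weak_homotopy_equivalence_def)
  let ?P = "path_sset X Y g b" and ?L = "Sing Y (g b)"
  have gb: "g b \<in> topspace Y" using cont b by (auto simp: continuous_map_def)
  {
    fix v assume v: "v \<in> simplices ?L 0"
    obtain y where y: "y \<in> simplices ?P 0"
      using reduced_path_sset[OF cont b] unfolding reduced_sset_def by blast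
    then have "path_end 0 y \<in> simplices ?L 0" by (rule sset_mapD(1)[OF sset_map_path_end])
    then have "path_end 0 y = v"
      using v reduced_Sing[OF gb] unfolding reduced_sset_def by auto
    with y show "\<exists>y\<in>simplices ?P 0. path_end 0 y = v" by blast
  next
    fix n z v
    assume v: "v \<in> simplices ?L (Suc n)"
      and zz: "(\<forall>i\<le>Suc n. z i \<in> simplices ?P n \<and> path_end n (z i) = act ?L (Suc n) n (coface (Suc n) i) v) \<and>
        (\<forall>i j m. i < j \<and> j \<le> Suc n \<and> n = Suc m \<longrightarrow>
           act ?P n m (coface n i) (z j) = act ?P n m (coface n (j - 1)) (z i))"
    let ?D = "standard_simplex (Suc n)" and ?B = "simplex_boundary (Suc n)" and ?W = "lid (Suc n)"
    define \<sigma> where "\<sigma> i = fst (z i)" for i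
    define H where "H i = snd (z i)" for i
    have z_eq: "z i = (\<sigma> i, H i)" for i by (simp add: \<sigma>_def H_def)
    have zP: "(\<sigma> i, H i) \<in> simplices ?P n" if "i \<le> Suc n" for i
      using zz that unfolding z_eq by blast
    have \<sigma>: "continuous_map (top_of_set (standard_simplex n)) X (\<sigma> i)" "\<And>k. k \<le> n \<Longrightarrow> \<sigma> i (std_vertex k) = b" if "i \<le> Suc n" for i
      using zP[OF that] by (simp_all add: simplices_path_sset simplices_Sing)
    have H: "continuous_map (top_of_set (cyl n)) Y (H i)" "\<And>x. x \<in> standard_simplex n \<Longrightarrow> H i (x, 0) = g (\<sigma> i x)"
      "\<And>k s. k \<le> n \<Longrightarrow> s \<in> {0..1} \<Longrightarrow> H i (std_vertex k, s) = g b" if "i \<le> Suc n" for i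
      using zP[OF that] by (simp_all add: simplices_path_sset)
    have ext: "\<sigma> i \<in> extensional (standard_simplex n)" "H i \<in> extensional (cyl n)" if "i \<le> Suc n" for i
      using zP[OF that] by (simp_all add: simplices_path_sset simplices_Sing)
    have tip: "H i (x, 1) = v (simplex_push n (coface (Suc n) i) x)" if "i \<le> Suc n" "x \<in> standard_simplex n" for i x
    proof -
      have "path_end n (z i) = act ?L (Suc n) n (coface (Suc n) i) v" using zz that(1) by blast
      from fun_cong[OF this, of x] show ?thesis using that(2) by (simp add: path_end_def act_Sing z_eq)
    qed
    have agree: "\<sigma> i (drop_coord i x) = \<sigma> j (drop_coord j x) \<and> (\<forall>s\<in>{0..1}. H i (drop_coord i x, s) = H j (drop_coord j x, s))"
      if x: "x \<in> ?D" and ij: "i < j" "j \<le> Suc n" "x i = 0" "x j = 0" for i j x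
    proof -
      obtain m y where m: "n = Suc m" and y: "y \<in> standard_simplex m"
        and dj: "drop_coord j x = simplex_push m (coface n i) y" and di: "drop_coord i x = simplex_push m (coface n (j - 1)) y"
        by (rule drop_two_coords[OF x ij])
      have eq: "act ?P n m (coface n i) (z j) = act ?P n m (coface n (j - 1)) (z i)" using zz ij m by blast
      have "\<sigma> j (simplex_push m (coface n i) y) = \<sigma> i (simplex_push m (coface n (j - 1)) y)"
        using fun_cong[OF arg_cong[OF eq, of fst], of y] y by (simp add: z_eq act_path_sset act_Sing)
      moreover have "H j (simplex_push m (coface n i) y, s) = H i (simplex_push m (coface n (j - 1)) y, s)" if "s \<in> {0..1}" for s
        using fun_cong[OF arg_cong[OF eq, of snd], of "(y, s)"] y that by (simp add: z_eq act_path_sset)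
      ultimately show ?thesis by (simp add: di dj)
    qed
    have agree': "\<sigma> i (drop_coord i x) = \<sigma> j (drop_coord j x) \<and> (\<forall>s\<in>{0..1}. H i (drop_coord i x, s) = H j (drop_coord j x, s))"
      if "x \<in> ?D" "i \<le> Suc n" "j \<le> Suc n" "x i = 0" "x j = 0" for i j x
    proof (cases i j rule: linorder_cases)
      case less then show ?thesis using agree[of x i j] that by blast
    next
      case greater then show ?thesis using agree[of x j i] that by simp
    qed simp
    have "\<exists>\<alpha>. continuous_map (top_of_set ?B) X \<alpha> \<and> (\<forall>i\<in>{..Suc n}. \<forall>x\<in>{x \<in> ?B. x i = 0}. \<alpha> x = \<sigma> i (drop_coord i x))"
    proof (rule paste_finite_closed)
      show "?B \<subseteq> (\<Union>i\<in>{..Suc n}. {x \<in> ?B. x i = 0})" by (auto simp: simplex_boundary_def)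
      show "{x \<in> ?B. x i = 0} \<subseteq> ?B \<and> closedin (top_of_set ?B) {x \<in> ?B. x i = 0}" for i
        by (intro conjI closedin_level continuous_on_coord) auto
      show "continuous_map (top_of_set {x \<in> ?B. x i = 0}) X (\<lambda>x. \<sigma> i (drop_coord i x))" if "i \<in> {..Suc n}" for i
        by (rule continuous_map_compose_on[OF \<sigma>(1) continuous_on_drop_coord[OF continuous_on_id]])
           (use that drop_coord_in_simplex boundary_subset in auto)
      show "\<sigma> i (drop_coord i x) = \<sigma> j (drop_coord j x)"
        if "i \<in> {..Suc n}" "j \<in> {..Suc n}" "x \<in> {x \<in> ?B. x i = 0}" "x \<in> {x \<in> ?B. x j = 0}" for i j x
        using agree'[of x i j] that boundary_subset[of x] by simp
    qed simp
    then obtain \<alpha> where \<alpha>: "continuous_map (top_of_set ?B) X \<alpha>"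
      "\<And>i x. i \<le> Suc n \<Longrightarrow> x \<in> ?B \<Longrightarrow> x i = 0 \<Longrightarrow> \<alpha> x = \<sigma> i (drop_coord i x)" by auto
    \<comment> \<open>The walls carry the indices up to \<open>Suc n\<close>, the ceiling carries the next one.\<close>
    define T where "T i = (if i \<le> Suc n then {p \<in> ?W. fst p i = 0} else {p \<in> ?W. snd p = 1})" for i
    define f where "f i = (if i \<le> Suc n then (\<lambda>p. H i (drop_coord i (fst p), snd p)) else (\<lambda>p. v (fst p)))" for i
    have WD: "fst p \<in> ?D" "0 \<le> snd p" "snd p \<le> 1" if "p \<in> ?W" for p
      using that by (auto simp: lid_def)
    have top: "H i (drop_coord i (fst p), snd p) = v (fst p)" if "i \<le> Suc n" "p \<in> ?W" "fst p i = 0" "snd p = 1" for i p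
      using tip[OF that(1) drop_coord_in_simplex[OF WD(1)[OF that(2)] that(1,3)]]
        simplex_push_drop_coord[OF WD(1)[OF that(2)] that(1,3)] that(4) by simp
    have "\<exists>w. continuous_map (top_of_set ?W) Y w \<and> (\<forall>i\<in>{..Suc (Suc n)}. \<forall>p\<in>T i. w p = f i p)"
    proof (rule paste_finite_closed)
      show "?W \<subseteq> (\<Union>i\<in>{..Suc (Suc n)}. T i)"
      proof
        fix p assume p: "p \<in> ?W"
        then consider "snd p = 1" | i where "i \<le> Suc n" "fst p i = 0"
          by (auto simp: lid_def simplex_boundary_def)
        then show "p \<in> (\<Union>i\<in>{..Suc (Suc n)}. T i)"
        proof cases
          case 1
          then have "p \<in> T (Suc (Suc n))" using p by (simp add: T_def)
          then show ?thesis by blast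
        next
          case (2 i)
          then have "p \<in> T i" using p by (simp add: T_def)
          then show ?thesis using 2 by (intro UN_I[of i]) auto
        qed
      qed
      show "T i \<subseteq> ?W \<and> closedin (top_of_set ?W) (T i)" for i
      proof (cases "i \<le> Suc n")
        case True
        then show ?thesis
          using closedin_level[of ?W "\<lambda>p. fst p i" 0] continuous_on_coord(2)[of ?W i] by (auto simp: T_def)
      next
        case False
        then show ?thesis
          using closedin_level[of ?W snd 1] continuous_on_snd[OF continuous_on_id, of ?W] by (auto simp: T_def)
      qed
      show "continuous_map (top_of_set (T i)) Y (f i)" if "i \<in> {..Suc (Suc n)}" for i
      proof (cases "i \<le> Suc n")
        case True
        have "continuous_map (top_of_set {p \<in> ?W. fst p i = 0}) Y (\<lambda>p. H i (drop_coord i (fst p), snd p))"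
        proof (rule continuous_map_compose_on[OF H(1)[OF True]])
          show "continuous_on {p \<in> ?W. fst p i = 0} (\<lambda>p. (drop_coord i (fst p), snd p))"
            by (intro continuous_on_Pair continuous_on_drop_coord continuous_on_fst continuous_on_snd continuous_on_id)
          show "(drop_coord i (fst p), snd p) \<in> cyl n" if "p \<in> {p \<in> ?W. fst p i = 0}" for p
            using that drop_coord_in_simplex[OF WD(1) True] WD by simp
        qed
        then show ?thesis using True by (simp add: T_def f_def)
      next
        case False
        have "continuous_map (top_of_set {p \<in> ?W. snd p = 1}) Y (\<lambda>p. v (fst p))"
          by (rule continuous_map_compose_on[of ?D Y v, OF _ continuous_on_fst[OF continuous_on_id]])
             (use v WD in \<open>auto simp: simplices_Sing\<close>)
        then show ?thesis using False by (simp add: T_def f_def)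
      qed
      show "f i p = f j p" if "i \<in> {..Suc (Suc n)}" "j \<in> {..Suc (Suc n)}" "p \<in> T i" "p \<in> T j" for i j p
        using that agree'[of "fst p" i j] WD[of p] top[of i p] top[of j p]
        by (cases "i \<le> Suc n"; cases "j \<le> Suc n") (simp_all add: T_def f_def)
    qed simp
    then obtain w where w: "continuous_map (top_of_set ?W) Y w" "\<And>i p. i \<le> Suc (Suc n) \<Longrightarrow> p \<in> T i \<Longrightarrow> w p = f i p" by auto
    have w_wall: "w (x, s) = H i (drop_coord i x, s)" if "i \<le> Suc n" "x \<in> ?D" "x i = 0" "0 \<le> s" "s \<le> 1" for i x s
    proof -
      have "x \<in> ?B" using that by (auto simp: simplex_boundary_def)
      then have "(x, s) \<in> T i" using that by (auto simp: T_def lid_def)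
      then show ?thesis using w(2)[of i "(x, s)"] that by (simp add: f_def)
    qed
    have w_lid: "w (x, 1) = v x" if "x \<in> ?D" for x
    proof -
      have "(x, 1) \<in> T (Suc (Suc n))" using that by (auto simp: T_def lid_def)
      then show ?thesis using w(2)[of "Suc (Suc n)" "(x, 1)"] by (simp add: f_def)
    qed
    have vert: "\<exists>j k. j \<le> Suc n \<and> k \<le> n \<and> std_vertex i j = (0 :: real) \<and> drop_coord j (std_vertex i) = std_vertex k" if "i \<le> Suc n" for i
    proof (cases "i = 0")
      case True
      then show ?thesis by (intro exI[of _ "Suc n"] exI[of _ 0]) (auto simp: drop_coord_def fun_eq_iff)
    next
      case False
      then show ?thesis using that by (intro exI[of _ 0] exI[of _ "i - 1"]) (auto simp: drop_coord_def fun_eq_iff)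
    qed
    have vertex_bd: "std_vertex i \<in> ?B" if "i \<le> Suc n" for i
    proof -
      have "\<exists>k\<le>Suc n. std_vertex i k = (0 :: real)"
      proof (cases "i = 0")
        case True
        then show ?thesis by (intro exI[of _ 1]) simp
      next
        case False
        then show ?thesis by (intro exI[of _ 0]) simp
      qed
      then show ?thesis using that by (simp add: simplex_boundary_def)
    qed
    have \<alpha>_b: "\<alpha> (std_vertex i) = b" if "i \<le> Suc n" for i
    proof -
      from vert[OF that] obtain j k where jk: "j \<le> Suc n" "k \<le> n" "std_vertex i j = (0 :: real)"
        "drop_coord j (std_vertex i) = std_vertex k" by blast
      then show ?thesis using \<alpha>(2)[OF jk(1) vertex_bd[OF that] jk(3)] \<sigma>(2)[OF jk(1,2)] by (simp only:)
    qed
    have w_b: "w (std_vertex i, s) = g b" if "i \<le> Suc n" "s \<in> {0..1}" for i s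
    proof -
      from vert[OF that(1)] obtain j k where jk: "j \<le> Suc n" "k \<le> n" "std_vertex i j = (0 :: real)"
        "drop_coord j (std_vertex i) = std_vertex k" by blast
      then show ?thesis
        using w_wall[OF jk(1) boundary_subset[OF vertex_bd[OF that(1)]] jk(3), of s] H(3)[OF jk(1,2) that(2)] that(2) by simp
    qed
    have "w (x, 0) = g (\<alpha> x)" if x: "x \<in> ?B" for x
    proof -
      obtain i where i: "i \<le> Suc n" "x i = 0" using x by (auto simp: simplex_boundary_def)
      then show ?thesis
        using w_wall[OF i(1) boundary_subset[OF x] i(2), of 0] \<alpha>(2)[OF i(1) x i(2)]
          H(2)[OF i(1) drop_coord_in_simplex[OF boundary_subset[OF x] i]] by simp
    qed
    with w(1) solvable_weak_homotopy_equivalence[OF g b \<alpha>(1) \<alpha>_b]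
    obtain \<alpha>' W where \<alpha>': "continuous_map (top_of_set ?D) X \<alpha>'" "\<And>x. x \<in> ?B \<Longrightarrow> \<alpha>' x = \<alpha> x"
      and W: "continuous_map (top_of_set (cyl (Suc n))) Y W" "\<And>p. p \<in> ?W \<Longrightarrow> W p = w p" "\<And>x. x \<in> ?D \<Longrightarrow> W (x, 0) = g (\<alpha>' x)"
      unfolding solvable_def by blast
    define y where "y = (restrict \<alpha>' ?D, restrict W (cyl (Suc n)))"
    have "continuous_map (top_of_set ?D) X (restrict \<alpha>' ?D)" "continuous_map (top_of_set (cyl (Suc n))) Y (restrict W (cyl (Suc n)))"
      by (rule continuous_map_top_of_set_cong[OF \<alpha>'(1)], simp) (rule continuous_map_top_of_set_cong[OF W(1)], simp)
    moreover have "(std_vertex i, s) \<in> ?W" if "i \<le> Suc n" "s \<in> {0..1}" for i s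
      using vertex_bd[OF that(1)] boundary_subset[OF vertex_bd[OF that(1)]] that(2) by (simp add: lid_def)
    ultimately have "y \<in> simplices ?P (Suc n)"
      using W(2,3) w_b \<alpha>'(2)[OF vertex_bd] \<alpha>_b by (simp add: y_def simplices_path_sset simplices_Sing)
    moreover have "path_end (Suc n) y = v"
    proof (rule extensionalityI[of _ ?D])
      show "path_end (Suc n) y \<in> extensional ?D" "v \<in> extensional ?D"
        using v by (simp_all add: path_end_def y_def simplices_Sing)
      show "path_end (Suc n) y x = v x" if "x \<in> ?D" for x
        using W(2)[of "(x, 1)"] w_lid[OF that] that by (simp add: path_end_def y_def lid_def)
    qed
    moreover have "act ?P (Suc n) n (coface (Suc n) i) y = z i" if i: "i \<le> Suc n" for i
    proof -
      let ?p = "simplex_push n (coface (Suc n) i)"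
      have p: "?p t \<in> ?D" "?p t i = 0" "?p t \<in> ?B" if "t \<in> standard_simplex n" for t
      proof -
        show p: "?p t \<in> ?D" by (rule simplex_push_in_standard_simplex[OF coface_Delta[OF i] that])
        show 0: "?p t i = 0" by (simp add: simplex_push_coface)
        show "?p t \<in> ?B" using p 0 i by (auto simp: simplex_boundary_def)
      qed
      have "(\<lambda>t\<in>standard_simplex n. restrict \<alpha>' ?D (?p t)) = \<sigma> i"
        by (rule extensionalityI[of _ "standard_simplex n"])
           (use ext[OF i] p \<alpha>'(2) \<alpha>(2)[OF i] drop_coord_push[OF _ i] in simp_all)
      moreover have "(\<lambda>q\<in>cyl n. restrict W (cyl (Suc n)) (?p (fst q), snd q)) = H i"
      proof (rule extensionalityI[of _ "cyl n"])
        fix q assume "q \<in> cyl n"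
        then have q: "fst q \<in> standard_simplex n" "0 \<le> snd q" "snd q \<le> 1" by auto
        have "(?p (fst q), snd q) \<in> ?W" using p[OF q(1)] q by (simp add: lid_def)
        then have "W (?p (fst q), snd q) = H i q"
          using W(2) w_wall[OF i p(1,2)[OF q(1)] q(2,3)] drop_coord_push[OF q(1) i] by simp
        then show "(\<lambda>q\<in>cyl n. restrict W (cyl (Suc n)) (?p (fst q), snd q)) q = H i q"
          using \<open>q \<in> cyl n\<close> p(1)[OF q(1)] q by simp
      qed (use ext[OF i] in simp_all)
      ultimately show ?thesis
        unfolding y_def act_path_sset act_Sing z_eq by simp
    qed
    ultimately show "\<exists>y\<in>simplices ?P (Suc n). path_end (Suc n) y = v \<and>
        (\<forall>i\<le>Suc n. act ?P (Suc n) n (coface (Suc n) i) y = z i)" by blast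
  }
qed

section \<open>The map of singular simplices of a weak equivalence is a homotopy equivalence\<close>

lemma sset_map_compose:
  assumes "sset_map X Y f" "sset_map Y Z h"
  shows "sset_map X Z (\<lambda>n x. h n (f n x))"
  unfolding sset_map_def using sset_mapD[OF assms(1)] sset_mapD[OF assms(2)] by metis

lemma simplicial_homotopy_compose:
  assumes H: "simplicial_homotopy X Y u v H" and a: "sset_map X' X a" and c: "sset_map Y Y' c"
  shows "simplicial_homotopy X' Y' (\<lambda>n x. c n (u n (a n x))) (\<lambda>n x. c n (v n (a n x))) (\<lambda>n (x, \<alpha>). c n (H n (a n x, \<alpha>)))"
  unfolding simplicial_homotopy_def
proof (intro conjI allI ballI)
  have H': "sset_map (prism X) Y H" using H by (simp add: simplicial_homotopy_def)
  have "sset_map (prism X') (prism X) (\<lambda>n (x, \<alpha>). (a n x, \<alpha>))"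
    unfolding sset_map_def
  proof (intro conjI allI ballI)
    fix n y assume y: "y \<in> simplices (prism X') n"
    then obtain x \<alpha> where xx: "y = (x, \<alpha>)" "x \<in> simplices X' n" "\<alpha> \<in> Delta n 1" by auto
    then show "(case y of (x, \<alpha>) \<Rightarrow> (a n x, \<alpha>)) \<in> simplices (prism X) n"
      using sset_mapD(1)[OF a xx(2)] by simp
    fix m \<theta> assume "\<theta> \<in> Delta m n"
    from sset_mapD(2)[OF a xx(2) this]
    show "(case act (prism X') n m \<theta> y of (x, \<alpha>) \<Rightarrow> (a m x, \<alpha>)) = act (prism X) n m \<theta> (case y of (x, \<alpha>) \<Rightarrow> (a n x, \<alpha>))"
      by (simp add: xx(1))
  qed
  from sset_map_compose[OF sset_map_compose[OF this H'] c]
  show "sset_map (prism X') Y' (\<lambda>n (x, \<alpha>). c n (H n (a n x, \<alpha>)))"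
    by (simp add: case_prod_unfold)
  fix n x assume x: "x \<in> simplices X' n"
  show "(case (x, const_map n 0) of (x, \<alpha>) \<Rightarrow> c n (H n (a n x, \<alpha>))) = c n (u n (a n x))"
    "(case (x, const_map n 1) of (x, \<alpha>) \<Rightarrow> c n (H n (a n x, \<alpha>))) = c n (v n (a n x))"
    using H sset_mapD(1)[OF a x] by (simp_all add: simplicial_homotopy_def)
next
  fix x assume x: "x \<in> simplices X' 0"
  have "codegen 0 0 \<in> Delta 1 0" using codegen_Delta[of 0 0] by simp
  then have "a 1 (act X' 0 1 (codegen 0 0) x) = act X 0 1 (codegen 0 0) (a 0 x)"
    by (rule sset_mapD(2)[OF a x])
  moreover have "degenerate Y 1 (H 1 (act X 0 1 (codegen 0 0) (a 0 x), step_map 1 0))"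
    using H sset_mapD(1)[OF a x] by (simp add: simplicial_homotopy_def)
  ultimately show "degenerate Y' 1 (case (act X' 0 1 (codegen 0 0) x, step_map 1 0) of (x, \<alpha>) \<Rightarrow> c 1 (H 1 (a 1 x, \<alpha>)))"
    using degenerate_sset_map[OF c] by simp
qed

lemma simplicial_homotopy_cong:
  assumes "simplicial_homotopy X Y u v H"
    and "\<And>n x. x \<in> simplices X n \<Longrightarrow> u' n x = u n x" "\<And>n x. x \<in> simplices X n \<Longrightarrow> v' n x = v n x"
  shows "simplicial_homotopy X Y u' v' H"
  using assms unfolding simplicial_homotopy_def by simp

text \<open>The fraction of a path that remains at a point of a simplex of the prism: the realization of the
  projection to the standard 1-simplex, with the unit interval as coordinate.\<close>

definition path_length :: "nat \<Rightarrow> (nat \<Rightarrow> nat) \<Rightarrow> (nat \<Rightarrow> real) \<Rightarrow> real" where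
  "path_length n \<alpha> x = simplex_push n \<alpha> x 1"

definition contract_path :: "nat \<Rightarrow> (((nat \<Rightarrow> real) \<Rightarrow> 'a) \<times> ((nat \<Rightarrow> real) \<times> real \<Rightarrow> 'b)) \<times> (nat \<Rightarrow> nat) \<Rightarrow>
    ((nat \<Rightarrow> real) \<Rightarrow> 'a) \<times> ((nat \<Rightarrow> real) \<times> real \<Rightarrow> 'b)" where
  "contract_path n = (\<lambda>((\<sigma>, H), \<alpha>). (\<sigma>, \<lambda>p\<in>cyl n. H (fst p, snd p * path_length n \<alpha> (fst p))))"

lemma path_length_bounds:
  assumes "\<alpha> \<in> Delta n 1" "x \<in> standard_simplex n"
  shows "0 \<le> path_length n \<alpha> x" "path_length n \<alpha> x \<le> 1"
  using standard_simplexD(1,2)[OF simplex_push_in_standard_simplex[OF assms]] by (simp_all add: path_length_def)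

lemma path_length_const:
  assumes "x \<in> standard_simplex n"
  shows "path_length n (const_map n 0) x = 0" "path_length n (const_map n 1) x = 1"
proof -
  have "{i. i \<le> n \<and> const_map n 0 i = 1} = {}" "{i. i \<le> n \<and> const_map n 1 i = (1 :: nat)} = {..n}"
    by (auto split: if_splits)
  then show "path_length n (const_map n 0) x = 0" "path_length n (const_map n 1) x = 1"
    using standard_simplexD(4)[OF assms] by (simp_all only: path_length_def simplex_push_def) simp_all
qed

lemma simplicial_homotopy_contract_path:
  assumes g: "continuous_map X Y g"
  shows "simplicial_homotopy (path_sset X Y g b) (path_sset X Y g b)
    (\<lambda>n x. const_path g n (fst x)) (\<lambda>n x. x) contract_path"
  unfolding simplicial_homotopy_def
proof (intro conjI allI ballI)
  let ?P = "path_sset X Y g b"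
  show "sset_map (prism ?P) ?P contract_path"
    unfolding sset_map_def
  proof (intro conjI allI ballI)
    fix n y assume y: "y \<in> simplices (prism ?P) n"
    obtain \<sigma> H \<alpha> where yy: "y = ((\<sigma>, H), \<alpha>)" by (metis surj_pair)
    have \<alpha>: "\<alpha> \<in> Delta n 1" and P: "(\<sigma>, H) \<in> simplices ?P n" using y by (simp_all add: yy)
    note HH = P[unfolded simplices_path_sset]
    have len: "0 \<le> s * path_length n \<alpha> x" "s * path_length n \<alpha> x \<le> 1" if "x \<in> standard_simplex n" "0 \<le> s" "s \<le> 1" for x s
      using path_length_bounds[OF \<alpha> that(1)] that by (simp_all add: mult_le_one)
    have "continuous_map (top_of_set (cyl n)) Y (\<lambda>p. H (fst p, snd p * path_length n \<alpha> (fst p)))"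
    proof (rule continuous_map_compose_on[of "cyl n" Y H])
      show "continuous_on (cyl n) (\<lambda>p. (fst p, snd p * path_length n \<alpha> (fst p)))"
        unfolding path_length_def
        by (intro continuous_on_Pair continuous_on_mult continuous_on_simplex_push continuous_on_fst continuous_on_snd continuous_on_id)
    qed (use HH len in \<open>auto simp: mem_Times_iff\<close>)
    then have "continuous_map (top_of_set (cyl n)) Y (\<lambda>p\<in>cyl n. H (fst p, snd p * path_length n \<alpha> (fst p)))"
      by (rule continuous_map_top_of_set_cong) simp
    then show "contract_path n y \<in> simplices ?P n"
      using HH len by (simp add: yy contract_path_def simplices_path_sset)
    fix m \<theta> assume \<theta>: "\<theta> \<in> Delta m n"
    show "contract_path m (act (prism ?P) n m \<theta> y) = act ?P n m \<theta> (contract_path n y)"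
      using simplex_push_in_standard_simplex[OF \<theta>] len
      by (auto simp: yy contract_path_def act_path_sset fun_eq_iff path_length_def simplex_push_compose[OF \<alpha> \<theta>, symmetric]
          path_length_def[symmetric] simplex_push_in_standard_simplex[OF \<theta>] path_length_bounds[OF \<alpha>] mult_le_one)
  qed
  fix n x assume x: "x \<in> simplices ?P n"
  obtain \<sigma> H where xx: "x = (\<sigma>, H)" by (cases x)
  note HH = x[unfolded xx simplices_path_sset]
  show "contract_path n (x, const_map n 0) = const_path g n (fst x)"
    using HH by (auto simp: xx contract_path_def const_path_def path_length_const fun_eq_iff)
  show "contract_path n (x, const_map n 1) = x"
    using HH by (auto simp: xx contract_path_def path_length_const[simplified] fun_eq_iff extensional_def)
next
  let ?P = "path_sset X Y g b"
  fix x assume x: "x \<in> simplices ?P 0"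
  have cg: "codegen 0 0 \<in> Delta 1 0" using codegen_Delta[of 0 0] by simp
  let ?s = "act ?P 0 1 (codegen 0 0) x"
  obtain \<sigma> H where xx: "x = (\<sigma>, H)" by (cases x)
  have "x = const_path g 0 (\<lambda>t\<in>standard_simplex 0. b)" by (rule simplices_path_sset_0[OF x])
  then have Hc: "H p = g b" if "p \<in> cyl 0" for p using that by (auto simp: xx const_path_def)
  have "contract_path 1 (?s, step_map 1 0) = ?s"
    using simplex_push_in_standard_simplex[OF cg] path_length_bounds[OF step_map_Delta(2)[of 1 0]]
    by (auto simp: xx act_path_sset contract_path_def fun_eq_iff Hc mult_le_one)
  then show "degenerate ?P 1 (contract_path 1 (?s, step_map 1 0))"
    unfolding degenerate_def using x by auto
qed

text \<open>The homotopy inverse sends a simplex to the source of its lift along the end point map. One of the two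
  homotopies is the contraction of paths, applied to lifts; the other one is that between the section after
  the end point map and the identity, applied to constant paths.\<close>

theorem omega_quasi_iso_Sing:
  assumes g: "weak_homotopy_equivalence X Y g" and b: "b \<in> topspace X"
  shows "omega_quasi_iso (Q_Delta (Sing X b) :: (_, 'k::comm_ring_1) dgc) (Q_Delta (Sing Y (g b)))
    (Q_Delta_map (Sing Y (g b)) (\<lambda>n. simplex_map n g))"
proof -
  have cont: "continuous_map X Y g" using g by (simp add: weak_homotopy_equivalence_def)
  have gb: "g b \<in> topspace Y" using cont b by (auto simp: continuous_map_def)
  let ?K = "Sing X b" and ?L = "Sing Y (g b)" and ?P = "path_sset X Y g b"
  note i = sset_map_const_path[OF cont, of b] and q = sset_map_path_source[of X Y g b] and e = sset_map_path_end[of X Y g b]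
  obtain s H where s: "sset_map ?L ?P s" "\<And>n y. y \<in> simplices ?L n \<Longrightarrow> path_end n (s n y) = y"
    and H: "simplicial_homotopy ?P ?P (\<lambda>n x. s n (path_end n x)) (\<lambda>n x. x) H"
    using trivial_fibration_homotopy_inverse[OF reduced_path_sset[OF cont b] simplicial_set_Sing trivial_fibration_path_end[OF g b]]
    by blast
  have f: "sset_map ?K ?L (\<lambda>n. simplex_map n g)"
    using sset_map_compose[OF i e] by (simp add: path_end_const_path)
  have r: "sset_map ?L ?K (\<lambda>n y. fst (s n y))"
    by (rule sset_map_compose[OF s(1) q])
  have 1: "simplicial_homotopy ?K ?K (\<lambda>n x. fst (s n (simplex_map n g x))) (\<lambda>n x. x)
      (\<lambda>n (x, \<alpha>). fst (H n (const_path g n x, \<alpha>)))"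
    using simplicial_homotopy_compose[OF H i q]
    by (rule simplicial_homotopy_cong) (simp_all add: path_end_const_path)
  have 2: "simplicial_homotopy ?L ?L (\<lambda>n y. simplex_map n g (fst (s n y))) (\<lambda>n y. y)
      (\<lambda>n (y, \<alpha>). path_end n (contract_path n (s n y, \<alpha>)))"
    using simplicial_homotopy_compose[OF simplicial_homotopy_contract_path[OF cont] s(1) e]
    by (rule simplicial_homotopy_cong) (simp_all add: path_end_const_path s(2))
  show ?thesis
    by (rule omega_quasi_iso_homotopy_equivalence[where f = "\<lambda>n. simplex_map n g" and r = "\<lambda>n y. fst (s n y)", OF reduced_Sing[OF b] reduced_Sing[OF gb] f r 1 2])
qed

theorem proposition8p3:
  fixes S :: "'a sset" and S' :: "'b sset" and f :: "nat \<Rightarrow> 'a \<Rightarrow> 'b"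
  assumes "reduced_sset S" and "reduced_sset S'"
    and "sset_map S S' f"
    and "kan_weak_equivalence S S' f"
  shows "omega_quasi_iso (QK S :: (_, 'k::comm_ring_1) dgc) (QK S') (QK_map S' f)"
proof -
  let ?x = "the_elem (simplices S 0)" and ?x' = "the_elem (simplices S' 0)"
  have x: "?x \<in> simplices S 0" using reduced_ssetD(2)[OF assms(1)] by (metis insertI1)
  have "f 0 ?x \<in> simplices S' 0" by (rule sset_mapD(1)[OF assms(3) x])
  then have fx: "f 0 ?x = ?x'" using reduced_ssetD(2)[OF assms(2)] by (metis singletonD)
  have v: "std_vertex 0 \<in> standard_simplex 0" by simp
  have base: "realization_map S' f (realization_base S) = realization_base S'"
    unfolding realization_base_def using realization_map_class[OF assms(3) x v] fx by simp
  have "realization_base S \<in> topspace (realization S)"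
    unfolding realization_base_def realization_def topspace_quotient_topology[OF equiv_glue_equiv]
    by (rule quotientI) (use x v in \<open>simp add: in_pre_realization\<close>)
  moreover have "weak_homotopy_equivalence (realization S) (realization S') (realization_map S' f)"
    using assms(4) by (simp add: kan_weak_equivalence_def)
  ultimately show ?thesis
    unfolding QK_def QK_map_def Sing_realization_def base[symmetric] by (intro omega_quasi_iso_Sing)
qed

end
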